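(* Let $\mathbf{w}\in\mathcal{V}$ have length $k$, and let $\mathcal{T}_{\mathbf{w}}$ be the canonical triangulation of $\mathcal{O}(Q_{\mathbf{w}})$. Then $\mathcal{T}_{\mathbf{w}}$ is a regular triangulation, induced by the canonical height function $\omega(x_i)=2^{\rho(x_i)}$. Furthermore, for any twist $\tau\in\mathfrak{T}(\mathbf{w})$, $\tau(\mathcal{T}_{\mathbf{w}})$ is a regular triangulation of $\mathcal{O}(Q_{\mathbf{w}})$, induced by the twisted height function $\omega_\tau(x_i)=\omega(\tau(x_i))$.
   Context: A generalized snake word of length $k\ge 0$ is a word $\mathbf{w}=w_0w_1\cdots w_k$ where $w_0=\varepsilon$ is the empty letter and $w_i\in\{L,R\}$ for $1\le i\le k$. $\mathcal{V}$ is the set of generalized snake words that do not contain $LRL$ or $RLR$ as a (contiguous) substring. The generalized snake poset $P(\mathbf{w})$ is defined recursively ($\prec$ denotes a cover relation). $P(\varepsilon)$ is the poset on $\{0,1,2,3\}$ with cover relations $1\prec 0$, $2\prec 0$, $3\prec 1$, $3\prec 2$. For $n\ge 1$, $P(w_0\cdots w_n)$ is $P(w_0\cdots w_{n-1})\cup\{2n+2,2n+3\}$ with the added cover relations $2n+3\prec 2n+1$, $2n+3\prec 2n+2$, and: $2n+2\prec 2n-1$ if ($n=1$ and $w_n=L$) or ($n\ge2$ and $w_{n-1}w_n\in\{RL,LR\}$); $2n+2\prec 2n$ if ($n=1$ and $w_n=R$) or ($n\ge 2$ and $w_{n-1}w_n\in\{LL,RR\}$). $\widehat{P}(\mathbf{w})$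 is $P(\mathbf{w})$ with a new minimum $\widehat 0$ and a new maximum $\widehat 1$ adjoined; it is a distributive lattice with $2k+6$ elements. $Q_{\mathbf{w}}$ is the poset of meet-irreducible elements of $\widehat P(\mathbf{w})$ (elements $\ne\widehat 1$ covered by exactly one element), with the induced order. The order polytope is $\mathcal{O}(Q)=\{x\in[0,1]^Q: x_i\le x_j \text{ whenever } i<_Q j\}$; its vertices are the indicator vectors of the filters of $Q$. Let $V_0$ be the set of elements of $\widehat P(\mathbf{w})$; identify $x\in V_0$ with the filter $\{q\in Q_{\mathbf{w}}: q\ge x\}$ and hence with a vertex of $\mathcal{O}(Q_{\mathbf{w}})$ (a bijection). The canonical triangulation $\mathcal{T}_{\mathbf{w}}$ is the one whose maximal simplices are spanned by the vertices in the maximal chains of $\widehat P(\mathbf{w})$. Squares and ladders. $\mathrm{Sq}(w_0)=\{0,1,2,3\}$; for $i\ge1$, $\mathrm{Sq}(w_i)=\{y,2i+1,2i+2,2i+3\}$, where $y$ is the element covering $2i+2$ in $P(\mathbf{w})$. Let $c_1<\dots<c_{t-1}$ be the indices $c$ with $1\le c\le k-1$ and $w_c\ne w_{c+1}$, and put $c_0=0$, $c_t=k$. For $1\le r\le t$ the ladder $\mathcal{L}^r$ is the subposet of $\widehat P(\mathbf{w})$ on $\bigcup_{j=c_{r-1}}^{c_r}\mathrm{Sq}(w_j)$. For each ladder, label its elements $y_1,\dots,y_s$ so that its cover relations are exactly $y_{j+2}\prec y_j$ for $1\le j\le s-2$ and $y_{2j}\prec y_{2j-1}$ for $1\le j\le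 s/2$ (this determines the labeling if the ladder has at least two squares; if $\mathbf{w}=\varepsilon$, take $y_1=0,y_2=1,y_3=2,y_4=3$). The pairs $\{y_{2j-1},y_{2j}\}$ are the rungs of the ladder. The elementary twist $\tau_r$ is the permutation of $V_0$ exchanging the two elements of each rung of $\mathcal{L}^r$ and fixing all other elements. The twist group $\mathfrak{T}(\mathbf{w})$ is the group of permutations of $V_0$ generated by $\tau_1,\dots,\tau_t$; its elements are called twists. For a triangulation $\mathcal{T}$, $\tau(\mathcal{T})$ is the collection of subsets obtained by applying $\tau$ to the vertex set of every simplex of $\mathcal{T}$. Heights. Label the elements of $\widehat P(\mathbf{w})$ as $x_0,\dots,x_{2k+5}$: $x_0=\widehat 1$ (corresponding to the empty filter), $x_{2k+5}=\widehat 0$; the elements of $\mathcal{L}^1$ are labeled $x_j=y_j$ for $1\le j\le s$, where $y_1,\dots,y_s$ is the labeling of the elements of $\mathcal{L}^1$ for which the cover relations of $\mathcal{L}^1$ are exactly $y_{j+2}\prec y_j$ for $1\le j\le s-2$ and $y_{2j}\prec y_{2j-1}$ for $1\le j\le s/2$ (with $y_1=0,y_2=1,y_3=2,y_4=3$ if $\mathbf{w}=\varepsilon$); then, for $\mathcal{L}^2,\mathcal{L}^3,\dots$ in turn, the not yet labeled rungs are labeled consecutively from top to bottom with the next two indices, the upper element of the rung receiving the smaller (odd) index. (Explicitly, $x_m$ is the element $m-1$ of $P(\mathbf{w})$ for $1\le m\le 2k+4$, except that when $w_1=L$ one has $x_2=2$ and $x_3=1$.) The canonical order is $x_0,x_2,x_1,x_4,x_3,\dots,x_{2k+4},x_{2k+3},x_{2k+5}$,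 and $\rho(x_i)=m-1$ if $x_i$ is the $m$-th element in this order. The canonical height function is $\omega(x_i)=2^{\rho(x_i)}$. A triangulation of $\mathcal{O}(Q_{\mathbf{w}})$ (using only its vertices) is regular, induced by a height function $\omega$ on the vertices, if it is the projection of the lower envelope of the convex hull of the lifted points $(v,\omega(v))$. *)

theory Defs
  imports
    "HOL-Analysis.Analysis"
    "HOL-Analysis.Finite_Function_Topology"
    "HOL-Library.Sublist"
    "HOL-Algebra.Bij"
    "HOL-Algebra.Generated_Groups"
begin

section \<open>Order polytopes\<close>

text \<open>
  The space of real vectors indexed by a finite set \<open>Q\<close> is the set of
  \<open>x :: 'a \<Rightarrow>\<^sub>0 real\<close> whose support is contained in \<open>Q\<close>; it is a subspace of a library real vector
  space, for any \<open>Q\<close>. A poset is given by its carrier and its strict order.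
\<close>

definition order_polytope :: "'a set \<Rightarrow> ('a \<Rightarrow> 'a \<Rightarrow> bool) \<Rightarrow> ('a \<Rightarrow>\<^sub>0 real) set" where
  "order_polytope Q lt =
     {x. Poly_Mapping.keys x \<subseteq> Q \<and>
         (\<forall>i\<in>Q. 0 \<le> Poly_Mapping.lookup x i \<and> Poly_Mapping.lookup x i \<le> 1) \<and>
         (\<forall>i\<in>Q. \<forall>j\<in>Q. lt i j \<longrightarrow> Poly_Mapping.lookup x i \<le> Poly_Mapping.lookup x j)}"

definition covers_in :: "'a set \<Rightarrow> ('a \<Rightarrow> 'a \<Rightarrow> bool) \<Rightarrow> 'a \<Rightarrow> 'a \<Rightarrow> bool" where
  "covers_in A lt x y \<longleftrightarrow>
     x \<in> A \<and> y \<in> A \<and> lt x y \<and> \<not> (\<exists>z\<in>A. lt x z \<and> lt z y)"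


section \<open>Regular triangulations\<close>

text \<open>
  The vertices of a polytope \<open>S\<close> are labelled by the elements of \<open>V\<close>, the label \<open>v\<close> standing for the
  point \<open>p v\<close>. A triangulation is the collection of the vertex sets (as sets of labels) of all its
  simplices, the empty one included.
\<close>

definition triangulation_of ::
  "'a set \<Rightarrow> ('a \<Rightarrow> 'v::real_vector) \<Rightarrow> 'v set \<Rightarrow> 'a set set \<Rightarrow> bool" where
  "triangulation_of V p S \<T> \<longleftrightarrow>
     bij_betw p V {x. x extreme_point_of S} \<and>
     (\<forall>\<sigma>\<in>\<T>. \<sigma> \<subseteq> V \<and> \<not> affine_dependent (p ` \<sigma>)) \<and>
     (\<forall>\<sigma>\<in>\<T>. \<forall>\<sigma>'. \<sigma>' \<subseteq> \<sigma> \<longrightarrow> \<sigma>' \<in> \<T>) \<and>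
     (\<forall>\<sigma>\<in>\<T>. \<forall>\<sigma>'\<in>\<T>.
        convex hull (p ` \<sigma>) \<inter> convex hull (p ` \<sigma>') = convex hull (p ` (\<sigma> \<inter> \<sigma>'))) \<and>
     (\<Union>\<sigma>\<in>\<T>. convex hull (p ` \<sigma>)) = S"

definition lifted_polytope ::
  "'a set \<Rightarrow> ('a \<Rightarrow> 'v::real_vector) \<Rightarrow> ('a \<Rightarrow> real) \<Rightarrow> ('v \<times> real) set" where
  "lifted_polytope V p h = convex hull ((\<lambda>v. (p v, h v)) ` V)"

definition lower_envelope :: "('v \<times> real) set \<Rightarrow> ('v \<times> real) set" where
  "lower_envelope S = {(x, t). (x, t) \<in> S \<and> (\<forall>s. (x, s) \<in> S \<longrightarrow> t \<le> s)}"

text \<open>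
  The simplices are the projections of the lower faces, i.e. of the faces of the lifted polytope
  lying on its lower envelope. Both sides contain the empty set, since
  \<^const>\<open>face_of\<close> admits the empty face.
\<close>

definition induced_by ::
  "'a set \<Rightarrow> ('a \<Rightarrow> 'v::real_vector) \<Rightarrow> 'a set set \<Rightarrow> ('a \<Rightarrow> real) \<Rightarrow> bool" where
  "induced_by V p \<T> h \<longleftrightarrow>
     (\<lambda>\<sigma>. convex hull (p ` \<sigma>)) ` \<T> =
     (\<lambda>F. fst ` F) ` {F. F face_of lifted_polytope V p h \<and>
                         F \<subseteq> lower_envelope (lifted_polytope V p h)}"

definition regular_triangulation_induced_by ::
  "'a set \<Rightarrow> ('a \<Rightarrow> 'v::real_vector) \<Rightarrow> 'v set \<Rightarrow> 'a set set \<Rightarrow> ('a \<Rightarrow> real) \<Rightarrow> bool" where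
  "regular_triangulation_induced_by V p S \<T> h \<longleftrightarrow>
     triangulation_of V p S \<T> \<and> induced_by V p \<T> h"


section \<open>Generalized snake posets\<close>

datatype letter = L | R

text \<open>
  A word \<open>w\<^sub>0 w\<^sub>1 \<dots> w\<^sub>k\<close> is the list \<open>[w\<^sub>1, \<dots>, w\<^sub>k]\<close>: the empty letter \<open>w\<^sub>0\<close> is left implicit,
  and \<open>k\<close> is the length of the list.
\<close>

type_synonym snake_word = "letter list"

definition letter_at :: "snake_word \<Rightarrow> nat \<Rightarrow> letter" where
  "letter_at w i = w ! (i - 1)"

definition snake_words_V :: "snake_word set" where
  "snake_words_V = {w. \<not> sublist [L, R, L] w \<and> \<not> sublist [R, L, R] w}"

text \<open>
  \<open>snake_covers_upto w n\<close> consists of the pairs \<open>(x, y)\<close> with \<open>x\<close> covered by \<open>y\<close> in the poset of the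
  prefix \<open>w\<^sub>0 \<dots> w\<^sub>n\<close>, and \<open>side_cover w n\<close> is the element covering \<open>2n + 2\<close>.
\<close>

definition side_cover :: "snake_word \<Rightarrow> nat \<Rightarrow> nat" where
  "side_cover w n =
     (if (n = 1 \<and> letter_at w 1 = L) \<or> (n \<ge> 2 \<and> letter_at w (n - 1) \<noteq> letter_at w n)
      then 2 * n - 1 else 2 * n)"

primrec snake_covers_upto :: "snake_word \<Rightarrow> nat \<Rightarrow> (nat \<times> nat) set" where
  "snake_covers_upto w 0 = {(1, 0), (2, 0), (3, 1), (3, 2)}"
| "snake_covers_upto w (Suc m) =
     (let n = Suc m in
      snake_covers_upto w m \<union>
      {(2 * n + 3, 2 * n + 1), (2 * n + 3, 2 * n + 2), (2 * n + 2, side_cover w n)})"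

definition snake_covers :: "snake_word \<Rightarrow> (nat \<times> nat) set" where
  "snake_covers w = snake_covers_upto w (length w)"

datatype hat = Bot | El nat | Top

definition hatP :: "snake_word \<Rightarrow> hat set" where
  "hatP w = {Bot, Top} \<union> El ` {0..2 * length w + 3}"

fun hat_less :: "snake_word \<Rightarrow> hat \<Rightarrow> hat \<Rightarrow> bool" where
  "hat_less w Bot y \<longleftrightarrow> y \<noteq> Bot"
| "hat_less w (El a) Bot \<longleftrightarrow> False"
| "hat_less w (El a) (El b) \<longleftrightarrow> (a, b) \<in> (snake_covers w)\<^sup>+"
| "hat_less w (El a) Top \<longleftrightarrow> True"
| "hat_less w Top y \<longleftrightarrow> False"

definition meet_irreducibles :: "snake_word \<Rightarrow> hat set" where
  "meet_irreducibles w =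
     {x \<in> hatP w. x \<noteq> Top \<and> (\<exists>!y. covers_in (hatP w) (hat_less w) x y)}"

definition snake_polytope :: "snake_word \<Rightarrow> (hat \<Rightarrow>\<^sub>0 real) set" where
  "snake_polytope w = order_polytope (meet_irreducibles w) (hat_less w)"

text \<open>The indicator vector of the filter of all meet-irreducible \<open>q \<ge> x\<close>.\<close>

definition filter_vertex :: "snake_word \<Rightarrow> hat \<Rightarrow> (hat \<Rightarrow>\<^sub>0 real)" where
  "filter_vertex w x =
     (\<Sum>q \<in> {q \<in> meet_irreducibles w. hat_less w x q \<or> x = q}. Poly_Mapping.single q 1)"

definition canonical_triangulation :: "snake_word \<Rightarrow> hat set set" where
  "canonical_triangulation w =
     {\<sigma>. \<exists>C. pred_on.maxchain (hatP w) (hat_less w) C \<and> \<sigma> \<subseteq> C}"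


section \<open>Ladders and twists\<close>

definition square :: "snake_word \<Rightarrow> nat \<Rightarrow> nat set" where
  "square w i =
     (if i = 0 then {0, 1, 2, 3}
      else {y. (2 * i + 2, y) \<in> snake_covers w} \<union> {2 * i + 1, 2 * i + 2, 2 * i + 3})"

text \<open>The list \<open>[c\<^sub>0, \<dots>, c\<^sub>t]\<close>.\<close>

definition breaks :: "snake_word \<Rightarrow> nat list" where
  "breaks w = [0] @ filter (\<lambda>c. letter_at w c \<noteq> letter_at w (c + 1)) [1..<length w] @ [length w]"

definition num_ladders :: "snake_word \<Rightarrow> nat" where
  "num_ladders w = length (breaks w) - 1"

definition ladder :: "snake_word \<Rightarrow> nat \<Rightarrow> hat set" where
  "ladder w r = El ` (\<Union>j \<in> {breaks w ! (r - 1)..breaks w ! r}. square w j)"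

text \<open>The label \<open>y\<^sub>j\<close> (\<open>1 \<le> j \<le> s\<close>) is the entry \<open>ys ! (j - 1)\<close> of the list \<open>ys\<close> of length \<open>s\<close>.\<close>

definition is_ladder_labeling :: "snake_word \<Rightarrow> nat \<Rightarrow> hat list \<Rightarrow> bool" where
  "is_ladder_labeling w r ys \<longleftrightarrow>
     distinct ys \<and> set ys = ladder w r \<and>
     (let s = length ys; y = (\<lambda>j. ys ! (j - 1)) in
      {(a, b). covers_in (ladder w r) (hat_less w) a b} =
      {(y (j + 2), y j) | j. 1 \<le> j \<and> j + 2 \<le> s} \<union>
      {(y (2 * j), y (2 * j - 1)) | j. 1 \<le> j \<and> 2 * j \<le> s}) \<and>
     (w = [] \<longrightarrow> ys = [El 0, El 1, El 2, El 3])"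

definition ladder_labeling :: "snake_word \<Rightarrow> nat \<Rightarrow> hat list" where
  "ladder_labeling w r = (THE ys. is_ladder_labeling w r ys)"

definition rungs :: "snake_word \<Rightarrow> nat \<Rightarrow> hat set set" where
  "rungs w r =
     (let ys = ladder_labeling w r; y = (\<lambda>j. ys ! (j - 1)) in
      {{y (2 * j - 1), y (2 * j)} | j. 1 \<le> j \<and> 2 * j \<le> length ys})"

definition elementary_twist :: "snake_word \<Rightarrow> nat \<Rightarrow> hat \<Rightarrow> hat" where
  "elementary_twist w r =
     (\<lambda>x \<in> hatP w. if x \<in> \<Union>(rungs w r) then (THE z. {x, z} \<in> rungs w r) else x)"

text \<open>As in \<^const>\<open>BijGroup\<close>, permutations are extensional functions on \<open>hatP w\<close>.\<close>

definition twist_group :: "snake_word \<Rightarrow> (hat \<Rightarrow> hat) set" where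
  "twist_group w = generate (BijGroup (hatP w)) (elementary_twist w ` {1..num_ladders w})"

definition twist_triangulation :: "('a \<Rightarrow> 'a) \<Rightarrow> 'a set set \<Rightarrow> 'a set set" where
  "twist_triangulation \<tau> \<T> = (\<lambda>\<sigma>. \<tau> ` \<sigma>) ` \<T>"


section \<open>The canonical height function\<close>

text \<open>
  The element \<open>x\<^sub>m\<close>, for \<open>0 \<le> m \<le> 2k + 5\<close>. Labelling the ladders one after the other, rung by rung,
  gives the elements of the snake poset in their numerical order, except that the second element
  \<open>y\<^sub>2\<close> of the first ladder is 2 and the third is 1 if \<open>w\<^sub>1 = L\<close>.
\<close>

definition x_label :: "snake_word \<Rightarrow> nat \<Rightarrow> hat" where
  "x_label w m =
     (if m = 0 then Top
      else if m = 2 * length w + 5 then Bot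
      else if w \<noteq> [] \<and> letter_at w 1 = L \<and> m = 2 then El 2
      else if w \<noteq> [] \<and> letter_at w 1 = L \<and> m = 3 then El 1
      else El (m - 1))"

definition canonical_order :: "snake_word \<Rightarrow> hat list" where
  "canonical_order w =
     [x_label w 0] @
     concat (map (\<lambda>j. [x_label w (2 * j), x_label w (2 * j - 1)]) [1..<length w + 3]) @
     [x_label w (2 * length w + 5)]"

definition canonical_rank :: "snake_word \<Rightarrow> hat \<Rightarrow> nat" where
  "canonical_rank w x =
     (THE i. i < length (canonical_order w) \<and> canonical_order w ! i = x)"

definition canonical_height :: "snake_word \<Rightarrow> hat \<Rightarrow> real" where
  "canonical_height w x = 2 ^ canonical_rank w x"

end

theory Submission
  imports Defs
begin

text \<open>
  A point of the polytope may have many convex representations by vertices. Whenever two vertices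
  \<open>a\<close>, \<open>b\<close> in the support of a representation satisfy \<open>p a + p b = p c + p d\<close> with
  \<open>h c + h d < h a + h b\<close>, shifting weight from \<open>a, b\<close> to \<open>c, d\<close> lowers the height; for the canonical
  triangulation such an exchange exists for every incomparable pair, \<open>c\<close> and \<open>d\<close> being meet and join,
  because the vertex of largest rank among the four always belongs to the incomparable pair. Hence
  representations of minimal height are supported on chains, and chain-supported representations
  are unique. These two facts alone give the regular triangulation.

  Placing the square with top \<open>x\<close> at \<open>x + {0, 1}\<^sup>2\<close> embeds the snake poset into a two-dimensional
  grid. A twist exchanges two adjacent lines of this grid, and on the level of polytopes it is the
  linear toggle that replaces one coordinate \<open>x\<^sub>q\<close> by \<open>x\<^sub>q\<^sub>0 + x\<^sub>q\<^sub>1 - x\<^sub>q\<close>. As no word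
  in question contains \<open>LRL\<close> or \<open>RLR\<close>, the toggles commute, so that all twists are involutions induced by
  linear maps; the argument above is invariant under these.
\<close>

section \<open>Triangulations from uncrossing\<close>

text \<open>Why the largest rank lies in the incomparable pair: an odd element
  \<open>2 n + 3\<close> is the bottom of a square and lies below every element of smaller number.
  So the later element of an incomparable pair is a side corner \<open>2 m + 2\<close>, and the meet
  is \<open>2 m + 3\<close>, which the canonical order puts just before it (in the first square, 1
  and 2 may be exchanged). For powers of two the exchange inequality is a statement about ranks
  alone. The meet-irreducibles split into two tracks, one per grid direction, with one element at
  each level. A filter contains an element of a track iff its generator is at least as deep in that
  direction. Along a track a vertex is therefore a threshold vector, and exchanging two adjacent
  lines alters a single coordinate. A toggle changes one coordinate and reads its two neighbours on
  the track. Toggles commute if no coordinate changed by one is touched by another. Tracks of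
  different directions share only their first and last elements, which are never changed; for equal
  directions the forbidden words keep the line pairs disjoint.\<close>

lemma convex_hull_image_finite:
  fixes f :: "'a \<Rightarrow> 'v::real_vector"
  assumes "finite V" "inj_on f V" "\<sigma> \<subseteq> V"
  shows "x \<in> convex hull (f ` \<sigma>) \<longleftrightarrow>
    (\<exists>l. (\<forall>v\<in>V. 0 \<le> l v) \<and> sum l V = 1 \<and> {v\<in>V. l v \<noteq> 0} \<subseteq> \<sigma> \<and> (\<Sum>v\<in>V. l v *\<^sub>R f v) = x)"
    (is "_ \<longleftrightarrow> ?R")
proof
  have fin: "finite \<sigma>" and inj: "inj_on f \<sigma>"
    using assms by (auto intro: finite_subset inj_on_subset)
  assume "x \<in> convex hull (f ` \<sigma>)"
  then obtain u where u: "\<forall>y\<in>f ` \<sigma>. 0 \<le> u y" "sum u (f ` \<sigma>) = 1" "(\<Sum>y\<in>f ` \<sigma>. u y *\<^sub>R y) = x"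
    using fin by (auto simp: convex_hull_finite)
  \<comment> \<open>Weights are functions on all of \<open>V\<close>, zero off
    \<open>\<sigma>\<close>, so that representations by different simplices can be compared
    pointwise.\<close>
  define l where "l v = (if v \<in> \<sigma> then u (f v) else 0)" for v
  have "sum l V = (\<Sum>v\<in>\<sigma>. u (f v))"
    using assms by (intro sum.mono_neutral_cong_right) (auto simp: l_def)
  also have "\<dots> = 1" using u(2) by (simp add: sum.reindex[OF inj])
  finally have "sum l V = 1" .
  moreover have "(\<Sum>v\<in>V. l v *\<^sub>R f v) = (\<Sum>v\<in>\<sigma>. u (f v) *\<^sub>R f v)"
    using assms by (intro sum.mono_neutral_cong_right) (auto simp: l_def)
  then have "(\<Sum>v\<in>V. l v *\<^sub>R f v) = x" using u(3) by (simp add: sum.reindex[OF inj])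
  moreover have "\<forall>v\<in>V. 0 \<le> l v" "{v\<in>V. l v \<noteq> 0} \<subseteq> \<sigma>"
    using u(1) by (auto simp: l_def)
  ultimately show ?R by blast
next
  assume ?R
  then obtain l where l: "\<forall>v\<in>V. 0 \<le> l v" "sum l V = 1" "{v\<in>V. l v \<noteq> 0} \<subseteq> \<sigma>"
    "(\<Sum>v\<in>V. l v *\<^sub>R f v) = x" by blast
  have z: "sum l \<sigma> = sum l V" "(\<Sum>v\<in>\<sigma>. l v *\<^sub>R f v) = (\<Sum>v\<in>V. l v *\<^sub>R f v)"
    by (rule sum.mono_neutral_left; use assms l(3) in auto)+
  have "(\<Sum>v\<in>\<sigma>. l v *\<^sub>R f v) \<in> convex hull (f ` \<sigma>)"
    by (rule convex_sum) (use z l assms finite_subset in \<open>auto intro: hull_inc\<close>)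
  with z l show "x \<in> convex hull (f ` \<sigma>)" by simp
qed

text \<open>If a vertex has positive weight in a representation of a point of \<open>F\<close>, that
  point lies strictly inside a segment from the vertex to the rest of the hull, and the face
  property pulls the vertex into \<open>F\<close>.\<close>

lemma face_of_convex_hull_finite:
  fixes f :: "'a \<Rightarrow> 'v::real_vector"
  assumes V: "finite V" "inj_on f V" and F: "F face_of convex hull (f ` V)"
  shows "F = convex hull (f ` {v\<in>V. f v \<in> F})"
proof
  have conv: "convex F" and sub: "F \<subseteq> convex hull (f ` V)"
    using F by (auto simp: face_of_def)
  show "convex hull (f ` {v\<in>V. f v \<in> F}) \<subseteq> F"
    by (rule hull_minimal) (use conv in auto)
  show "F \<subseteq> convex hull (f ` {v\<in>V. f v \<in> F})"
  proof
    fix z assume z: "z \<in> F"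
    then obtain l where l: "\<forall>v\<in>V. 0 \<le> l v" "sum l V = 1" "(\<Sum>v\<in>V. l v *\<^sub>R f v) = z"
      using sub V convex_hull_image_finite[of V f V z] by auto
    have "f v \<in> F" if v: "v \<in> V" "l v \<noteq> 0" for v
    proof (cases "l v = 1")
      case True
      have "sum l (V - {v}) = 0" using V v l(2) True by (simp add: sum_diff1)
      then have "\<forall>u\<in>V-{v}. l u = 0" using V l(1) by (subst (asm) sum_nonneg_eq_0_iff) auto
      then have "(\<Sum>u\<in>V. l u *\<^sub>R f u) = f v"
        using V v True by (subst sum.remove[of _ v]) auto
      with l z show ?thesis by simp
    next
      case False
      define t where "t = l v"
      have t: "0 < t" "t < 1"
      proof -
        show "0 < t" using l v by (auto simp: t_def less_le)
        have "l v \<le> sum l V" using l V v by (intro member_le_sum) auto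
        then show "t < 1" using l(2) False by (simp add: t_def)
      qed
      \<comment> \<open>The remaining weights, rescaled to sum 1, give the other end
        \<open>y\<close> of a segment on which \<open>z\<close> lies strictly between
        \<open>f v\<close> and \<open>y\<close>.\<close>
      define m where "m = (\<lambda>u. if u = v then 0 else l u / (1 - t))"
      have sm: "sum m V = (\<Sum>u\<in>V-{v}. l u) / (1 - t)"
        unfolding sum_divide_distrib using V v
        by (intro sum.mono_neutral_cong_right) (auto simp: m_def)
      then have sm1: "sum m V = 1" using V v l(2) t by (simp add: sum_diff1 t_def)
      define y where "y = (\<Sum>u\<in>V. m u *\<^sub>R f u)"
      have y: "y \<in> convex hull (f ` V)"
        unfolding y_def by (rule convex_sum) (use V sm1 l t in \<open>auto simp: m_def intro: hull_inc\<close>)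
      have "y = (\<Sum>u\<in>V-{v}. (l u / (1 - t)) *\<^sub>R f u)"
        unfolding y_def using V v by (intro sum.mono_neutral_cong_right) (auto simp: m_def)
      then have y1: "(1 - t) *\<^sub>R y = (\<Sum>u\<in>V-{v}. l u *\<^sub>R f u)"
        using t by (simp add: scaleR_sum_right)
      have zz: "z = t *\<^sub>R f v + (1 - t) *\<^sub>R y"
        using sum.remove[OF V(1) v(1), of "\<lambda>u. l u *\<^sub>R f u"] y1 l(3) by (simp add: t_def)
      show ?thesis
      proof (cases "f v = y")
        case True then show ?thesis using zz z by (simp add: algebra_simps)
      next
        case False
        then have "z \<in> open_segment y (f v)"
          unfolding in_segment using zz t by (auto intro!: exI[of _ t] simp: add.commute)
        then show ?thesis using face_ofD[OF F _ y _ z, of "f v"] v V by (auto intro: hull_inc)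
      qed
    qed
    then have "{v\<in>V. l v \<noteq> 0} \<subseteq> {v\<in>V. f v \<in> F}" by auto
    then show "z \<in> convex hull (f ` {v\<in>V. f v \<in> F})"
      using V l convex_hull_image_finite[of V f "{v\<in>V. f v \<in> F}" z] by auto
  qed
qed

text \<open>\<open>\<T>\<close> and \<open>h\<close> are kept abstract because the interface is met
  twice: by the canonical triangulation and by its images under twists. For
  \<open>\<sigma> = {}\<close> the hypothesis \<open>uncross\<close> has no witnesses, so it also
  puts the empty set into \<open>\<T>\<close>.\<close>

locale uncrossing =
  fixes V :: "'a set" and p :: "'a \<Rightarrow> 'v::real_normed_vector"
    and \<T> :: "'a set set" and h :: "'a \<Rightarrow> real"
  assumes finite_V: "finite V"
    and inj_p: "inj_on p V"
    and simplex_subset: "\<sigma> \<in> \<T> \<Longrightarrow> \<sigma> \<subseteq> V"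
    and simplex_downward: "\<sigma> \<in> \<T> \<Longrightarrow> \<sigma>' \<subseteq> \<sigma> \<Longrightarrow> \<sigma>' \<in> \<T>"
    and uncross: "\<sigma> \<subseteq> V \<Longrightarrow> \<sigma> \<notin> \<T> \<Longrightarrow>
      \<exists>a\<in>\<sigma>. \<exists>b\<in>\<sigma>. \<exists>c\<in>V. \<exists>d\<in>V. a \<noteq> b \<and> p a + p b = p c + p d \<and> h c + h d < h a + h b"
    and unique_weights:
      "\<lbrakk>\<forall>v\<in>V. 0 \<le> l v; \<forall>v\<in>V. 0 \<le> m v; sum l V = 1; sum m V = 1;
        {v\<in>V. l v \<noteq> 0} \<in> \<T>; {v\<in>V. m v \<noteq> 0} \<in> \<T>;
        (\<Sum>v\<in>V. l v *\<^sub>R p v) = (\<Sum>v\<in>V. m v *\<^sub>R p v); v \<in> V\<rbrakk> \<Longrightarrow> l v = m v"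
begin

definition weights :: "('a \<Rightarrow> real) \<Rightarrow> bool" where
  "weights l \<longleftrightarrow> (\<forall>v\<in>V. 0 \<le> l v) \<and> sum l V = 1"

definition supp :: "('a \<Rightarrow> real) \<Rightarrow> 'a set" where
  "supp l = {v\<in>V. l v \<noteq> 0}"

definition point :: "('a \<Rightarrow> real) \<Rightarrow> 'v" where
  "point l = (\<Sum>v\<in>V. l v *\<^sub>R p v)"

definition height :: "('a \<Rightarrow> real) \<Rightarrow> real" where
  "height l = (\<Sum>v\<in>V. l v * h v)"

abbreviation lift :: "'a \<Rightarrow> 'v \<times> real" where
  "lift v \<equiv> (p v, h v)"

lemma inj_lift: "inj_on lift V"
  using inj_p by (auto simp: inj_on_def)

lemma sum_lift: "(\<Sum>v\<in>V. l v *\<^sub>R lift v) = (point l, height l)"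
proof -
  have "(\<Sum>v\<in>A. l v *\<^sub>R lift v) = (\<Sum>v\<in>A. l v *\<^sub>R p v, \<Sum>v\<in>A. l v * h v)" for A
    by (induction A rule: infinite_finite_induct) (auto simp: zero_prod_def)
  then show ?thesis by (simp add: point_def height_def)
qed

lemma in_hull_iff:
  "\<sigma> \<subseteq> V \<Longrightarrow> x \<in> convex hull (p ` \<sigma>) \<longleftrightarrow> (\<exists>l. weights l \<and> supp l \<subseteq> \<sigma> \<and> point l = x)"
  unfolding convex_hull_image_finite[OF finite_V inj_p] weights_def supp_def point_def by auto

lemma in_lift_hull_iff:
  "\<sigma> \<subseteq> V \<Longrightarrow> z \<in> convex hull (lift ` \<sigma>) \<longleftrightarrow>
     (\<exists>l. weights l \<and> supp l \<subseteq> \<sigma> \<and> z = (point l, height l))"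
  unfolding convex_hull_image_finite[OF finite_V inj_lift] sum_lift weights_def supp_def by auto

lemma supp_subset: "supp l \<subseteq> V"
  by (auto simp: supp_def)

lemma in_lifted_iff:
  "z \<in> lifted_polytope V p h \<longleftrightarrow> (\<exists>l. weights l \<and> z = (point l, height l))"
  unfolding lifted_polytope_def in_lift_hull_iff[OF subset_refl] using supp_subset by blast

lemma unique:
  assumes "weights l" "weights m" "supp l \<in> \<T>" "supp m \<in> \<T>" "point l = point m" "v \<in> V"
  shows "l v = m v"
  using assms unique_weights[of l m v] by (simp add: weights_def supp_def point_def)

lemma unique_supp_height:
  assumes "weights l" "weights m" "supp l \<in> \<T>" "supp m \<in> \<T>" "point l = point m"
  shows "supp l = supp m" "height l = height m"
  using unique[OF assms] by (auto simp: supp_def height_def)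

lemma lower_weights:
  assumes l: "weights l" "supp l \<notin> \<T>"
  obtains m where "weights m" "point m = point l" "height m < height l"
proof -
  obtain a b c d where ab: "a \<in> supp l" "b \<in> supp l" "c \<in> V" "d \<in> V" "a \<noteq> b"
    and eq: "p a + p b = p c + p d" and less: "h c + h d < h a + h b"
    using uncross[OF supp_subset l(2)] by blast
  have V: "a \<in> V" "b \<in> V" using ab supp_subset by auto
  \<comment> \<open>The largest amount that can be taken from both \<open>a\<close> and
    \<open>b\<close>.\<close>
  define e where "e = min (l a) (l b)"
  have e: "e > 0" using ab l(1) by (auto simp: e_def supp_def weights_def less_le)
  \<comment> \<open>\<open>D x\<close> is a mass \<open>e\<close> at \<open>x\<close>. Adding and
    subtracting such functions needs no case distinction when \<open>c\<close> and \<open>d\<close>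
    coincide with each other or with \<open>a\<close>, \<open>b\<close>; only
    \<open>a \<noteq> b\<close> matters, for nonnegativity.\<close>
  define D where "D = (\<lambda>x v::'a. if v = x then e else (0::real))"
  define m where "m = (\<lambda>v. l v - D a v - D b v + D c v + D d v)"
  have D: "sum (D x) V = e" "(\<Sum>v\<in>V. D x v *\<^sub>R p v) = e *\<^sub>R p x" "(\<Sum>v\<in>V. D x v * h v) = e * h x"
    if "x \<in> V" for x
  proof -
    show "sum (D x) V = e" using that finite_V by (simp add: D_def)
    have "(\<Sum>v\<in>V. D x v *\<^sub>R p v) = (\<Sum>v\<in>{x}. D x v *\<^sub>R p v)"
      using that finite_V by (intro sum.mono_neutral_right) (auto simp: D_def)
    then show "(\<Sum>v\<in>V. D x v *\<^sub>R p v) = e *\<^sub>R p x" by (simp add: D_def)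
    have "(\<Sum>v\<in>V. D x v * h v) = (\<Sum>v\<in>{x}. D x v * h v)"
      using that finite_V by (intro sum.mono_neutral_right) (auto simp: D_def)
    then show "(\<Sum>v\<in>V. D x v * h v) = e * h x" by (simp add: D_def)
  qed
  have "0 \<le> l v - D a v - D b v" if "v \<in> V" for v
    using l(1) that e ab(5) by (auto simp: D_def e_def weights_def)
  moreover have "0 \<le> D x v" for x v using e by (simp add: D_def)
  ultimately have "\<forall>v\<in>V. 0 \<le> m v" by (force simp: m_def intro!: add_nonneg_nonneg)
  moreover have "sum m V = 1"
    using D(1) V ab l(1) by (simp add: m_def sum.distrib sum_subtractf weights_def)
  ultimately have "weights m" by (simp add: weights_def)
  moreover have "point m = point l"
  proof -
    have "point m = point l - e *\<^sub>R p a - e *\<^sub>R p b + e *\<^sub>R p c + e *\<^sub>R p d"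
      using D(2) V ab
      by (simp add: point_def m_def sum.distrib sum_subtractf scaleR_left_distrib scaleR_left_diff_distrib)
    also have "\<dots> = point l - e *\<^sub>R (p a + p b) + e *\<^sub>R (p c + p d)" by (simp add: algebra_simps)
    finally show ?thesis using eq by simp
  qed
  moreover have "height m < height l"
  proof -
    have "height m = height l - e * h a - e * h b + e * h c + e * h d"
      using D(3) V ab
      by (simp add: height_def m_def sum.distrib sum_subtractf algebra_simps)
    also have "\<dots> = height l - e * ((h a + h b) - (h c + h d))" by (simp add: algebra_simps)
    finally show ?thesis using e less by (simp)
  qed
  ultimately show ?thesis using that by blast
qed

text \<open>The fibre of the lifted polytope over the point is compact, so the minimum height is
  attained, and a minimiser admits no exchange. This avoids showing that repeated exchanges
  terminate.\<close>

lemma minimal_weights: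
  assumes "weights l"
  obtains m where "weights m" "point m = point l" "supp m \<in> \<T>" "height m \<le> height l"
proof -
  let ?K = "lifted_polytope V p h \<inter> {point l} \<times> UNIV"
  have "compact (lifted_polytope V p h)"
    unfolding lifted_polytope_def using finite_V by (intro finite_imp_compact_convex_hull) auto
  then have K: "compact ?K" by (intro compact_Int_closed closed_Times) auto
  have l: "(point l, height l) \<in> ?K" using assms by (auto simp: in_lifted_iff)
  obtain z where z: "z \<in> ?K" "\<forall>y\<in>?K. snd z \<le> snd y"
    using continuous_attains_inf[OF K _ continuous_on_snd[OF continuous_on_id]] l by force
  then obtain m where m: "weights m" "z = (point m, height m)" by (auto simp: in_lifted_iff)
  have pm: "point m = point l" using z m by auto
  have "supp m \<in> \<T>"
  proof (rule ccontr)
    assume "supp m \<notin> \<T>"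
    then obtain m' where m': "weights m'" "point m' = point m" "height m' < height m"
      using lower_weights m by blast
    then have "(point m', height m') \<in> ?K" using pm by (auto simp: in_lifted_iff)
    then have "snd z \<le> snd (point m', height m')" using z(2) by blast
    then show False using m m' by simp
  qed
  moreover have "height m \<le> height l" using bspec[OF z(2) l] m by simp
  ultimately show ?thesis using that m pm by blast
qed

lemma simplex_weights_minimal:
  assumes "weights l" "supp l \<in> \<T>" "weights m" "point m = point l"
  shows "height l \<le> height m"
proof -
  obtain m' where m': "weights m'" "point m' = point m" "supp m' \<in> \<T>" "height m' \<le> height m"
    using minimal_weights assms(3) by blast
  then show ?thesis using unique_supp_height(2)[of l m'] assms by simp
qed

text \<open>An exchange lowers any representation whose support is not a simplex. Conversely, a
  minimal representation of the same point is supported on a simplex, hence equals \<open>l\<close>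
  by uniqueness.\<close>

lemma in_lower_envelope_iff:
  assumes "weights l"
  shows "(point l, height l) \<in> lower_envelope (lifted_polytope V p h) \<longleftrightarrow> supp l \<in> \<T>"
proof
  assume "supp l \<in> \<T>"
  then show "(point l, height l) \<in> lower_envelope (lifted_polytope V p h)"
    unfolding lower_envelope_def using assms simplex_weights_minimal
    by (fastforce simp: in_lifted_iff)
next
  assume low: "(point l, height l) \<in> lower_envelope (lifted_polytope V p h)"
  show "supp l \<in> \<T>"
  proof (rule ccontr)
    assume "supp l \<notin> \<T>"
    then obtain m where m: "weights m" "point m = point l" "height m < height l"
      using lower_weights assms by blast
    then have "(point l, height m) \<in> lifted_polytope V p h" by (auto simp: in_lifted_iff intro!: exI[of _ m])
    then have "height l \<le> height m" using low by (auto simp: lower_envelope_def)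
    with m show False by simp
  qed
qed

text \<open>The positive and negative parts of an affine dependence have equal mass
  \<open>P\<close>. Divided by \<open>P\<close> they are two representations of one point inside
  \<open>\<sigma>\<close>, so uniqueness makes them equal, although they have disjoint
  supports.\<close>

lemma simplex_affine_independent:
  assumes "\<sigma> \<in> \<T>"
  shows "\<not> affine_dependent (p ` \<sigma>)"
proof
  have sV: "\<sigma> \<subseteq> V" and fin: "finite \<sigma>" and inj: "inj_on p \<sigma>"
    using simplex_subset[OF assms] finite_V inj_p by (auto intro: finite_subset inj_on_subset)
  assume "affine_dependent (p ` \<sigma>)"
  then obtain U where U: "sum U (p ` \<sigma>) = 0" "\<exists>v\<in>p ` \<sigma>. U v \<noteq> 0" "(\<Sum>v\<in>p ` \<sigma>. U v *\<^sub>R v) = 0"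
    using fin by (auto simp: affine_dependent_explicit_finite)
  define u where "u v = (if v \<in> \<sigma> then U (p v) else 0)" for v
  have "sum u V = (\<Sum>v\<in>\<sigma>. U (p v))"
    using sV finite_V by (intro sum.mono_neutral_cong_right) (auto simp: u_def)
  then have u0: "sum u V = 0" using U(1) by (simp add: sum.reindex[OF inj])
  have "(\<Sum>v\<in>V. u v *\<^sub>R p v) = (\<Sum>v\<in>\<sigma>. U (p v) *\<^sub>R p v)"
    using sV finite_V by (intro sum.mono_neutral_cong_right) (auto simp: u_def)
  then have u1: "(\<Sum>v\<in>V. u v *\<^sub>R p v) = 0" using U(3) by (simp add: sum.reindex[OF inj])
  obtain v0 where v0: "v0 \<in> \<sigma>" "u v0 \<noteq> 0" using U(2) by (auto simp: u_def)
  define P where "P = (\<Sum>v\<in>V. max (u v) 0)"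
  have N: "(\<Sum>v\<in>V. max (- u v) 0) = P"
  proof -
    have "P - (\<Sum>v\<in>V. max (- u v) 0) = sum u V"
      unfolding P_def sum_subtractf[symmetric] by (rule sum.cong) auto
    with u0 show ?thesis by simp
  qed
  have "P > 0"
  proof (rule ccontr)
    assume "\<not> 0 < P"
    moreover have "P \<ge> 0" by (auto simp: P_def intro: sum_nonneg)
    ultimately have "P = 0" by simp
    then have "max (u v0) 0 = 0" "max (- u v0) 0 = 0"
      using N sum_nonneg_eq_0_iff[of V "\<lambda>v. max (u v) 0"] sum_nonneg_eq_0_iff[of V "\<lambda>v. max (- u v) 0"]
        finite_V v0 sV by (auto simp: P_def)
    with v0 show False by auto
  qed
  define l where "l v = max (u v) 0 / P" for v
  define m where "m v = max (- u v) 0 / P" for v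
  have "weights l" "weights m"
    using \<open>P > 0\<close> N by (auto simp: weights_def l_def m_def sum_divide_distrib[symmetric] P_def[symmetric])
  moreover have "supp l \<in> \<T>" "supp m \<in> \<T>"
    by (rule simplex_downward[OF assms]; auto simp: supp_def l_def m_def u_def split: if_splits)+
  moreover have "point l = point m"
  proof -
    have "point l - point m = (\<Sum>v\<in>V. (1 / P) *\<^sub>R (u v *\<^sub>R p v))"
      unfolding point_def sum_subtractf[symmetric]
      by (rule sum.cong) (auto simp: l_def m_def max_def divide_inverse scaleR_left_diff_distrib[symmetric])
    also have "\<dots> = 0" unfolding scaleR_sum_right[symmetric] u1 by simp
    finally show ?thesis by simp
  qed
  ultimately have "l v0 = m v0" using unique v0 sV by auto
  with v0 \<open>P > 0\<close> show False by (auto simp: l_def m_def max_def split: if_splits)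
qed

text \<open>A point determines its supporting simplex, which gives the intersection property;
  covering is the existence of minimal representations.\<close>

lemma triangulation:
  assumes "{x. x extreme_point_of convex hull (p ` V)} = p ` V"
  shows "triangulation_of V p (convex hull (p ` V)) \<T>"
  unfolding triangulation_of_def
proof (intro conjI ballI allI impI)
  show "bij_betw p V {x. x extreme_point_of convex hull (p ` V)}"
    using assms inj_p by (simp add: bij_betw_def)
  show "\<sigma> \<subseteq> V" "\<not> affine_dependent (p ` \<sigma>)" if "\<sigma> \<in> \<T>" for \<sigma>
    using that simplex_subset simplex_affine_independent by blast+
  show "\<sigma>' \<in> \<T>" if "\<sigma> \<in> \<T>" "\<sigma>' \<subseteq> \<sigma>" for \<sigma> \<sigma>' using simplex_downward that by blast
  show "convex hull (p ` \<sigma>) \<inter> convex hull (p ` \<sigma>') = convex hull (p ` (\<sigma> \<inter> \<sigma>'))" (is "?L = ?R")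
    if s: "\<sigma> \<in> \<T>" "\<sigma>' \<in> \<T>" for \<sigma> \<sigma>'
  proof
    show "?R \<subseteq> ?L" by (intro Int_greatest hull_mono) auto
    show "?L \<subseteq> ?R"
    proof
      fix x assume x: "x \<in> ?L"
      obtain l m where l: "weights l" "supp l \<subseteq> \<sigma>" "point l = x"
        and m: "weights m" "supp m \<subseteq> \<sigma>'" "point m = x"
        using x in_hull_iff[OF simplex_subset[OF s(1)], of x] in_hull_iff[OF simplex_subset[OF s(2)], of x]
        by auto
      have "supp l = supp m"
        using l m s by (intro unique_supp_height) (auto intro: simplex_downward)
      then have "supp l \<subseteq> \<sigma> \<inter> \<sigma>'" using l m by auto
      then show "x \<in> ?R" using in_hull_iff[of "\<sigma> \<inter> \<sigma>'" x] simplex_subset[OF s(1)] l by auto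
    qed
  qed
  show "(\<Union>\<sigma>\<in>\<T>. convex hull (p ` \<sigma>)) = convex hull (p ` V)" (is "?L = ?R")
  proof
    show "?L \<subseteq> ?R" using simplex_subset by (intro UN_least hull_mono image_mono)
    show "?R \<subseteq> ?L"
    proof
      fix x assume "x \<in> ?R"
      then obtain l where l: "weights l" "point l = x" using in_hull_iff[of V] by auto
      obtain m where m: "weights m" "point m = point l" "supp m \<in> \<T>"
        using minimal_weights[OF l(1)] .
      then have "x \<in> convex hull (p ` supp m)" using in_hull_iff[OF supp_subset] l by auto
      with m show "x \<in> ?L" by blast
    qed
  qed
qed

text \<open>If a lifted point of the simplex lies inside a segment, mixing the weights of the two
  ends represents the same lifted point. Being on the lower envelope, the mixture is supported on a
  simplex, hence within \<open>\<sigma>\<close>; as nothing cancels, so are the weights of both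
  ends.\<close>

lemma lift_simplex_face:
  assumes "\<sigma> \<in> \<T>"
  shows "convex hull (lift ` \<sigma>) face_of lifted_polytope V p h"
  unfolding face_of_def
proof (intro conjI ballI impI)
  have sV: "\<sigma> \<subseteq> V" using simplex_subset assms .
  show "convex hull (lift ` \<sigma>) \<subseteq> lifted_polytope V p h"
    unfolding lifted_polytope_def using sV by (intro hull_mono) auto
  show "convex (convex hull (lift ` \<sigma>))" by simp
  fix a b z assume a: "a \<in> lifted_polytope V p h" and b: "b \<in> lifted_polytope V p h"
    and z: "z \<in> convex hull (lift ` \<sigma>)" and seg: "z \<in> open_segment a b"
  obtain k where k: "weights k" "supp k \<subseteq> \<sigma>" "z = (point k, height k)"
    using z in_lift_hull_iff[OF sV] by blast
  obtain l m where l: "weights l" "a = (point l, height l)" and m: "weights m" "b = (point m, height m)"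
    using a b in_lifted_iff by blast
  obtain t where t: "0 < t" "t < 1" "z = (1 - t) *\<^sub>R a + t *\<^sub>R b"
    using seg in_segment by blast
  define n where "n v = (1 - t) * l v + t * m v" for v
  have n: "weights n"
    using l m t by (auto simp: weights_def n_def sum.distrib sum_distrib_left[symmetric])
  have "point n = (1 - t) *\<^sub>R point l + t *\<^sub>R point m" "height n = (1 - t) * height l + t * height m"
    unfolding point_def height_def n_def scaleR_sum_right sum_distrib_left sum.distrib[symmetric]
    by (auto intro!: sum.cong simp: algebra_simps)
  then have nz: "(point n, height n) = z" using t l m by simp
  have "supp k \<in> \<T>" using simplex_downward assms k by blast
  then have "supp n \<in> \<T>"
    using in_lower_envelope_iff[OF n] in_lower_envelope_iff[OF k(1)] nz k(3) by metis
  then have sn: "supp n \<subseteq> \<sigma>"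
    using unique_supp_height(1)[OF n k(1)] \<open>supp k \<in> \<T>\<close> nz k by auto
  have "l v = 0 \<and> m v = 0" if "v \<in> V" "n v = 0" for v
  proof -
    have "0 \<le> (1 - t) * l v" "0 \<le> t * m v" using l m t that by (auto simp: weights_def)
    then have "(1 - t) * l v = 0" "t * m v = 0" using that(2) unfolding n_def by linarith+
    then show ?thesis using t by simp
  qed
  then have "supp l \<subseteq> \<sigma>" "supp m \<subseteq> \<sigma>" using sn by (auto simp: supp_def)
  then show "a \<in> convex hull (lift ` \<sigma>)" "b \<in> convex hull (lift ` \<sigma>)"
    using in_lift_hull_iff[OF sV] l m by blast+
qed

lemma fst_lift_hull: "fst ` (convex hull (lift ` \<sigma>)) = convex hull (p ` \<sigma>)"
  by (subst convex_hull_linear_image) (auto simp: linear_fst image_image)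

lemma induced: "induced_by V p \<T> h"
  unfolding induced_by_def
proof (intro equalityI subsetI)
  fix X assume "X \<in> (\<lambda>\<sigma>. convex hull (p ` \<sigma>)) ` \<T>"
  then obtain \<sigma> where s: "\<sigma> \<in> \<T>" "X = convex hull (p ` \<sigma>)" by blast
  have "convex hull (lift ` \<sigma>) \<subseteq> lower_envelope (lifted_polytope V p h)"
  proof
    fix z assume "z \<in> convex hull (lift ` \<sigma>)"
    then obtain l where "weights l" "supp l \<subseteq> \<sigma>" "z = (point l, height l)"
      using in_lift_hull_iff[OF simplex_subset[OF s(1)], of z] by auto
    then show "z \<in> lower_envelope (lifted_polytope V p h)"
      using in_lower_envelope_iff simplex_downward s by blast
  qed
  then show "X \<in> (\<lambda>F. fst ` F) ` {F. F face_of lifted_polytope V p h \<and>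
      F \<subseteq> lower_envelope (lifted_polytope V p h)}"
    using lift_simplex_face[OF s(1)] fst_lift_hull[of \<sigma>] s(2)
    by (intro image_eqI[of _ _ "convex hull (lift ` \<sigma>)"]) auto
next
  fix X assume "X \<in> (\<lambda>F. fst ` F) ` {F. F face_of lifted_polytope V p h \<and>
      F \<subseteq> lower_envelope (lifted_polytope V p h)}"
  then obtain F where F: "F face_of lifted_polytope V p h"
    "F \<subseteq> lower_envelope (lifted_polytope V p h)" "X = fst ` F" by blast
  define \<sigma> where "\<sigma> = {v\<in>V. lift v \<in> F}"
  have FF: "F = convex hull (lift ` \<sigma>)"
    using face_of_convex_hull_finite[OF finite_V inj_lift] F(1)
    unfolding lifted_polytope_def \<sigma>_def by blast
  have "\<sigma> \<in> \<T>"
  proof (cases "\<sigma> = {}")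
    case True
    \<comment> \<open>The empty face corresponds to the empty simplex.\<close>
    then show ?thesis using uncross[of "{}"] by auto
  next
    case False
    have sV: "\<sigma> \<subseteq> V" and fin: "finite \<sigma>" using finite_V by (auto simp: \<sigma>_def)
    \<comment> \<open>The barycentre of the face has all its vertices in its support.\<close>
    define l where "l v = (if v \<in> \<sigma> then 1 / card \<sigma> else 0)" for v
    have "sum l V = (\<Sum>v\<in>\<sigma>. 1 / card \<sigma>)"
      using sV finite_V by (intro sum.mono_neutral_cong_right) (auto simp: l_def)
    then have l: "weights l" using False fin by (auto simp: weights_def l_def)
    have sl: "supp l = \<sigma>" using False fin sV by (auto simp: supp_def l_def)
    then have "(point l, height l) \<in> F" unfolding FF using in_lift_hull_iff[OF sV] l by blast
    then show ?thesis using in_lower_envelope_iff[OF l] F(2) sl by auto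
  qed
  then show "X \<in> (\<lambda>\<sigma>. convex hull (p ` \<sigma>)) ` \<T>"
    using F(3) fst_lift_hull[of \<sigma>] FF by auto
qed

theorem regular_triangulation:
  assumes "{x. x extreme_point_of convex hull (p ` V)} = p ` V"
  shows "regular_triangulation_induced_by V p (convex hull (p ` V)) \<T> h"
  using triangulation[OF assms] induced by (simp add: regular_triangulation_induced_by_def)

text \<open>The map \<open>B\<close> carries exchange relations and equalities of represented points
  from \<open>v\<close> to \<open>\<tau> v\<close>. Since \<open>\<tau>\<close> is an involution,
  the same \<open>B\<close> also carries them back, so no inverse of \<open>B\<close> has to be
  provided.\<close>

lemma uncrossing_involution:
  assumes \<tau>: "\<And>v. v \<in> V \<Longrightarrow> \<tau> v \<in> V" "\<And>v. v \<in> V \<Longrightarrow> \<tau> (\<tau> v) = v"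
    and B: "linear B" "\<And>v. v \<in> V \<Longrightarrow> p (\<tau> v) = B (p v)"
  shows "uncrossing V p (twist_triangulation \<tau> \<T>) (\<lambda>v. h (\<tau> v))"
proof -
  have bij: "bij_betw \<tau> V V"
    by (rule bij_betw_byWitness[of _ \<tau>]) (use \<tau> in auto)
  have img: "\<sigma> \<in> twist_triangulation \<tau> \<T> \<longleftrightarrow> \<tau> ` \<sigma> \<in> \<T>" if "\<sigma> \<subseteq> V" for \<sigma>
  proof -
    have "\<tau> ` \<tau> ` \<sigma> = \<sigma>" if "\<sigma> \<subseteq> V" for \<sigma> using \<tau> that by (force simp: image_image)
    then show ?thesis using that simplex_subset unfolding twist_triangulation_def
      by (metis (no_types, lifting) image_iff)
  qed
  have sub: "\<sigma> \<subseteq> V" if "\<sigma> \<in> twist_triangulation \<tau> \<T>" for \<sigma>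
    using that simplex_subset \<tau>(1) by (fastforce simp: twist_triangulation_def)
  show ?thesis
  proof
    show "finite V" "inj_on p V" by (fact finite_V inj_p)+
    show "\<sigma> \<subseteq> V" if "\<sigma> \<in> twist_triangulation \<tau> \<T>" for \<sigma> using sub that .
    show "\<sigma>' \<in> twist_triangulation \<tau> \<T>" if "\<sigma> \<in> twist_triangulation \<tau> \<T>" "\<sigma>' \<subseteq> \<sigma>" for \<sigma> \<sigma>'
      using that img[of \<sigma>] img[of \<sigma>'] sub[of \<sigma>] simplex_downward[of "\<tau> ` \<sigma>" "\<tau> ` \<sigma>'"] by auto
    show "\<exists>a\<in>\<sigma>. \<exists>b\<in>\<sigma>. \<exists>c\<in>V. \<exists>d\<in>V. a \<noteq> b \<and> p a + p b = p c + p d \<and>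
        h (\<tau> c) + h (\<tau> d) < h (\<tau> a) + h (\<tau> b)"
      if s: "\<sigma> \<subseteq> V" "\<sigma> \<notin> twist_triangulation \<tau> \<T>" for \<sigma>
    proof -
      have "\<tau> ` \<sigma> \<subseteq> V" "\<tau> ` \<sigma> \<notin> \<T>" using s \<tau> img by auto
      then obtain a b c d where *: "a \<in> \<sigma>" "b \<in> \<sigma>" "c \<in> V" "d \<in> V" "\<tau> a \<noteq> \<tau> b"
        "p (\<tau> a) + p (\<tau> b) = p c + p d" "h c + h d < h (\<tau> a) + h (\<tau> b)"
        using uncross[of "\<tau> ` \<sigma>"] by blast
      \<comment> \<open>The exchange was found for the image under \<open>\<tau>\<close>; applying
        \<open>B\<close> once more returns it to \<open>a\<close> and \<open>b\<close>.\<close>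
      have "p a + p b = B (p (\<tau> a) + p (\<tau> b))"
        using * s \<tau> B by (metis linear_add subsetD)
      also have "\<dots> = p (\<tau> c) + p (\<tau> d)"
        using * B by (metis linear_add)
      finally show ?thesis using * \<tau> by (metis (no_types, lifting))
    qed
    show "l v = m v" if l: "\<forall>v\<in>V. 0 \<le> l v" "\<forall>v\<in>V. 0 \<le> m v" "sum l V = 1" "sum m V = 1"
      "{v\<in>V. l v \<noteq> 0} \<in> twist_triangulation \<tau> \<T>" "{v\<in>V. m v \<noteq> 0} \<in> twist_triangulation \<tau> \<T>"
      "(\<Sum>v\<in>V. l v *\<^sub>R p v) = (\<Sum>v\<in>V. m v *\<^sub>R p v)" "v \<in> V" for l m :: "'a \<Rightarrow> real" and v
    proof -
      have sup: "{v\<in>V. l (\<tau> v) \<noteq> 0} = \<tau> ` {v\<in>V. l v \<noteq> 0}" for l :: "'a \<Rightarrow> real"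
        using \<tau> by (force simp: image_iff)
      have sm: "(\<Sum>v\<in>V. l (\<tau> v)) = sum l V" for l :: "'a \<Rightarrow> real"
        using sum.reindex_bij_betw[OF bij] .
      have pt: "(\<Sum>v\<in>V. l (\<tau> v) *\<^sub>R p v) = B (\<Sum>v\<in>V. l v *\<^sub>R p v)" for l :: "'a \<Rightarrow> real"
      proof -
        have "B (\<Sum>v\<in>V. l v *\<^sub>R p v) = (\<Sum>v\<in>V. l v *\<^sub>R p (\<tau> v))"
          using B by (simp add: linear_sum[OF B(1)] linear_scale[OF B(1)] B(2))
        also have "\<dots> = (\<Sum>v\<in>V. l (\<tau> v) *\<^sub>R p (\<tau> (\<tau> v)))"
          using sum.reindex_bij_betw[OF bij, of "\<lambda>v. l v *\<^sub>R p (\<tau> v)"] by simp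
        finally show ?thesis using \<tau> by simp
      qed
      have T: "\<tau> ` {v\<in>V. l v \<noteq> 0} \<in> \<T>" "\<tau> ` {v\<in>V. m v \<noteq> 0} \<in> \<T>"
        using l(5,6) img by auto
      have "(l \<circ> \<tau>) (\<tau> v) = (m \<circ> \<tau>) (\<tau> v)"
        by (rule unique_weights) (use l \<tau> T in \<open>auto simp: sup sm pt\<close>)
      then show ?thesis using \<tau> l by simp
    qed
  qed
qed

end

section \<open>Order polytopes and chains of filters\<close>

definition up_sets :: "'a set \<Rightarrow> ('a \<Rightarrow> 'a \<Rightarrow> bool) \<Rightarrow> 'a set set" where
  "up_sets Q lt = {F. F \<subseteq> Q \<and> (\<forall>i\<in>F. \<forall>j\<in>Q. lt i j \<longrightarrow> j \<in> F)}"

definition indicator_vector :: "'a set \<Rightarrow> ('a \<Rightarrow>\<^sub>0 real)" where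
  "indicator_vector F = (\<Sum>q\<in>F. Poly_Mapping.single q 1)"

section \<open>Vertices of the order polytope\<close>

lemma lookup_scaleR [simp]:
  "Poly_Mapping.lookup (r *\<^sub>R x) i = r * Poly_Mapping.lookup x i" for x :: "'a \<Rightarrow>\<^sub>0 real"
proof -
  have "finite {i. r * Poly_Mapping.lookup x i \<noteq> 0}"
    by (rule finite_subset[OF _ finite_lookup[of x]]) auto
  then show ?thesis by (simp add: scaleR_poly_mapping_def)
qed

lemma lookup_indicator_vector:
  "finite F \<Longrightarrow> Poly_Mapping.lookup (indicator_vector F) i = of_bool (i \<in> F)"
  by (auto simp: indicator_vector_def lookup_sum lookup_single when_def)

lemma finite_up_sets: "finite Q \<Longrightarrow> finite (up_sets Q lt)"
  by (rule finite_subset[of _ "Pow Q"]) (auto simp: up_sets_def)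

lemma up_sets_finite: "finite Q \<Longrightarrow> F \<in> up_sets Q lt \<Longrightarrow> finite F"
  by (auto simp: up_sets_def intro: finite_subset)

lemma inj_on_indicator_vector: "finite Q \<Longrightarrow> inj_on indicator_vector (up_sets Q lt)"
proof (rule inj_onI)
  fix F G assume *: "finite Q" "F \<in> up_sets Q lt" "G \<in> up_sets Q lt"
    "indicator_vector F = indicator_vector G"
  then have "i \<in> F \<longleftrightarrow> i \<in> G" for i
    by (metis lookup_indicator_vector up_sets_finite of_bool_eq_iff)
  then show "F = G" by blast
qed

text \<open>The support of \<open>x\<close> is a filter. Subtracting its indicator times the
  smallest positive value keeps the order relations and removes an element from the support. The
  total \<open>c\<close> is general because it drops by the subtracted value.\<close>

lemma layer_cake:
  fixes x :: "'a \<Rightarrow>\<^sub>0 real"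
  assumes "finite Q" "Poly_Mapping.keys x \<subseteq> Q"
    "\<forall>i\<in>Q. 0 \<le> Poly_Mapping.lookup x i \<and> Poly_Mapping.lookup x i \<le> c"
    "\<forall>i\<in>Q. \<forall>j\<in>Q. lt i j \<longrightarrow> Poly_Mapping.lookup x i \<le> Poly_Mapping.lookup x j" "0 \<le> c"
  shows "\<exists>l. (\<forall>F\<in>up_sets Q lt. 0 \<le> l F) \<and> sum l (up_sets Q lt) = c \<and>
    (\<Sum>F\<in>up_sets Q lt. l F *\<^sub>R indicator_vector F) = x"
  using assms(2-)
proof (induction "card (Poly_Mapping.keys x)" arbitrary: x c rule: less_induct)
  case less
  let ?K = "Poly_Mapping.keys x" and ?U = "up_sets Q lt"
  note fU = finite_up_sets[OF assms(1), of lt]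
  have delta: "sum (\<lambda>F. if F = G then a else (0::real)) ?U = a"
    "(\<Sum>F\<in>?U. (if F = G then a else (0::real)) *\<^sub>R indicator_vector F) = a *\<^sub>R indicator_vector G"
    if "G \<in> ?U" for G a
  proof -
    show "sum (\<lambda>F. if F = G then a else (0::real)) ?U = a" using that fU by simp
    have "(\<Sum>F\<in>?U. (if F = G then a else (0::real)) *\<^sub>R indicator_vector F) =
        (\<Sum>F\<in>{G}. (if F = G then a else (0::real)) *\<^sub>R indicator_vector F)"
      using that fU by (intro sum.mono_neutral_right) auto
    then show "(\<Sum>F\<in>?U. (if F = G then a else (0::real)) *\<^sub>R indicator_vector F) = a *\<^sub>R indicator_vector G"
      by simp
  qed
  show ?case
  proof (cases "?K = {}")
    case True
    then have "x = 0" by simp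
    \<comment> \<open>The weight left over goes to the empty filter, whose indicator is
      zero.\<close>
    moreover have "{} \<in> ?U" by (simp add: up_sets_def)
    ultimately show ?thesis using delta[of "{}" c] less.prems
      by (intro exI[of _ "\<lambda>F. if F = {} then c else 0"]) (auto simp: indicator_vector_def)
  next
    case False
    have pos: "0 < Poly_Mapping.lookup x i" if "i \<in> ?K" for i
      using that less.prems by (metis in_keys_iff order_less_le subsetD)
    define m where "m = Min (Poly_Mapping.lookup x ` ?K)"
    obtain i0 where i0: "i0 \<in> ?K" "Poly_Mapping.lookup x i0 = m"
      using Min_in[of "Poly_Mapping.lookup x ` ?K"] False unfolding m_def by fastforce
    have m_le: "m \<le> Poly_Mapping.lookup x i" if "i \<in> ?K" for i using that by (simp add: m_def)
    have m: "0 < m" "m \<le> c" using pos[OF i0(1)] i0 less.prems by auto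
    have KU: "?K \<in> ?U"
      unfolding up_sets_def
    proof (intro CollectI conjI ballI impI)
      show "?K \<subseteq> Q" by (fact less.prems(1))
      fix i j assume "i \<in> ?K" "j \<in> Q" "lt i j"
      then have "0 < Poly_Mapping.lookup x j" using pos[of i] less.prems(1,3) by fastforce
      then show "j \<in> ?K" by (simp add: in_keys_iff)
    qed
    define y where "y = x - m *\<^sub>R indicator_vector ?K"
    have y: "Poly_Mapping.lookup y i = Poly_Mapping.lookup x i - m * of_bool (i \<in> ?K)" for i
      by (simp add: y_def lookup_minus lookup_indicator_vector)
    have keys_y: "Poly_Mapping.keys y \<subset> ?K"
    proof
      show "Poly_Mapping.keys y \<subseteq> ?K" using y by (auto simp: in_keys_iff)
      have "i0 \<notin> Poly_Mapping.keys y" using y[of i0] i0 by (simp add: in_keys_iff)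
      then show "Poly_Mapping.keys y \<noteq> ?K" using i0 by blast
    qed
    then have "card (Poly_Mapping.keys y) < card ?K" by (simp add: psubset_card_mono)
    moreover have "Poly_Mapping.keys y \<subseteq> Q" using keys_y less.prems(1) by auto
    moreover have "\<forall>i\<in>Q. 0 \<le> Poly_Mapping.lookup y i \<and> Poly_Mapping.lookup y i \<le> c - m"
      using less.prems(2) m m_le y by (auto simp: in_keys_iff)
    moreover have "\<forall>i\<in>Q. \<forall>j\<in>Q. lt i j \<longrightarrow> Poly_Mapping.lookup y i \<le> Poly_Mapping.lookup y j"
    proof (intro ballI impI)
      fix i j assume ij: "i \<in> Q" "j \<in> Q" "lt i j"
      have "i \<in> ?K \<Longrightarrow> j \<in> ?K" using KU ij by (auto simp: up_sets_def)
      then show "Poly_Mapping.lookup y i \<le> Poly_Mapping.lookup y j"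
        using less.prems(3) ij m_le by (auto simp: y in_keys_iff)
    qed
    ultimately obtain l where l: "\<forall>F\<in>?U. 0 \<le> l F" "sum l ?U = c - m"
      "(\<Sum>F\<in>?U. l F *\<^sub>R indicator_vector F) = y"
      using less.hyps[of y "c - m"] m by auto
    have "(\<Sum>F\<in>?U. (l F + (if F = ?K then m else 0)) *\<^sub>R indicator_vector F) = x"
      using l(3) delta(2)[OF KU, of m] by (simp add: scaleR_left_distrib sum.distrib y_def)
    moreover have "(\<Sum>F\<in>?U. (l F + (if F = ?K then m else 0))) = c"
      using l(2) delta(1)[OF KU, of m] by (simp add: sum.distrib)
    ultimately show ?thesis using l(1) m
      by (intro exI[of _ "\<lambda>F. l F + (if F = ?K then m else 0)"]) auto
  qed
qed

lemma indicator_vector_in_order_polytope: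
  assumes "finite Q" "F \<in> up_sets Q lt"
  shows "indicator_vector F \<in> order_polytope Q lt"
proof -
  have "Poly_Mapping.keys (indicator_vector F) \<subseteq> Q"
    using assms by (auto simp: in_keys_iff lookup_indicator_vector up_sets_finite up_sets_def)
  then show ?thesis
    using assms by (auto simp: order_polytope_def lookup_indicator_vector up_sets_finite up_sets_def)
qed

lemma convex_order_polytope: "convex (order_polytope Q lt)"
proof (rule convexI)
  fix x y :: "'a \<Rightarrow>\<^sub>0 real" and u v :: real
  assume xy: "x \<in> order_polytope Q lt" "y \<in> order_polytope Q lt" and uv: "0 \<le> u" "0 \<le> v" "u + v = 1"
  have "Poly_Mapping.keys (u *\<^sub>R x + v *\<^sub>R y) \<subseteq> Q"
  proof
    fix i assume "i \<in> Poly_Mapping.keys (u *\<^sub>R x + v *\<^sub>R y)"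
    then have "i \<in> Poly_Mapping.keys x \<or> i \<in> Poly_Mapping.keys y"
      by (auto simp: in_keys_iff lookup_add)
    then show "i \<in> Q" using xy by (auto simp: order_polytope_def)
  qed
  moreover have "u * a + v * b \<le> 1" if "a \<le> 1" "b \<le> 1" for a b
    using convex_bound_le[OF that uv] .
  ultimately show "u *\<^sub>R x + v *\<^sub>R y \<in> order_polytope Q lt"
    using xy uv by (auto simp: order_polytope_def lookup_add intro!: add_mono mult_left_mono)
qed

lemma order_polytope_eq_hull:
  assumes "finite Q"
  shows "order_polytope Q lt = convex hull (indicator_vector ` up_sets Q lt)"
proof
  show "convex hull (indicator_vector ` up_sets Q lt) \<subseteq> order_polytope Q lt"
    by (rule hull_minimal) (auto simp: convex_order_polytope indicator_vector_in_order_polytope assms)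
  show "order_polytope Q lt \<subseteq> convex hull (indicator_vector ` up_sets Q lt)"
  proof
    fix x assume "x \<in> order_polytope Q lt"
    then obtain l where "\<forall>F\<in>up_sets Q lt. 0 \<le> l F" "sum l (up_sets Q lt) = 1"
      "(\<Sum>F\<in>up_sets Q lt. l F *\<^sub>R indicator_vector F) = x"
      using layer_cake[OF assms, of x 1 lt] by (auto simp: order_polytope_def)
    then show "x \<in> convex hull (indicator_vector ` up_sets Q lt)"
      using convex_hull_image_finite[OF finite_up_sets[OF assms] inj_on_indicator_vector[OF assms] subset_refl]
      by blast
  qed
qed

lemma extreme_points_order_polytope:
  assumes "finite Q"
  shows "{x. x extreme_point_of order_polytope Q lt} = indicator_vector ` up_sets Q lt"
proof
  show "{x. x extreme_point_of order_polytope Q lt} \<subseteq> indicator_vector ` up_sets Q lt"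
    unfolding order_polytope_eq_hull[OF assms] using extreme_point_of_convex_hull by blast
  show "indicator_vector ` up_sets Q lt \<subseteq> {x. x extreme_point_of order_polytope Q lt}"
  proof clarify
    fix F assume F: "F \<in> up_sets Q lt"
    have "indicator_vector F \<notin> open_segment a b"
      if ab: "a \<in> order_polytope Q lt" "b \<in> order_polytope Q lt" for a b
    proof
      assume "indicator_vector F \<in> open_segment a b"
      then obtain t where t: "0 < t" "t < 1" "a \<noteq> b" "indicator_vector F = (1 - t) *\<^sub>R a + t *\<^sub>R b"
        unfolding in_segment by blast
      have "Poly_Mapping.lookup a i = Poly_Mapping.lookup b i" for i
      proof (cases "i \<in> Q")
        case True
        define \<alpha> \<beta> where "\<alpha> = Poly_Mapping.lookup a i" and "\<beta> = Poly_Mapping.lookup b i"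
        have bds: "0 \<le> \<alpha>" "\<alpha> \<le> 1" "0 \<le> \<beta>" "\<beta> \<le> 1"
          using ab True by (auto simp: order_polytope_def \<alpha>_def \<beta>_def)
        have "of_bool (i \<in> F) = (1 - t) * \<alpha> + t * \<beta>"
          using arg_cong[OF t(4), of "\<lambda>x. Poly_Mapping.lookup x i"] up_sets_finite[OF assms F]
          by (simp add: lookup_add lookup_indicator_vector \<alpha>_def \<beta>_def)
        \<comment> \<open>The coordinate is 0 or 1, an end of the interval containing
          \<open>\<alpha>\<close> and \<open>\<beta>\<close>, so a proper convex combination attains
          it only if both equal it.\<close>
        then consider "(1 - t) * \<alpha> + t * \<beta> = 0" | "(1 - t) * (1 - \<alpha>) + t * (1 - \<beta>) = 0"
          by (cases "i \<in> F") (auto simp: algebra_simps)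
        then show ?thesis
        proof cases
          case 1
          then have "(1 - t) * \<alpha> = 0 \<and> t * \<beta> = 0"
            using bds t by (subst (asm) add_nonneg_eq_0_iff) auto
          then show ?thesis using t by (simp add: \<alpha>_def \<beta>_def)
        next
          case 2
          then have "(1 - t) * (1 - \<alpha>) = 0 \<and> t * (1 - \<beta>) = 0"
            using bds t by (subst (asm) add_nonneg_eq_0_iff) auto
          then show ?thesis using t by (simp add: \<alpha>_def \<beta>_def)
        qed
      next
        case False
        then show ?thesis using ab by (metis (mono_tags, lifting) in_keys_iff mem_Collect_eq order_polytope_def subsetD)
      qed
      then show False using t(3) by (simp add: poly_mapping_eqI)
    qed
    then show "indicator_vector F extreme_point_of order_polytope Q lt"
      by (simp add: extreme_point_of_def indicator_vector_in_order_polytope assms F)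
  qed
qed

text \<open>Among the members of the chain that do not contain \<open>G\<close>, the largest one
  misses some \<open>q\<close> in \<open>G\<close>, and then all the smaller ones miss it as well.
  Membership of this \<open>q\<close> therefore detects containment of all of
  \<open>G\<close>.\<close>

lemma chain_weight_witness:
  assumes "finite \<sigma>" "\<And>a b. a \<in> \<sigma> \<Longrightarrow> b \<in> \<sigma> \<Longrightarrow> F a \<subseteq> F b \<or> F b \<subseteq> F a" "G \<noteq> {}"
    and finF: "\<And>a. a \<in> \<sigma> \<Longrightarrow> finite (F a)"
  shows "\<exists>q\<in>G. \<forall>u\<in>\<sigma>. q \<in> F u \<longrightarrow> G \<subseteq> F u"
proof (cases "\<exists>u\<in>\<sigma>. \<not> G \<subseteq> F u")
  case True
  let ?B = "{u\<in>\<sigma>. \<not> G \<subseteq> F u}"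
  have "finite ?B" "?B \<noteq> {}" using assms True by auto
  then obtain u0 where u0: "u0 \<in> ?B" "\<forall>u\<in>?B. card (F u) \<le> card (F u0)"
    using Max_in[of "(\<lambda>u. card (F u)) ` ?B"] Max_ge[of "(\<lambda>u. card (F u)) ` ?B"]
    by (smt (verit) finite_imageI image_iff image_is_empty)
  obtain q where q: "q \<in> G" "q \<notin> F u0" using u0 by auto
  have "G \<subseteq> F u" if u: "u \<in> \<sigma>" "q \<in> F u" for u
  proof (rule ccontr)
    assume "\<not> G \<subseteq> F u"
    then have "card (F u) \<le> card (F u0)" using u u0 by auto
    moreover have "F u0 \<subset> F u" using assms(2)[of u u0] u q u0 by auto
    then have "card (F u0) < card (F u)" using finF u by (simp add: psubset_card_mono)
    ultimately show False by simp
  qed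
  then show ?thesis using q by blast
next
  case False
  then show ?thesis using assms(3) by auto
qed

text \<open>\<open>\<Lambda> k G\<close> is the total weight of the filters that contain
  \<open>G\<close>. For weights supported on a chain it is the minimum over \<open>q\<close> in
  \<open>G\<close> of the coordinate at \<open>q\<close>, so the represented point determines it.
  The two chains may differ a priori.\<close>

lemma chain_weights_unique:
  fixes F :: "'v \<Rightarrow> 'a set" and l m :: "'v \<Rightarrow> real"
  assumes V: "finite V" and Q: "finite Q" "\<And>v. v \<in> V \<Longrightarrow> F v \<subseteq> Q" and inj: "inj_on F V"
    and l: "\<forall>v\<in>V. 0 \<le> l v" "sum l V = 1"
      "\<And>a b. \<lbrakk>a \<in> V; b \<in> V; l a \<noteq> 0; l b \<noteq> 0\<rbrakk> \<Longrightarrow> F a \<subseteq> F b \<or> F b \<subseteq> F a"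
    and m: "\<forall>v\<in>V. 0 \<le> m v" "sum m V = 1"
      "\<And>a b. \<lbrakk>a \<in> V; b \<in> V; m a \<noteq> 0; m b \<noteq> 0\<rbrakk> \<Longrightarrow> F a \<subseteq> F b \<or> F b \<subseteq> F a"
    and eq: "(\<Sum>v\<in>V. l v *\<^sub>R indicator_vector (F v)) = (\<Sum>v\<in>V. m v *\<^sub>R indicator_vector (F v))"
    and v: "v \<in> V"
  shows "l v = m v"
proof -
  define \<Lambda> where "\<Lambda> k G = (\<Sum>u\<in>{u\<in>V. G \<subseteq> F u}. k u)" for k :: "'v \<Rightarrow> real" and G
  have finF: "finite (F v)" if "v \<in> V" for v using that Q finite_subset by blast
  have coord: "\<Lambda> k {q} = Poly_Mapping.lookup (\<Sum>v\<in>V. k v *\<^sub>R indicator_vector (F v)) q" for k q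
  proof -
    have "Poly_Mapping.lookup (\<Sum>v\<in>V. k v *\<^sub>R indicator_vector (F v)) q = (\<Sum>v\<in>V. k v * of_bool (q \<in> F v))"
      using finF by (simp add: lookup_sum lookup_indicator_vector)
    also have "\<dots> = \<Lambda> k {q}"
      unfolding \<Lambda>_def using V by (intro sum.mono_neutral_cong_right) auto
    finally show ?thesis by simp
  qed
  have mono: "\<Lambda> k G \<le> \<Lambda> k {q}" if "\<forall>v\<in>V. 0 \<le> k v" "q \<in> G" for k G q
    unfolding \<Lambda>_def using that V by (intro sum_mono2) auto
  have witness: "\<exists>q\<in>G. \<Lambda> k G = \<Lambda> k {q}"
    if k: "\<And>a b. \<lbrakk>a \<in> V; b \<in> V; k a \<noteq> 0; k b \<noteq> 0\<rbrakk> \<Longrightarrow> F a \<subseteq> F b \<or> F b \<subseteq> F a" and G: "G \<noteq> {}" for k G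
  proof -
    have "\<exists>q\<in>G. \<forall>u\<in>{u\<in>V. k u \<noteq> 0}. q \<in> F u \<longrightarrow> G \<subseteq> F u"
      by (rule chain_weight_witness) (use V k G finF in auto)
    then obtain q where q: "q \<in> G" "\<forall>u\<in>V. k u \<noteq> 0 \<longrightarrow> q \<in> F u \<longrightarrow> G \<subseteq> F u" by blast
    then have "\<Lambda> k G = \<Lambda> k {q}" unfolding \<Lambda>_def using V by (intro sum.mono_neutral_left) auto
    with q show ?thesis by blast
  qed
  have same: "\<Lambda> l G = \<Lambda> m G" for G
  proof (cases "G = {}")
    case True
    then show ?thesis using l m by (simp add: \<Lambda>_def)
  next
    case False
    have e: "\<Lambda> l {q} = \<Lambda> m {q}" for q using eq by (simp add: coord)
    \<comment> \<open>The minima may be attained at different elements; testing each at the other's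
      place with \<open>mono\<close> gives both inequalities.\<close>
    obtain q q' where "q \<in> G" "\<Lambda> l G = \<Lambda> l {q}" "q' \<in> G" "\<Lambda> m G = \<Lambda> m {q'}"
      using witness[of l G] witness[of m G] l m False by metis
    then show ?thesis using mono[OF l(1), of q' G] mono[OF m(1), of q G] e by simp
  qed
  show ?thesis using v
  proof (induction "card (Q - F v)" arbitrary: v rule: less_induct)
    case less
    \<comment> \<open>Only \<open>v\<close> itself and the labels of strictly larger filters
      contribute, and the latter weights are known by induction.\<close>
    have split: "\<Lambda> k (F v) = k v + (\<Sum>u\<in>{u\<in>V. F v \<subset> F u}. k u)" for k
    proof -
      have "{u\<in>V. F v \<subseteq> F u} = insert v {u\<in>V. F v \<subset> F u}"
        using inj less.prems by (auto dest: inj_onD)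
      then show ?thesis using V by (simp add: \<Lambda>_def)
    qed
    have "l u = m u" if "u \<in> V" "F v \<subset> F u" for u
      using that Q by (intro less.hyps) (auto intro!: psubset_card_mono)
    then show ?case using same[of "F v"] split[of l] split[of m] by simp
  qed
qed

lemma order_polytope_uncrossing:
  fixes F :: "'v \<Rightarrow> 'a set"
  assumes Q: "finite Q" and V: "finite V" and F: "bij_betw F V (up_sets Q lt)"
    and h: "\<And>a b c d. \<lbrakk>a \<in> V; b \<in> V; c \<in> V; d \<in> V; F c = F a \<inter> F b; F d = F a \<union> F b;
      \<not> F a \<subseteq> F b; \<not> F b \<subseteq> F a\<rbrakk> \<Longrightarrow> h c + h d < h a + h b"
  shows "uncrossing V (\<lambda>v. indicator_vector (F v))
    {\<sigma>. \<sigma> \<subseteq> V \<and> (\<forall>a\<in>\<sigma>. \<forall>b\<in>\<sigma>. F a \<subseteq> F b \<or> F b \<subseteq> F a)} h" (is "uncrossing V ?p ?T h")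
proof
  have FU: "F v \<in> up_sets Q lt" if "v \<in> V" for v using F that by (auto simp: bij_betw_def)
  show "finite V" by (fact V)
  show "inj_on ?p V"
    using comp_inj_on[of F V indicator_vector] F inj_on_indicator_vector[OF Q]
    by (auto simp: bij_betw_def comp_def)
  show "\<sigma> \<subseteq> V" if "\<sigma> \<in> ?T" for \<sigma> using that by simp
  show "\<sigma>' \<in> ?T" if "\<sigma> \<in> ?T" "\<sigma>' \<subseteq> \<sigma>" for \<sigma> \<sigma>' using that by blast
  show "\<exists>a\<in>\<sigma>. \<exists>b\<in>\<sigma>. \<exists>c\<in>V. \<exists>d\<in>V. a \<noteq> b \<and> ?p a + ?p b = ?p c + ?p d \<and> h c + h d < h a + h b"
    if s: "\<sigma> \<subseteq> V" "\<sigma> \<notin> ?T" for \<sigma>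
  proof -
    obtain a b where ab: "a \<in> \<sigma>" "b \<in> \<sigma>" "\<not> F a \<subseteq> F b" "\<not> F b \<subseteq> F a" using s by blast
    then have U: "F a \<in> up_sets Q lt" "F b \<in> up_sets Q lt" using FU s by auto
    then have "F a \<inter> F b \<in> up_sets Q lt" "F a \<union> F b \<in> up_sets Q lt" by (auto simp: up_sets_def)
    then have "F a \<inter> F b \<in> F ` V" "F a \<union> F b \<in> F ` V" using F by (simp_all add: bij_betw_def)
    then obtain c d where cd: "c \<in> V" "d \<in> V" "F c = F a \<inter> F b" "F d = F a \<union> F b"
      by (metis imageE)
    have fin: "finite (F a)" "finite (F b)" using U up_sets_finite Q by auto
    have "?p a + ?p b = ?p c + ?p d"
      by (rule poly_mapping_eqI) (use fin in \<open>auto simp: cd lookup_add lookup_indicator_vector\<close>)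
    moreover have "a \<noteq> b" using ab by auto
    ultimately show ?thesis using h[of a b c d] ab s cd by blast
  qed
  show "l v = m v" if "\<forall>v\<in>V. 0 \<le> l v" "\<forall>v\<in>V. 0 \<le> m v" "sum l V = 1" "sum m V = 1"
    "{v\<in>V. l v \<noteq> 0} \<in> ?T" "{v\<in>V. m v \<noteq> 0} \<in> ?T"
    "(\<Sum>v\<in>V. l v *\<^sub>R ?p v) = (\<Sum>v\<in>V. m v *\<^sub>R ?p v)" "v \<in> V" for l m v
    by (rule chain_weights_unique[of V Q F l m v])
      (use that V Q F FU in \<open>auto simp: bij_betw_def up_sets_def\<close>)
qed

lemma order_polytope_hull_bij:
  assumes "finite Q" "bij_betw F V (up_sets Q lt)"
  shows "convex hull ((\<lambda>v. indicator_vector (F v)) ` V) = order_polytope Q lt"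
    "{x. x extreme_point_of order_polytope Q lt} = (\<lambda>v. indicator_vector (F v)) ` V"
proof -
  have "(\<lambda>v. indicator_vector (F v)) ` V = indicator_vector ` up_sets Q lt"
    using assms(2) by (auto simp: bij_betw_def image_image[symmetric])
  then show "convex hull ((\<lambda>v. indicator_vector (F v)) ` V) = order_polytope Q lt"
    "{x. x extreme_point_of order_polytope Q lt} = (\<lambda>v. indicator_vector (F v)) ` V"
    using order_polytope_eq_hull[OF assms(1)] extreme_points_order_polytope[OF assms(1)] by simp_all
qed

section \<open>The grid embedding of the snake poset\<close>

text \<open>The empty letter is read as \<open>R\<close>. The rule for the first letter then becomes
  the general one: \<open>L\<close> is a change of letter and \<open>R\<close> a repetition, and the
  square formulas hold from \<open>n = 0\<close> on.\<close>

definition eff_letter :: "snake_word \<Rightarrow> nat \<Rightarrow> letter" where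
  "eff_letter w n = (if n = 0 then R else letter_at w n)"

primrec letter_count :: "snake_word \<Rightarrow> letter \<Rightarrow> nat \<Rightarrow> nat" where
  "letter_count w c 0 = 0"
| "letter_count w c (Suc n) = letter_count w c n + (if letter_at w (Suc n) = c then 1 else 0)"

text \<open>The coordinate in direction \<open>c\<close>, with \<open>n = i div 2\<close> in the
  last clause. The top of square \<open>n\<close> sits at the letter counts of the first
  \<open>n\<close> letters; \<open>2 n + 2\<close> is one step from it in the direction of letter
  \<open>n\<close>, and \<open>2 n + 3\<close> is the opposite corner.\<close>

fun depth :: "snake_word \<Rightarrow> letter \<Rightarrow> nat \<Rightarrow> nat" where
  "depth w c 0 = 0"
| "depth w c (Suc 0) = (if c = L then 1 else 0)"
| "depth w c (Suc (Suc i)) =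
     letter_count w c (i div 2) + (if odd i \<or> eff_letter w (i div 2) = c then 1 else 0)"

lemma letter_neq_R_iff [simp]: "c \<noteq> R \<longleftrightarrow> c = L" by (cases c) auto
lemma letter_neq_L_iff [simp]: "c \<noteq> L \<longleftrightarrow> c = R" by (cases c) auto
lemma all_letter: "(\<forall>c. P c) \<longleftrightarrow> P L \<and> P R" by (metis letter.exhaust)

lemma depth_even: "depth w c (2 * n + 2) = letter_count w c n + (if eff_letter w n = c then 1 else 0)"
  by simp

lemma depth_odd: "depth w c (2 * n + 3) = letter_count w c n + 1"
  by (simp add: numeral_3_eq_3)

text \<open>The bottom of the preceding square, seen as the second side corner of square
  \<open>n\<close>.\<close>

lemma depth_odd': "depth w c (2 * n + 1) = letter_count w c n + (if eff_letter w n = c then 0 else 1)"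
proof (cases n)
  case 0
  then show ?thesis by (cases c) (auto simp: eff_letter_def)
next
  case (Suc m)
  then have "2 * n + 1 = 2 * m + 3" by simp
  then show ?thesis using depth_odd[of w c m] Suc by (auto simp: eff_letter_def)
qed

lemma index_cases:
  obtains "i = 0" | "i = 1" | n where "i = 2 * n + 2" | n where "i = 2 * n + (3::nat)"
proof -
  have "i = 0 \<or> i = 1 \<or> (\<exists>n. i = 2 * n + 2) \<or> (\<exists>n. i = 2 * n + 3)" by presburger
  then show ?thesis using that by blast
qed

section \<open>Numbering and coordinates\<close>

lemma letter_count_mono: "m \<le> n \<Longrightarrow> letter_count w c m \<le> letter_count w c n"
  by (induction n) (auto simp: le_Suc_eq)

lemma letter_count_less:
  assumes "m < n"
  shows "letter_count w (eff_letter w n) m < letter_count w (eff_letter w n) n"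
proof -
  obtain n' where "n = Suc n'" using assms by (cases n) auto
  then show ?thesis using letter_count_mono[of m n' w "eff_letter w n"] assms
    by (simp add: eff_letter_def)
qed

text \<open>The top of a square is the side corner of the preceding square in the direction of the
  new letter. That corner is \<open>2 n\<close> if the letter repeats and \<open>2 n - 1\<close> if
  it changes.\<close>

lemma depth_side_cover:
  assumes "n \<le> length w"
  shows "depth w c (side_cover w n) = letter_count w c n"
proof -
  consider "n = 0" | "n = 1" | m where "n = m + 2" by (metis One_nat_def add_2_eq_Suc' not0_implies_Suc)
  then show ?thesis
  proof cases
    case 1
    then show ?thesis by (simp add: side_cover_def)
  next
    case 2
    then show ?thesis
      by (cases c; cases "letter_at w 1")
        (auto simp: side_cover_def eff_letter_def numeral_2_eq_2)
  next
    case 3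
    have sq: "2 * n - 1 = 2 * m + 3" "2 * n = 2 * (m + 1) + 2" "n = Suc (Suc m)" using 3 by auto
    show ?thesis
    proof (cases "letter_at w (Suc m) = letter_at w (Suc (Suc m))")
      case True
      then have "side_cover w n = 2 * (m + 1) + 2" using 3 by (simp add: side_cover_def)
      then show ?thesis unfolding depth_even using 3 True by (simp add: eff_letter_def)
    next
      case False
      then have "side_cover w n = 2 * m + 3" using 3 by (simp add: side_cover_def)
      then have "depth w c (side_cover w n) = letter_count w c m + 1" by (simp only: depth_odd)
      then show ?thesis using False unfolding sq(3)
        by (cases c; cases "letter_at w (Suc m)"; cases "letter_at w (Suc (Suc m))") auto
    qed
  qed
qed

lemma side_cover_less: "side_cover w n < 2 * n + 2"
  by (auto simp: side_cover_def)

lemma snake_covers_upto_iff: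
  "(a, b) \<in> snake_covers_upto w k \<longleftrightarrow> a = 1 \<and> b = 0 \<or>
     (\<exists>n\<le>k. a = 2 * n + 3 \<and> (b = 2 * n + 1 \<or> b = 2 * n + 2) \<or> a = 2 * n + 2 \<and> b = side_cover w n)"
proof (induction k)
  case 0
  then show ?case by (auto simp: side_cover_def)
next
  case (Suc k)
  have ex: "(\<exists>n\<le>Suc k. P n) \<longleftrightarrow> (\<exists>n\<le>k. P n) \<or> P (Suc k)" for P
    using le_Suc_eq by auto
  show ?case unfolding ex using Suc by (auto simp: Let_def)
qed

lemma snake_covers_iff:
  "(a, b) \<in> snake_covers w \<longleftrightarrow> a = 1 \<and> b = 0 \<or>
     (\<exists>n\<le>length w. a = 2 * n + 3 \<and> (b = 2 * n + 1 \<or> b = 2 * n + 2) \<or>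
        a = 2 * n + 2 \<and> b = side_cover w n)"
  unfolding snake_covers_def by (rule snake_covers_upto_iff)

lemma snake_covers_less: "(a, b) \<in> snake_covers w \<Longrightarrow> b < a \<and> a \<le> 2 * length w + 3"
  using side_cover_less by (auto simp: snake_covers_iff)

text \<open>Every generating relation is a unit step in the grid.\<close>

lemma snake_covers_depth:
  assumes "(a, b) \<in> snake_covers w"
  obtains d where "\<And>c. depth w c a = depth w c b + (if c = d then 1 else 0)"
proof -
  have "\<exists>d. \<forall>c. depth w c a = depth w c b + (if c = d then 1 else 0)"
    using assms unfolding snake_covers_iff
  proof (elim disjE conjE exE)
    show ?thesis if "a = 1" "b = 0" using that by (intro exI[of _ L]) auto
    fix n assume n: "n \<le> length w"
    show ?thesis if "a = 2 * n + 3" "b = 2 * n + 1"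
      by (intro exI[of _ "eff_letter w n"]) (simp only: that depth_odd depth_odd', auto)
    show ?thesis if "a = 2 * n + 3" "b = 2 * n + 2"
      by (intro exI[of _ "if eff_letter w n = L then R else L"])
        (simp only: that depth_odd depth_even, auto simp: all_letter)
    show ?thesis if "a = 2 * n + 2" "b = side_cover w n"
      by (intro exI[of _ "eff_letter w n"])
        (simp only: that depth_side_cover[OF n] depth_even, auto)
  qed
  with that show ?thesis by blast
qed

lemma depth_le_odd:
  assumes "b \<le> 2 * n + 1"
  shows "depth w c b \<le> depth w c (2 * n + 1)"
proof (cases b rule: index_cases)
  case 1
  then show ?thesis by simp
next
  case 2
  show ?thesis
  proof (cases n)
    case 0
    then show ?thesis using 2 by simp
  next
    case (Suc m)
    then have "2 * n + 1 = 2 * m + 3" by simp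
    then show ?thesis using depth_odd[of w c m] 2 by simp
  qed
next
  case (3 m)
  then have "2 * n + 1 = 2 * (n - 1) + 3" "m \<le> n - 1" using assms by simp_all
  then show ?thesis using letter_count_mono[of m "n - 1" w c] depth_odd[of w c "n - 1"]
    unfolding 3 depth_even by simp
next
  case (4 m)
  then have "Suc m \<le> n" using assms by simp
  then have "2 * n + 1 = 2 * (n - 1) + 3" "m \<le> n - 1" by simp_all
  then show ?thesis using letter_count_mono[of m "n - 1" w c] depth_odd[of w c "n - 1"] depth_odd[of w c m] 4
    by simp
qed

lemma depth_le: "b \<le> 2 * n + 3 \<Longrightarrow> depth w c b \<le> letter_count w c n + 1"
  using depth_le_odd[of b "Suc n" w c] depth_odd[of w c n] by (simp add: numeral_3_eq_3)

lemma depth_ge: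
  assumes "2 * n + 2 \<le> b"
  shows "letter_count w c n \<le> depth w c b"
proof (cases b rule: index_cases)
  case (3 m)
  then show ?thesis using assms letter_count_mono[of n m w c] unfolding 3 depth_even by simp
next
  case (4 m)
  then show ?thesis using assms letter_count_mono[of n m w c] unfolding 4 depth_odd by simp
qed (use assms in auto)

lemma depth_gt:
  assumes "2 * n + 3 < b"
  obtains c where "letter_count w c n + 1 < depth w c b"
proof (cases b rule: index_cases)
  case (3 m)
  have "letter_count w (eff_letter w m) n < letter_count w (eff_letter w m) m"
    using 3 assms by (intro letter_count_less) simp
  then show ?thesis using that[of "eff_letter w m"] unfolding 3 depth_even by simp
next
  case (4 m)
  have "letter_count w (eff_letter w m) n < letter_count w (eff_letter w m) m"
    using 4 assms by (intro letter_count_less) simp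
  then show ?thesis using that[of "eff_letter w m"] unfolding 4 depth_odd by simp
qed (use assms in auto)

lemma depth_pos: "0 < b \<Longrightarrow> \<exists>c. 0 < depth w c b"
proof (cases b rule: index_cases)
  case (3 n)
  then show ?thesis using depth_even[of w "eff_letter w n" n] by (metis add_gr_0 zero_less_one)
qed (auto simp: numeral_3_eq_3)

section \<open>The order read off from the coordinates\<close>

lemma trancl_snake_covers_less: "(a, b) \<in> (snake_covers w)\<^sup>+ \<Longrightarrow> b < a \<and> a \<le> 2 * length w + 3"
  by (induction rule: trancl.induct) (auto dest: snake_covers_less)

lemma trancl_snake_covers_depth:
  "(a, b) \<in> (snake_covers w)\<^sup>+ \<Longrightarrow> depth w c b \<le> depth w c a"
proof (induction rule: trancl.induct)
  case (r_into_trancl a b)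
  then show ?case using snake_covers_depth by (metis le_add1)
next
  case (trancl_into_trancl a b d)
  then show ?case using snake_covers_depth by (metis le_add1 le_trans)
qed

lemma depth_imp_trancl:
  assumes "a \<le> 2 * length w + 3" "a \<noteq> b" "\<And>c. depth w c b \<le> depth w c a"
  shows "(a, b) \<in> (snake_covers w)\<^sup>+"
  using assms
proof (induction a rule: less_induct)
  case (less a)
  \<comment> \<open>it suffices to find an upper cover of \<open>a\<close> that still lies below \<open>b\<close>\<close>
  have step: ?case if "(a, e) \<in> snake_covers w" "\<And>c. depth w c b \<le> depth w c e" for e
  proof (cases "e = b")
    case True
    then show ?thesis using that by auto
  next
    case False
    have "e < a" "e \<le> 2 * length w + 3" using snake_covers_less that less.prems by fastforce+
    then have "(e, b) \<in> (snake_covers w)\<^sup>+" using less.IH False that by blast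
    then show ?thesis using that by (meson trancl_into_trancl2)
  qed
  show ?case
  proof (cases a rule: index_cases)
    case 1
    then have "b > 0" using less.prems by simp
    then obtain c where "depth w c b > 0" using depth_pos by blast
    then show ?thesis using 1 less.prems(3)[of c] by simp
  next
    case 2
    have "b = 0"
    proof (rule ccontr)
      assume "b \<noteq> 0"
      then have b: "b \<ge> 2" using 2 less.prems by simp
      have R: "depth w R b = 0" and L: "depth w L b \<le> 1" using less.prems(3)[of R] less.prems(3)[of L] 2 by simp_all
      show False
      proof (cases b rule: index_cases)
        case (3 n)
        have "eff_letter w n = L" using R unfolding 3 depth_even by (auto split: if_splits)
        moreover from this have "n \<noteq> 0" by (auto simp: eff_letter_def split: if_splits)
        ultimately have "letter_count w L n > 0" using letter_count_less[of 0 n w] by auto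
        then show False using L \<open>eff_letter w n = L\<close> unfolding 3 depth_even by simp
      next
        case (4 n)
        then show False using R unfolding 4 depth_odd by simp
      qed (use b in auto)
    qed
    then show ?thesis using 2 by (auto simp: snake_covers_iff)
  next
    case (3 n)
    let ?c = "eff_letter w n"
    have n: "n \<le> length w" using less.prems 3 by simp
    have le: "depth w c b \<le> letter_count w c n + (if ?c = c then 1 else 0)" for c
      using less.prems(3)[of c] unfolding 3 depth_even .
    \<comment> \<open>The only upper cover of a side corner is the top of its square, so
      \<open>b\<close> must not use the last step in direction \<open>?c\<close>. Earlier elements
      do not reach it; \<open>2 n + 3\<close> fails in the other direction and later elements leave
      the square.\<close>
    have "depth w ?c b \<le> letter_count w ?c n"
    proof (cases "b \<le> 2 * n + 1")
      case True
      then show ?thesis using depth_le_odd[of b n w ?c] unfolding depth_odd' by simp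
    next
      case False
      obtain d where d: "d \<noteq> ?c" by (metis letter.distinct(1))
      have "depth w d b \<le> letter_count w d n" using le[of d] d by simp
      then have "b \<noteq> 2 * n + 3" using depth_odd[of w d n] by auto
      then have "2 * n + 3 < b" using False less.prems(2) 3 by simp
      then obtain c where "letter_count w c n + 1 < depth w c b" using depth_gt by blast
      then show ?thesis using le[of c] by (auto split: if_splits)
    qed
    then have "depth w c b \<le> depth w c (side_cover w n)" for c
      using le[of c] by (auto simp: depth_side_cover[OF n] split: if_splits)
    moreover have "(a, side_cover w n) \<in> snake_covers w" using 3 n by (auto simp: snake_covers_iff)
    ultimately show ?thesis using step by blast
  next
    case (4 n)
    let ?c = "eff_letter w n"
    have n: "n \<le> length w" using less.prems 4 by simp
    have le: "depth w c b \<le> letter_count w c n + 1" for c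
      using less.prems(3)[of c] unfolding 4 depth_odd .
    have b: "b < 2 * n + 3"
    proof (rule ccontr)
      assume "\<not> b < 2 * n + 3"
      then have "2 * n + 3 < b" using 4 less.prems by simp
      then obtain c where "letter_count w c n + 1 < depth w c b" using depth_gt by blast
      then show False using le[of c] by simp
    qed
    show ?thesis
    proof (cases "b = 2 * n + 2")
      case True
      have "(a, 2 * n + 2) \<in> snake_covers w" using 4 n by (auto simp: snake_covers_iff)
      then show ?thesis using True by auto
    next
      case False
      then have "depth w c b \<le> depth w c (2 * n + 1)" for c using b by (intro depth_le_odd) simp
      moreover have "(a, 2 * n + 1) \<in> snake_covers w" using 4 n by (auto simp: snake_covers_iff)
      ultimately show ?thesis using step by blast
    qed
  qed
qed

lemma trancl_snake_covers_iff:
  assumes "a \<le> 2 * length w + 3"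
  shows "(a, b) \<in> (snake_covers w)\<^sup>+ \<longleftrightarrow> a \<noteq> b \<and> (\<forall>c. depth w c b \<le> depth w c a)"
  using depth_imp_trancl[OF assms] trancl_snake_covers_depth trancl_snake_covers_less by fastforce

section \<open>Meet-irreducible elements and filters\<close>

text \<open>The depth is shifted by one to leave 0 for \<open>Top\<close>. Levels of ordinary
  elements end at the letter count plus 2, whence the 3 for \<open>Bot\<close>.\<close>

fun level :: "snake_word \<Rightarrow> letter \<Rightarrow> hat \<Rightarrow> nat" where
  "level w c Top = 0"
| "level w c (El a) = depth w c a + 1"
| "level w c Bot = letter_count w c (length w) + 3"

text \<open>The thresholds of direction \<open>c\<close>: one meet-irreducible for each level from 1
  to that of \<open>Bot\<close>. The ends \<open>El 0\<close> and \<open>Bot\<close> belong to both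
  tracks; \<open>El 1\<close> is the \<open>L\<close>-side of the first square, whose letter counts
  as \<open>R\<close>.\<close>

definition track :: "snake_word \<Rightarrow> letter \<Rightarrow> hat set" where
  "track w c = {Bot, El 0} \<union> (if c = L then {El 1} else {}) \<union>
     {El (2 * n + 2) | n. n \<le> length w \<and> eff_letter w n = c}"

abbreviation hat_le :: "snake_word \<Rightarrow> hat \<Rightarrow> hat \<Rightarrow> bool" where
  "hat_le w x y \<equiv> hat_less w x y \<or> x = y"

lemma El_in_hatP [simp]: "El a \<in> hatP w \<longleftrightarrow> a \<le> 2 * length w + 3"
  by (auto simp: hatP_def)

lemma Top_Bot_in_hatP [simp]: "Top \<in> hatP w" "Bot \<in> hatP w"
  by (auto simp: hatP_def)

lemma finite_hatP: "finite (hatP w)"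
  by (simp add: hatP_def)

lemma hat_less_Bot [simp]: "hat_less w x Bot \<longleftrightarrow> False"
  by (cases x) auto

lemma hat_less_Top [simp]: "hat_less w x Top \<longleftrightarrow> x \<noteq> Top"
  by (cases x) auto

lemma level_El_less: "a \<le> 2 * length w + 3 \<Longrightarrow> level w c (El a) < level w c Bot"
  using depth_le[of a "length w" w c] by simp

lemma hat_le_iff_level:
  assumes "x \<in> hatP w" "y \<in> hatP w"
  shows "hat_le w x y \<longleftrightarrow> (\<forall>c. level w c y \<le> level w c x)"
proof (cases x)
  case Bot
  have "level w c y \<le> level w c Bot" for c
    using level_El_less[of _ w c] assms by (cases y) (auto intro: less_imp_le)
  then show ?thesis using Bot by (cases y) auto
next
  case Top
  then show ?thesis by (cases y) auto
next
  case (El a)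
  then have "a \<le> 2 * length w + 3" using assms by simp
  then have "\<not> level w L Bot \<le> level w L (El a)" using level_El_less[of a w L] by simp
  then show ?thesis
    using El \<open>a \<le> _\<close> trancl_snake_covers_iff[of a w] by (cases y) auto
qed

lemma covers_in_iff_least:
  assumes "x \<in> A" "y\<^sub>0 \<in> A" "lt x y\<^sub>0" "\<And>z. z \<in> A \<Longrightarrow> lt x z \<Longrightarrow> (lt y\<^sub>0 z \<or> y\<^sub>0 = z) \<and> \<not> lt z y\<^sub>0"
  shows "covers_in A lt x y \<longleftrightarrow> y = y\<^sub>0"
  using assms unfolding covers_in_def by blast

lemma meet_irreducible_even:
  assumes "n \<le> length w"
  shows "covers_in (hatP w) (hat_less w) (El (2 * n + 2)) y \<longleftrightarrow> y = El (side_cover w n)"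
proof -
  let ?a = "2 * n + 2" and ?s = "side_cover w n"
  have cov: "(?a, ?s) \<in> snake_covers w" using assms by (auto simp: snake_covers_iff)
  have s: "?s \<le> 2 * length w + 3" using side_cover_less[of w n] assms by simp
  have up: "hat_le w (El ?s) z" if "hat_less w (El ?a) z" "z \<in> hatP w" for z
  proof (cases z)
    case (El b)
    then have "(?a, b) \<in> (snake_covers w)\<^sup>+" using that by simp
    then obtain e where e: "(?a, e) \<in> snake_covers w" "(e, b) \<in> (snake_covers w)\<^sup>*"
      by (meson tranclD)
    then have "e = ?s" by (auto simp: snake_covers_iff) presburger+
    then show ?thesis using e El by (auto simp: rtrancl_eq_or_trancl)
  qed (use that in auto)
  show ?thesis
  proof (rule covers_in_iff_least)
    show "El ?a \<in> hatP w" "El ?s \<in> hatP w" using assms s by auto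
    show "hat_less w (El ?a) (El ?s)" using cov by auto
    fix z assume z: "z \<in> hatP w" "hat_less w (El ?a) z"
    then have "hat_le w (El ?s) z" using up by blast
    moreover from this have "\<not> hat_less w z (El ?s)" using z
      by (cases z) (auto dest!: trancl_snake_covers_less)
    ultimately show "hat_le w (El ?s) z \<and> \<not> hat_less w z (El ?s)" by blast
  qed
qed

text \<open>An element in between agrees with both ends in one coordinate and lies within a unit
  interval in the other, so it coincides with one end.\<close>

lemma covers_in_hatP_El:
  assumes "(a, b) \<in> snake_covers w"
  shows "covers_in (hatP w) (hat_less w) (El a) (El b)"
  unfolding covers_in_def
proof (intro conjI notI)
  have ab: "b < a" "a \<le> 2 * length w + 3" using snake_covers_less assms by auto
  then show "El a \<in> hatP w" "El b \<in> hatP w" by auto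
  show "hat_less w (El a) (El b)" using assms by auto
  assume "\<exists>z\<in>hatP w. hat_less w (El a) z \<and> hat_less w z (El b)"
  then obtain z where z: "z \<in> hatP w" "hat_less w (El a) z" "hat_less w z (El b)" by blast
  then obtain e where e: "z = El e" by (cases z) auto
  obtain d where d: "\<And>c. depth w c a = depth w c b + (if c = d then 1 else 0)"
    using snake_covers_depth[OF assms] by blast
  have *: "a \<noteq> e" "e \<noteq> b" "depth w c b \<le> depth w c e" "depth w c e \<le> depth w c a" for c
    using z e ab trancl_snake_covers_iff[of a w e] trancl_snake_covers_iff[of e w b] by auto
  have "(\<forall>c. depth w c e = depth w c b) \<or> (\<forall>c. depth w c e = depth w c a)"
  proof (cases "depth w d e = depth w d b")
    case True
    then show ?thesis using *(3,4) d by (metis add.right_neutral le_antisym)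
  next
    case False
    then have "depth w d e = depth w d a" using *(3,4)[of d] d[of d] by simp
    then show ?thesis using *(3,4) d by (metis add.right_neutral le_antisym)
  qed
  then have "(b, e) \<in> (snake_covers w)\<^sup>+ \<or> (e, a) \<in> (snake_covers w)\<^sup>+"
    using * ab z e by (auto simp: trancl_snake_covers_iff)
  then show False using z e by (auto dest!: trancl_snake_covers_less)
qed

text \<open>Bottoms of squares have two upper covers; every other element except \<open>Top\<close>
  has exactly one.\<close>

lemma meet_irreducibles_eq: "meet_irreducibles w = track w L \<union> track w R"
proof -
  have even: "El (2 * n + 2) \<in> meet_irreducibles w" if "n \<le> length w" for n
  proof -
    have "\<exists>!y. covers_in (hatP w) (hat_less w) (El (2 * n + 2)) y"
      unfolding meet_irreducible_even[OF that] by blast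
    then show ?thesis using that by (simp add: meet_irreducibles_def)
  qed
  have odd: "El (2 * n + 3) \<notin> meet_irreducibles w" if "n \<le> length w" for n
  proof -
    have "(2 * n + 3, 2 * n + 1) \<in> snake_covers w" "(2 * n + 3, 2 * n + 2) \<in> snake_covers w"
      using that by (auto simp: snake_covers_iff)
    then have "covers_in (hatP w) (hat_less w) (El (2 * n + 3)) (El (2 * n + 1))"
      "covers_in (hatP w) (hat_less w) (El (2 * n + 3)) (El (2 * n + 2))"
      by (auto intro: covers_in_hatP_El)
    moreover have "El (2 * n + 1) \<noteq> El (2 * n + 2)" by simp
    ultimately have "\<not> (\<exists>!y. covers_in (hatP w) (hat_less w) (El (2 * n + 3)) y)" by blast
    then show ?thesis unfolding meet_irreducibles_def by blast
  qed
  have zero: "covers_in (hatP w) (hat_less w) (El 0) y \<longleftrightarrow> y = Top" for y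
  proof -
    have "\<not> hat_less w (El 0) (El b)" for b using trancl_snake_covers_less[of 0 b w] by auto
    then have "z = Top" if "hat_less w (El 0) z" for z using that by (cases z) auto
    then show ?thesis by (intro covers_in_iff_least) force+
  qed
  have one: "covers_in (hatP w) (hat_less w) (El 1) y \<longleftrightarrow> y = El 0" for y
  proof -
    have c: "(1, 0) \<in> snake_covers w" by (auto simp: snake_covers_iff)
    have "\<not> hat_less w (El 1) (El b)" if "b \<noteq> 0" for b
      using trancl_snake_covers_less[of 1 b w] that by auto
    then have "z = Top \<or> z = El 0" if "hat_less w (El 1) z" for z using that by (cases z) auto
    moreover have "\<not> hat_less w (El 0) (El 0)" using trancl_snake_covers_less[of 0 0 w] by auto
    ultimately show ?thesis using c by (intro covers_in_iff_least) force+
  qed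
  have bot: "covers_in (hatP w) (hat_less w) Bot y \<longleftrightarrow> y = El (2 * length w + 3)" for y
  proof -
    let ?m = "El (2 * length w + 3)"
    have "hat_le w ?m z" if z: "z \<in> hatP w" "z \<noteq> Bot" for z
    proof (cases z)
      case (El b)
      then have "level w c z \<le> level w c ?m" for c
        using z depth_le[of b "length w" w c] by (simp add: depth_odd)
      then show ?thesis using z by (subst hat_le_iff_level) auto
    qed (use z in auto)
    moreover have "\<not> hat_less w z ?m" if "z \<noteq> Bot" for z
      using that by (cases z) (auto dest: trancl_snake_covers_less)
    ultimately show ?thesis by (intro covers_in_iff_least) auto
  qed
  show ?thesis
  proof (intro equalityI subsetI)
    fix q assume q: "q \<in> meet_irreducibles w"
    show "q \<in> track w L \<union> track w R"
    proof (cases q)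
      case Bot
      then show ?thesis by (simp add: track_def)
    next
      case Top
      then show ?thesis using q by (simp add: meet_irreducibles_def)
    next
      case (El a)
      then have "a \<le> 2 * length w + 3" using q by (simp add: meet_irreducibles_def)
      then show ?thesis using odd q El
        by (cases a rule: index_cases) (auto simp: track_def)
    qed
  next
    fix q assume "q \<in> track w L \<union> track w R"
    then consider "q = Bot" | "q = El 0" | "q = El 1" | n where "n \<le> length w" "q = El (2 * n + 2)"
      by (auto simp: track_def)
    then show "q \<in> meet_irreducibles w"
      using even zero one bot by cases (auto simp: meet_irreducibles_def)
  qed
qed

lemma track_in_hatP: "track w c \<subseteq> hatP w"
  by (auto simp: track_def)

lemma finite_meet_irreducibles: "finite (meet_irreducibles w)"
  unfolding meet_irreducibles_eq using track_in_hatP finite_hatP by (meson finite_UnI finite_subset)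

text \<open>For \<open>q = El (2 * n + 2)\<close> with letter \<open>c\<close>, elements numbered
  below \<open>2 n + 2\<close> do not reach the level of \<open>q\<close> in direction
  \<open>c\<close>. An element that does reach it has a number from \<open>2 n + 2\<close> on and is
  then automatically deep enough in the other direction.\<close>

lemma hat_le_track:
  assumes v: "v \<in> hatP w" and q: "q \<in> track w c"
  shows "hat_le w v q \<longleftrightarrow> level w c q \<le> level w c v"
proof
  have qP: "q \<in> hatP w" using q track_in_hatP by auto
  show "hat_le w v q \<Longrightarrow> level w c q \<le> level w c v" using hat_le_iff_level[OF v qP] by blast
  assume le: "level w c q \<le> level w c v"
  show "hat_le w v q"
  proof (cases v)
    case Bot
    then show ?thesis by auto
  next
    case Top
    then show ?thesis using le q by (auto simp: track_def split: if_splits)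
  next
    case (El a)
    then have a: "a \<le> 2 * length w + 3" using v by simp
    from q consider "q = Bot" | "q = El 0" | "q = El 1" "c = L"
      | n where "n \<le> length w" "eff_letter w n = c" "q = El (2 * n + 2)"
      by (auto simp: track_def split: if_splits)
    then have "level w d q \<le> level w d v" for d
    proof cases
      case 1
      then show ?thesis using le El level_El_less[OF a, of c] by simp
    next
      case 2
      then show ?thesis using El by simp
    next
      case 3
      then show ?thesis using El le by (cases d) auto
    next
      case (4 n)
      have "2 * n + 2 \<le> a"
      proof (rule ccontr)
        assume "\<not> 2 * n + 2 \<le> a"
        then have "depth w c a \<le> depth w c (2 * n + 1)" by (intro depth_le_odd) simp
        then have "depth w c a \<le> letter_count w c n" unfolding depth_odd' using 4 by simp
        moreover have "depth w c (2 * n + 2) \<le> depth w c a" using le 4 El by simp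
        ultimately show False unfolding depth_even using 4 by simp
      qed
      then have "letter_count w d n \<le> depth w d a" using depth_ge by blast
      then show ?thesis using 4 El le by (cases "d = c") auto
    qed
    then show ?thesis using hat_le_iff_level[OF v qP] by blast
  qed
qed

lemma track_at_level:
  assumes "1 \<le> j" "j \<le> level w c Bot"
  obtains q where "q \<in> track w c" "level w c q = j"
proof -
  \<comment> \<open>The count grows by single steps, so each value \<open>i\<close> is first reached
    at an occurrence of \<open>c\<close>. Level \<open>j\<close> will be that of the occurrence
    number \<open>j - 2\<close>.\<close>
  have count: "\<exists>n\<le>k. n \<noteq> 0 \<and> letter_at w n = c \<and> letter_count w c n = i"
    if "1 \<le> i" "i \<le> letter_count w c k" for i k
    using that
  proof (induction k)
    case (Suc k)
    show ?case
    proof (cases "i \<le> letter_count w c k")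
      case True
      then show ?thesis using Suc by (meson le_SucI)
    next
      case False
      then have "letter_at w (Suc k) = c \<and> letter_count w c (Suc k) = i"
        using Suc.prems by (auto split: if_splits)
      then show ?thesis by blast
    qed
  qed simp
  consider "j = 1" | "j = 2" | "3 \<le> j" "j \<le> letter_count w c (length w) + 2" | "j = level w c Bot"
    using assms by force
  then show ?thesis
  proof cases
    case 1
    then show ?thesis by (intro that[of "El 0"]) (auto simp: track_def)
  next
    case 2
    show ?thesis
    proof (cases c)
      case L
      then show ?thesis using 2 by (intro that[of "El 1"]) (auto simp: track_def)
    next
      case R
      have "El (2 * 0 + 2) \<in> track w c" using R unfolding track_def by (auto simp: eff_letter_def)
      then show ?thesis using that[of "El (2 * 0 + 2)"] depth_even[of w c 0] R 2
        by (simp add: eff_letter_def)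
    qed
  next
    case 3
    then have "1 \<le> j - 2" "j - 2 \<le> letter_count w c (length w)" by simp_all
    then obtain n where n: "n \<le> length w" "n \<noteq> 0" "letter_at w n = c" "letter_count w c n = j - 2"
      using count by blast
    then have "El (2 * n + 2) \<in> track w c" unfolding track_def by (auto simp: eff_letter_def)
    moreover have "level w c (El (2 * n + 2)) = j"
      using n 3 depth_even[of w c n] by (simp add: eff_letter_def)
    ultimately show ?thesis using that by blast
  next
    case 4
    then show ?thesis by (intro that[of Bot]) (auto simp: track_def)
  qed
qed

lemma hat_le_antisym: "hat_le w x y \<Longrightarrow> hat_le w y x \<Longrightarrow> x = y"
  by (cases x; cases y) (auto dest!: trancl_snake_covers_less)

lemma inj_on_level_track: "inj_on (level w c) (track w c)"
proof (rule inj_onI)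
  fix p q assume *: "p \<in> track w c" "q \<in> track w c" "level w c p = level w c q"
  have P: "p \<in> hatP w" "q \<in> hatP w" using * track_in_hatP by auto
  have "hat_le w p q" "hat_le w q p" using hat_le_track[OF P(1) *(2)] hat_le_track[OF P(2) *(1)] *(3) by auto
  then show "p = q" by (rule hat_le_antisym)
qed

section \<open>Filters of meet-irreducibles are principal\<close>

definition principal_filter :: "snake_word \<Rightarrow> hat \<Rightarrow> hat set" where
  "principal_filter w x = {q \<in> meet_irreducibles w. hat_le w x q}"

lemma filter_vertex_eq: "filter_vertex w x = indicator_vector (principal_filter w x)"
  by (simp add: filter_vertex_def indicator_vector_def principal_filter_def)

lemma in_principal_filter_iff:
  "v \<in> hatP w \<Longrightarrow> q \<in> track w c \<Longrightarrow> q \<in> principal_filter w v \<longleftrightarrow> level w c q \<le> level w c v"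
  using hat_le_track by (cases c) (auto simp: principal_filter_def meet_irreducibles_eq)

text \<open>Each positive level of \<open>y\<close> is attained on the corresponding track; testing
  the two filters at that element compares the levels of \<open>x\<close> and
  \<open>y\<close>.\<close>

lemma principal_filter_subset_iff:
  assumes x: "x \<in> hatP w" and y: "y \<in> hatP w"
  shows "principal_filter w y \<subseteq> principal_filter w x \<longleftrightarrow> hat_le w x y"
proof
  assume sub: "principal_filter w y \<subseteq> principal_filter w x"
  have "level w c y \<le> level w c x" for c
  proof (cases "level w c y = 0")
    case False
    have "level w c y \<le> level w c Bot"
      using y level_El_less[of _ w c] by (cases y) (auto intro: less_imp_le)
    then obtain q where q: "q \<in> track w c" "level w c q = level w c y"
      using track_at_level[of "level w c y" w c] False by auto
    then have "q \<in> principal_filter w y" using in_principal_filter_iff y by simp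
    then have "q \<in> principal_filter w x" using sub by blast
    then show ?thesis using in_principal_filter_iff[OF x q(1)] q(2) by simp
  qed simp
  then show "hat_le w x y" using hat_le_iff_level x y by blast
next
  assume le: "hat_le w x y"
  show "principal_filter w y \<subseteq> principal_filter w x"
  proof
    fix q assume q: "q \<in> principal_filter w y"
    then obtain c where c: "q \<in> track w c" by (auto simp: principal_filter_def meet_irreducibles_eq)
    have "level w c q \<le> level w c y" using q in_principal_filter_iff[OF y c] by simp
    also have "\<dots> \<le> level w c x" using le hat_le_iff_level[OF x y] by blast
    finally show "q \<in> principal_filter w x" using in_principal_filter_iff[OF x c] by simp
  qed
qed

lemma hat_le_trans:
  assumes "hat_le w x y" "hat_le w y z"
  shows "hat_le w x z"
  using assms by (cases x; cases y; cases z) auto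

lemma inj_on_principal_filter: "inj_on (principal_filter w) (hatP w)"
proof (rule inj_onI)
  fix x y assume "x \<in> hatP w" "y \<in> hatP w" "principal_filter w x = principal_filter w y"
  then have "hat_le w x y" "hat_le w y x" using principal_filter_subset_iff by (metis order_refl)+
  then show "x = y" by (rule hat_le_antisym)
qed

lemma principal_filter_up_set: "principal_filter w x \<in> up_sets (meet_irreducibles w) (hat_less w)"
  using hat_le_trans[of w x] by (auto simp: up_sets_def principal_filter_def)

lemma principal_filter_odd:
  assumes "n \<le> length w"
  shows "principal_filter w (El (2 * n + 3)) = {El a | a. a \<le> 2 * n + 3 \<and> El a \<in> meet_irreducibles w}"
proof -
  have "hat_le w (El (2 * n + 3)) (El a) \<longleftrightarrow> a \<le> 2 * n + 3" if "a \<le> 2 * length w + 3" for a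
  proof
    show "a \<le> 2 * n + 3" if "hat_le w (El (2 * n + 3)) (El a)"
      using that by (auto dest: trancl_snake_covers_less)
    assume a: "a \<le> 2 * n + 3"
    have "level w c (El a) \<le> level w c (El (2 * n + 3))" for c
      using depth_le[OF a, of w c] by (simp add: depth_odd)
    then show "hat_le w (El (2 * n + 3)) (El a)"
      using that assms by (subst hat_le_iff_level) auto
  qed
  moreover have "\<not> hat_le w (El (2 * n + 3)) Bot" "Top \<notin> meet_irreducibles w"
    by (auto simp: meet_irreducibles_def)
  moreover have "a \<le> 2 * length w + 3" if "El a \<in> meet_irreducibles w" for a
    using that by (simp add: meet_irreducibles_def)
  ultimately show ?thesis unfolding principal_filter_def
    by (auto; metis hat.exhaust)
qed

text \<open>Let \<open>N\<close> be the largest number in \<open>G\<close>. Either \<open>G\<close>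
  is the filter of \<open>El N\<close>, or \<open>N = 2 n + 2\<close> is a side corner and
  \<open>G\<close> contains one more element, from the other track. In the latter case
  \<open>G\<close> is the filter of the bottom \<open>2 n + 3\<close> of that square.\<close>

lemma up_set_principal:
  assumes "G \<in> up_sets (meet_irreducibles w) (hat_less w)"
  obtains x where "x \<in> hatP w" "principal_filter w x = G"
proof -
  let ?Q = "meet_irreducibles w"
  have GQ: "G \<subseteq> ?Q" and up: "\<And>i j. i \<in> G \<Longrightarrow> j \<in> ?Q \<Longrightarrow> hat_le w i j \<Longrightarrow> j \<in> G"
    using assms by (auto simp: up_sets_def)
  have sub: "principal_filter w x \<subseteq> G" if "x \<in> G" for x
    using up[OF that] by (auto simp: principal_filter_def)
  consider "G = {}" | "Bot \<in> G" | "G \<noteq> {}" "Bot \<notin> G" by blast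
  then show ?thesis
  proof cases
    case 1
    then show ?thesis by (intro that[of Top]) (auto simp: principal_filter_def meet_irreducibles_def)
  next
    case 2
    then have "principal_filter w Bot = G" using GQ sub[OF 2] by (auto simp: principal_filter_def)
    then show ?thesis by (intro that[of Bot]) auto
  next
    case 3
    define I where "I = {a. El a \<in> G}"
    have bnd: "a \<le> 2 * length w + 3" if "a \<in> I" for a
      using that GQ by (auto simp: I_def meet_irreducibles_def)
    have GI: "G = El ` I"
    proof -
      have "q \<in> El ` I" if "q \<in> G" for q
        using that 3 GQ by (cases q) (auto simp: I_def meet_irreducibles_def)
      then show ?thesis by (auto simp: I_def)
    qed
    have "finite I" using bnd by (meson finite_nat_set_iff_bounded_le)
    moreover have "I \<noteq> {}" using 3 GI by auto
    ultimately obtain N where N: "N \<in> I" "\<And>a. a \<in> I \<Longrightarrow> a \<le> N"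
      using Max_in[of I] Max_ge[of I] by blast
    have NP: "El N \<in> hatP w" using bnd N by simp
    have NQ: "El N \<in> ?Q" using N GQ by (auto simp: I_def)
    have subN: "principal_filter w (El N) \<subseteq> G" using sub N by (auto simp: I_def)
    show ?thesis
    proof (cases "G = principal_filter w (El N)")
      case True
      then show ?thesis using that[OF NP] by simp
    next
      case False
      then obtain q0 where q0: "q0 \<in> G" "q0 \<notin> principal_filter w (El N)" using subN by blast
      then obtain a0 where a0: "q0 = El a0" "a0 \<le> N" using GI N by auto
      have q0Q: "q0 \<in> ?Q" using q0 GQ by auto
      have ne: "\<not> hat_le w (El N) q0" using q0 q0Q by (auto simp: principal_filter_def)
      obtain n where n: "N = 2 * n + 2" "n \<le> length w"
      proof -
        have "\<exists>n. N = 2 * n + 2 \<and> n \<le> length w"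
        proof (cases N rule: index_cases)
          case 1
          then show ?thesis using a0 ne by auto
        next
          case 2
          have "(1, 0) \<in> snake_covers w" by (auto simp: snake_covers_iff)
          then show ?thesis using 2 a0 ne by (cases a0) auto
        next
          case (3 n)
          then show ?thesis using bnd[OF N(1)] by simp
        next
          case (4 n)
          then show ?thesis using NQ unfolding meet_irreducibles_eq track_def
            by (auto split: if_splits; presburger)
        qed
        then show thesis using that by blast
      qed
      define c where "c = eff_letter w n"
      have lev: "level w d (El N) = letter_count w d n + (if d = c then 2 else 1)" for d
        using depth_even[of w d n] n by (auto simp: c_def)
      have le: "level w d (El a) \<le> letter_count w d n + 2" if "a \<le> N + 1" for a d
        using depth_le[of a n w d] that n by simp
      \<comment> \<open>An element up to this square that the filter of \<open>El N\<close> misses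
        must be deeper than \<open>El N\<close> in its own direction. That leaves the other track
        and one level on it, so there is only one such element.\<close>
      have new: "level w d q = letter_count w d n + 2 \<and> d \<noteq> c"
        if "q \<in> track w d" "q \<notin> principal_filter w (El N)" "q = El a" "a \<le> N + 1" for q d a
        using that in_principal_filter_iff[OF NP that(1)] lev[of d] le[of a d]
        by (auto split: if_splits)
      obtain d where d: "q0 \<in> track w d" using q0Q by (auto simp: meet_irreducibles_eq)
      have "principal_filter w (El (2 * n + 3)) = G"
      proof
        show "G \<subseteq> principal_filter w (El (2 * n + 3))"
        proof
          fix q assume q: "q \<in> G"
          then obtain a where a: "q = El a" "a \<in> I" using GI by blast
          then have "a \<le> 2 * n + 3" using N(2)[of a] n by simp
          moreover have "q \<in> ?Q" using q GQ by blast
          ultimately show "q \<in> principal_filter w (El (2 * n + 3))"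
            unfolding principal_filter_odd[OF n(2)] using a by blast
        qed
        show "principal_filter w (El (2 * n + 3)) \<subseteq> G"
        proof
          fix q assume "q \<in> principal_filter w (El (2 * n + 3))"
          then obtain a where a: "q = El a" "a \<le> N + 1" "q \<in> ?Q"
            unfolding principal_filter_odd[OF n(2)] n by auto
          show "q \<in> G"
          proof (cases "q \<in> principal_filter w (El N)")
            case True
            then show ?thesis using subN by blast
          next
            case False
            obtain d' where d': "q \<in> track w d'" using a by (auto simp: meet_irreducibles_eq)
            have "d' = d" using new[OF d' False a(1,2)] new[OF d q0(2) a0(1)] a0 
              by (cases c; cases d; cases d') auto
            then have "q = q0"
              using new[OF d' False a(1,2)] new[OF d q0(2) a0(1)] a0 d d' inj_on_level_track[of w d]
              by (intro inj_onD[of "level w d"]) auto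
            then show ?thesis using q0 by simp
          qed
        qed
      qed
      then show ?thesis using that[of "El (2 * n + 3)"] n by simp
    qed
  qed
qed

lemma bij_betw_principal_filter:
  "bij_betw (principal_filter w) (hatP w) (up_sets (meet_irreducibles w) (hat_less w))"
  unfolding bij_betw_def
proof
  show "inj_on (principal_filter w) (hatP w)" by (rule inj_on_principal_filter)
  show "principal_filter w ` hatP w = up_sets (meet_irreducibles w) (hat_less w)"
    using principal_filter_up_set up_set_principal by (metis (no_types, lifting) image_subset_iff
      equalityI image_eqI subsetI)
qed

text \<open>By finiteness every chain extends to a maximal one, so the simplices are exactly the
  chains, and comparability is nesting of filters.\<close>

lemma canonical_triangulation_eq:
  "canonical_triangulation w = {\<sigma>. \<sigma> \<subseteq> hatP w \<and> (\<forall>a\<in>\<sigma>. \<forall>b\<in>\<sigma>.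
     principal_filter w a \<subseteq> principal_filter w b \<or> principal_filter w b \<subseteq> principal_filter w a)}"
proof -
  let ?ch = "pred_on.chain (hatP w) (hat_less w)"
  have chain_iff: "?ch C \<longleftrightarrow> C \<subseteq> hatP w \<and> (\<forall>a\<in>C. \<forall>b\<in>C.
     principal_filter w a \<subseteq> principal_filter w b \<or> principal_filter w b \<subseteq> principal_filter w a)" for C
  proof (cases "C \<subseteq> hatP w")
    case True
    then have "hat_le w a b \<longleftrightarrow> principal_filter w b \<subseteq> principal_filter w a" if "a \<in> C" "b \<in> C" for a b
      using that by (subst principal_filter_subset_iff) auto
    moreover have "?ch C \<longleftrightarrow> (\<forall>a\<in>C. \<forall>b\<in>C. hat_le w a b \<or> hat_le w b a)"
      using True by (auto simp: pred_on.chain_def)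
    ultimately show ?thesis using True by (simp cong: ball_cong) blast
  qed (auto simp: pred_on.chain_def)
  have ext: "\<exists>D. pred_on.maxchain (hatP w) (hat_less w) D \<and> C \<subseteq> D" if C: "?ch C" for C
  proof -
    let ?X = "{D. ?ch D \<and> C \<subseteq> D}"
    have "?X \<subseteq> Pow (hatP w)" by (auto simp: pred_on.chain_def)
    then have "finite ?X" using finite_hatP by (meson finite_Pow_iff finite_subset)
    moreover have "?X \<noteq> {}" using C by auto
    ultimately obtain D where "D \<in> ?X" "\<forall>E\<in>?X. D \<subseteq> E \<longrightarrow> E = D"
      using finite_has_maximal[of ?X] by metis
    then show ?thesis unfolding pred_on.maxchain_def by (intro exI[of _ D]) auto
  qed
  have down: "?ch C \<Longrightarrow> \<sigma> \<subseteq> C \<Longrightarrow> ?ch \<sigma>" for C \<sigma> by (auto simp: pred_on.chain_def)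
  have "canonical_triangulation w = {\<sigma>. ?ch \<sigma>}"
    unfolding canonical_triangulation_def using ext down pred_on.maxchain_def by blast
  then show ?thesis using chain_iff by simp
qed

section \<open>The canonical height function\<close>

text \<open>The canonical rank in closed form. \<open>El i\<close> is normally the label of index
  \<open>i + 1\<close>; swapping the two labels of each rung places it at \<open>i\<close> for odd
  \<open>i\<close> and at \<open>i + 2\<close> for even \<open>i\<close>. If the first letter is
  \<open>L\<close>, the elements 1 and 2 trade places.\<close>

definition position :: "snake_word \<Rightarrow> hat \<Rightarrow> nat" where
  "position w x = (case x of Top \<Rightarrow> 0 | Bot \<Rightarrow> 2 * length w + 5
     | El i \<Rightarrow> if w \<noteq> [] \<and> letter_at w 1 = L \<and> i = 1 then 4
         else if w \<noteq> [] \<and> letter_at w 1 = L \<and> i = 2 then 1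
         else if odd i then i else i + 2)"

lemma nth_concat_pairs:
  "length (concat (map (\<lambda>j. [f j, g j]) [1..<Suc n])) = 2 * n \<and>
   (\<forall>j<n. concat (map (\<lambda>j. [f j, g j]) [1..<Suc n]) ! (2 * j) = f (Suc j) \<and>
          concat (map (\<lambda>j. [f j, g j]) [1..<Suc n]) ! (2 * j + 1) = g (Suc j))"
proof (induction n)
  case (Suc n)
  let ?c = "\<lambda>n. concat (map (\<lambda>j. [f j, g j]) [1..<Suc n])"
  have step: "?c (Suc n) = ?c n @ [f (Suc n), g (Suc n)]" by simp
  have len: "length (?c n) = 2 * n" using Suc by blast
  show ?case
  proof (intro conjI allI impI)
    show "length (?c (Suc n)) = 2 * Suc n" unfolding step length_append len by simp
    fix j assume j: "j < Suc n"
    show "?c (Suc n) ! (2 * j) = f (Suc j)"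
    proof (cases "j = n")
      case True
      then show ?thesis unfolding step nth_append len by simp
    next
      case False
      then show ?thesis using Suc j unfolding step nth_append len by simp
    qed
    show "?c (Suc n) ! (2 * j + 1) = g (Suc j)"
    proof (cases "j = n")
      case True
      then show ?thesis unfolding step nth_append len by simp
    next
      case False
      then show ?thesis using Suc j unfolding step nth_append len by simp
    qed
  qed
qed simp

lemma length_canonical_order: "length (canonical_order w) = 2 * length w + 6"
proof -
  have eq: "length w + 3 = Suc (length w + 2)" by simp
  show ?thesis
    unfolding canonical_order_def eq length_append
      nth_concat_pairs[of "\<lambda>j. x_label w (2 * j)" "\<lambda>j. x_label w (2 * j - 1)" "length w + 2", THEN conjunct1]
    by simp
qed

lemma nth_canonical_order:
  "canonical_order w ! 0 = Top"
  "canonical_order w ! (2 * length w + 5) = Bot"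
  "j < length w + 2 \<Longrightarrow> canonical_order w ! (2 * j + 1) = x_label w (2 * j + 2)"
  "j < length w + 2 \<Longrightarrow> canonical_order w ! (2 * j + 2) = x_label w (2 * j + 1)"
proof -
  let ?c = "concat (map (\<lambda>j. [x_label w (2 * j), x_label w (2 * j - 1)]) [1..<length w + 3])"
  have eq: "length w + 3 = Suc (length w + 2)" by simp
  have len: "length ?c = 2 * (length w + 2)"
    and nth: "\<And>j. j < length w + 2 \<Longrightarrow> ?c ! (2 * j) = x_label w (2 * Suc j) \<and> ?c ! (2 * j + 1) = x_label w (2 * Suc j - 1)"
    unfolding eq
    using nth_concat_pairs[of "\<lambda>j. x_label w (2 * j)" "\<lambda>j. x_label w (2 * j - 1)" "length w + 2"] by blast+
  have order: "canonical_order w = x_label w 0 # ?c @ [x_label w (2 * length w + 5)]"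
    by (simp add: canonical_order_def)
  show "canonical_order w ! 0 = Top" by (simp add: order x_label_def)
  have "canonical_order w ! (Suc (2 * (length w + 2))) = x_label w (2 * length w + 5)"
    unfolding order nth_Cons_Suc nth_append len by simp
  then show "canonical_order w ! (2 * length w + 5) = Bot" by (simp add: x_label_def eval_nat_numeral)
  assume j: "j < length w + 2"
  have "canonical_order w ! (Suc (2 * j)) = ?c ! (2 * j)"
    "canonical_order w ! (Suc (2 * j + 1)) = ?c ! (2 * j + 1)"
    unfolding order nth_Cons_Suc nth_append len using j by simp_all
  then show "canonical_order w ! (2 * j + 1) = x_label w (2 * j + 2)"
    "canonical_order w ! (2 * j + 2) = x_label w (2 * j + 1)" using nth[OF j] by simp_all
qed

lemma nth_position:
  assumes "x \<in> hatP w"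
  shows "position w x < length (canonical_order w) \<and> canonical_order w ! position w x = x"
proof (cases x)
  case (El i)
  then have i: "i \<le> 2 * length w + 3" using assms by simp
  show ?thesis
  proof (cases "w \<noteq> [] \<and> letter_at w 1 = L \<and> (i = 1 \<or> i = 2)")
    case True
    then have "length w \<noteq> 0" by simp
    then show ?thesis using True El nth_canonical_order(3)[of 0 w] nth_canonical_order(4)[of 1 w]
      by (auto simp: position_def x_label_def length_canonical_order)
  next
    case False
    show ?thesis
    proof (cases "odd i")
      case True
      then obtain m where m: "i = 2 * m + 1" by (elim oddE)
      have "position w x = 2 * m + 1" using False El m by (auto simp: position_def)
      moreover have "canonical_order w ! (2 * m + 1) = x_label w (2 * m + 2)"
        using m i by (intro nth_canonical_order) simp
      moreover have "x_label w (2 * m + 2) = El (2 * m + 1)"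
        using False m i by (auto simp: x_label_def; presburger)
      ultimately show ?thesis using El m i by (simp add: length_canonical_order)
    next
      case even: False
      then obtain m where m: "i = 2 * m" by auto
      have "position w x = 2 * m + 2" using False El m by (auto simp: position_def)
      moreover have "canonical_order w ! (2 * m + 2) = x_label w (2 * m + 1)"
        using m i by (intro nth_canonical_order) simp
      moreover have "x_label w (2 * m + 1) = El (2 * m)"
        using False m i by (auto simp: x_label_def)
      ultimately show ?thesis using El m i by (simp add: length_canonical_order)
    qed
  qed
qed (simp_all add: position_def length_canonical_order nth_canonical_order)

text \<open>The list has as many entries as there are elements and contains all of them.\<close>

lemma distinct_canonical_order: "distinct (canonical_order w)"
proof (rule card_distinct)
  have "hatP w \<subseteq> set (canonical_order w)" using nth_position nth_mem by (metis subsetI)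
  then have "card (hatP w) \<le> card (set (canonical_order w))" by (simp add: card_mono)
  moreover have "card (hatP w) = 2 * length w + 6"
  proof -
    have "card (El ` {0..2 * length w + 3}) = 2 * length w + 4"
      by (subst card_image) (auto simp: inj_on_def)
    then show ?thesis unfolding hatP_def by (subst card_Un_disjoint) auto
  qed
  ultimately show "card (set (canonical_order w)) = length (canonical_order w)"
    using card_length[of "canonical_order w"] by (simp add: length_canonical_order)
qed

lemma canonical_rank_eq:
  assumes "x \<in> hatP w"
  shows "canonical_rank w x = position w x"
  unfolding canonical_rank_def
proof (rule the_equality)
  show *: "position w x < length (canonical_order w) \<and> canonical_order w ! position w x = x"
    by (rule nth_position[OF assms])
  fix i assume "i < length (canonical_order w) \<and> canonical_order w ! i = x"
  then show "i = position w x"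
    using * nth_eq_iff_index_eq[OF distinct_canonical_order, of i w "position w x"] by simp
qed

text \<open>Odd-numbered elements lie below all earlier ones, so the later of two incomparable
  elements is a side corner; in the first square its partner can only be 1.\<close>

lemma incomparable_even:
  assumes ab: "a < b" "b \<le> 2 * length w + 3" and inc: "\<not> hat_le w (El b) (El a)"
  obtains m where "b = 2 * m + 2" "m \<le> length w" "m \<noteq> 0 \<or> a = 1"
proof (cases b rule: index_cases)
  case 2
  then have "(b, a) \<in> snake_covers w" using ab by (auto simp: snake_covers_iff)
  then show ?thesis using inc by auto
next
  case (3 m)
  have "m \<noteq> 0 \<or> a = 1"
  proof (rule ccontr)
    assume "\<not> (m \<noteq> 0 \<or> a = 1)"
    then have "a = 0" "m = 0" using ab 3 by auto
    then have "(b, a) \<in> snake_covers w" using 3 by (auto simp: snake_covers_iff side_cover_def)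
    then show False using inc by auto
  qed
  then show ?thesis using that 3 ab by simp
next
  case (4 m)
  have "level w c (El a) \<le> level w c (El b)" for c
    using depth_le[of a m w c] ab 4 by (simp add: depth_odd)
  then show ?thesis using inc ab by (subst (asm) hat_le_iff_level) auto
qed (use ab in auto)

text \<open>The join lies above \<open>El a\<close>, so it comes earlier than \<open>El a\<close> numerically; the meet is \<open>El (b + 1)\<close>.\<close>

lemma position_join_meet:
  assumes ab: "a < b" "b \<le> 2 * length w + 3"
    and inc: "\<not> hat_le w (El b) (El a)"
    and c: "c \<in> hatP w" "principal_filter w c = principal_filter w (El a) \<inter> principal_filter w (El b)"
    and d: "d \<in> hatP w" "principal_filter w d = principal_filter w (El a) \<union> principal_filter w (El b)"
  shows "position w c < max (position w (El a)) (position w (El b)) \<and>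
    position w d < max (position w (El a)) (position w (El b))"
proof -
  obtain m where m: "b = 2 * m + 2" "m \<le> length w" "m \<noteq> 0 \<or> a = 1"
    using incomparable_even[OF ab inc] .
  have P: "El a \<in> hatP w" "El b \<in> hatP w" "El (b + 1) \<in> hatP w" using ab m by auto
  have ac: "hat_le w (El a) c" "c \<noteq> El a"
  proof -
    show "hat_le w (El a) c" using c P principal_filter_subset_iff by blast
    show "c \<noteq> El a" using c(2) inc P principal_filter_subset_iff by blast
  qed
  have lv: "level w e (El a) \<le> letter_count w e m + 2" for e
    using depth_le[of a m w e] m ab by simp
  have dd: "d = El (b + 1)"
  proof (rule hat_le_antisym)
    have "hat_le w d (El b)" "hat_le w d (El a)" using d P principal_filter_subset_iff by blast+
    then have le: "level w e (El b) \<le> level w e d" "level w e (El a) \<le> level w e d" for e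
      using hat_le_iff_level d P by blast+
    \<comment> \<open>In some direction \<open>El a\<close> is deeper than \<open>El b\<close>. The
      bounds force this to be the direction in which \<open>El b\<close> makes no step, with
      \<open>El a\<close> at the last level of the square; anything below both is then below the
      bottom corner.\<close>
    obtain e where e: "level w e (El b) < level w e (El a)"
      using inc hat_le_iff_level[OF P(2,1)] by (meson not_le)
    have b: "level w f (El b) = letter_count w f m + (if eff_letter w m = f then 2 else 1)" for f
      unfolding m using depth_even[of w f m] by simp
    have "e \<noteq> eff_letter w m" "level w e (El a) = letter_count w e m + 2"
      using e lv[of e] b[of e] by (auto split: if_splits)
    then have "level w f (El (b + 1)) \<le> level w f d" for f
      using le[of f] b[of f] depth_odd[of w f m] m
      by (cases f; cases e; cases "eff_letter w m") (auto split: if_splits)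
    then show "hat_le w d (El (b + 1))" using hat_le_iff_level d P by blast
    have "level w f (El x) \<le> level w f (El (b + 1))" if "x \<le> b + 1" for f x
      using depth_le[of x m w f] that m depth_odd[of w f m] by simp
    then have "hat_le w (El (b + 1)) (El a)" "hat_le w (El (b + 1)) (El b)"
      using hat_le_iff_level[OF P(3,1)] hat_le_iff_level[OF P(3,2)] ab by auto
    then have "principal_filter w d \<subseteq> principal_filter w (El (b + 1))"
      using principal_filter_subset_iff P d(2) by (metis Un_least)
    then show "hat_le w (El (b + 1)) d" using principal_filter_subset_iff P d by blast
  qed
  \<comment> \<open>The pair 1, 2 is separate because of the possible exchange of their labels:
    either one may hold position 4, ahead of which come the meet at 3 and the join.\<close>
  show ?thesis
  proof (cases "m = 0")
    case True
    then have a: "a = 1" "b = 2" using m by auto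
    then have "c = Top \<or> c = El 0" using ac by (cases c) (auto dest: trancl_snake_covers_less)
    then show ?thesis using a dd by (auto simp: position_def)
  next
    case False
    then have b: "position w (El b) = b + 2" using m by (auto simp: position_def)
    moreover have "position w d < b + 2" using dd m False by (auto simp: position_def)
    moreover have "position w c < b + 2"
    proof (cases c)
      case (El e)
      then have "e < a" using ac by (auto dest: trancl_snake_covers_less)
      then show ?thesis using El m ab False by (auto simp: position_def)
    qed (use ac in \<open>auto simp: position_def\<close>)
    ultimately show ?thesis by (simp add: less_max_iff_disj)
  qed
qed

text \<open>Two powers with exponents below the maximum add up to at most the power of the maximum;
  the second, positive power on the right makes the inequality strict.\<close>

lemma sum_two_powers_less:
  assumes "i < max k l" "j < max k (l::nat)"
  shows "(2::real) ^ i + 2 ^ j < 2 ^ k + 2 ^ l"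
proof -
  obtain n where n: "max k l = Suc n" using assms(1) by (cases "max k l") auto
  have "(2::real) ^ i \<le> 2 ^ n" "(2::real) ^ j \<le> 2 ^ n" using assms n by (auto intro: power_increasing)
  then have "(2::real) ^ i + 2 ^ j \<le> 2 ^ max k l" unfolding n power_Suc by linarith
  also have "\<dots> < 2 ^ k + 2 ^ l" by (simp add: max_def)
  finally show ?thesis .
qed

lemma canonical_height_uncross:
  assumes P: "a \<in> hatP w" "b \<in> hatP w" "c \<in> hatP w" "d \<in> hatP w"
    and c: "principal_filter w c = principal_filter w a \<inter> principal_filter w b"
    and d: "principal_filter w d = principal_filter w a \<union> principal_filter w b"
    and inc: "\<not> principal_filter w a \<subseteq> principal_filter w b" "\<not> principal_filter w b \<subseteq> principal_filter w a"
  shows "canonical_height w c + canonical_height w d < canonical_height w a + canonical_height w b"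
proof -
  have inc': "\<not> hat_le w a b" "\<not> hat_le w b a" using inc principal_filter_subset_iff P by blast+
  then obtain i j where ij: "a = El i" "b = El j" by (cases a; cases b) auto
  then have "i < j \<or> j < i" using inc' by (metis nat_neq_iff)
  then have "position w c < max (position w a) (position w b) \<and> position w d < max (position w a) (position w b)"
  proof
    assume "i < j"
    then show ?thesis unfolding ij
      by (rule position_join_meet) (use P ij inc' c d in auto)
  next
    assume "j < i"
    then show ?thesis unfolding ij max.commute[of "position w (El i)"]
      by (rule position_join_meet) (use P ij inc' c d in auto)
  qed
  then show ?thesis unfolding canonical_height_def using P
    by (simp add: canonical_rank_eq sum_two_powers_less)
qed

lemma canonical_uncrossing:
  "uncrossing (hatP w) (filter_vertex w) (canonical_triangulation w) (canonical_height w)"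
proof -
  have fv: "filter_vertex w = (\<lambda>v. indicator_vector (principal_filter w v))"
    by (rule ext) (rule filter_vertex_eq)
  show ?thesis unfolding canonical_triangulation_eq fv
    by (rule order_polytope_uncrossing[OF finite_meet_irreducibles finite_hatP bij_betw_principal_filter])
      (rule canonical_height_uncross)
qed

lemma snake_polytope_hull:
  "convex hull (filter_vertex w ` hatP w) = snake_polytope w"
  "{x. x extreme_point_of snake_polytope w} = filter_vertex w ` hatP w"
proof -
  have "filter_vertex w = (\<lambda>v. indicator_vector (principal_filter w v))"
    by (rule ext) (rule filter_vertex_eq)
  then show "convex hull (filter_vertex w ` hatP w) = snake_polytope w"
    "{x. x extreme_point_of snake_polytope w} = filter_vertex w ` hatP w"
    unfolding snake_polytope_def
    using order_polytope_hull_bij[OF finite_meet_irreducibles bij_betw_principal_filter, of w] by simp_all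
qed

lemma uncrossing_regular_triangulation:
  assumes "uncrossing (hatP w) (filter_vertex w) \<T> h"
  shows "regular_triangulation_induced_by (hatP w) (filter_vertex w) (snake_polytope w) \<T> h"
  using uncrossing.regular_triangulation[OF assms] snake_polytope_hull by simp

section \<open>Ladders and twists\<close>

definition toggle :: "'a \<Rightarrow> 'a \<Rightarrow> 'a \<Rightarrow> ('a \<Rightarrow>\<^sub>0 real) \<Rightarrow> ('a \<Rightarrow>\<^sub>0 real)" where
  "toggle q\<^sub>0 q q\<^sub>1 x = x + Poly_Mapping.single q
     (Poly_Mapping.lookup x q\<^sub>0 - 2 * Poly_Mapping.lookup x q + Poly_Mapping.lookup x q\<^sub>1)"

lemma lookup_toggle:
  "Poly_Mapping.lookup (toggle q\<^sub>0 q q\<^sub>1 x) i =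
     (if i = q then Poly_Mapping.lookup x q\<^sub>0 - Poly_Mapping.lookup x q + Poly_Mapping.lookup x q\<^sub>1
      else Poly_Mapping.lookup x i)"
  by (simp add: toggle_def lookup_add lookup_single when_def)

lemma linear_toggle: "linear (toggle q\<^sub>0 q q\<^sub>1)"
  by (rule linearI; rule poly_mapping_eqI) (auto simp: lookup_toggle lookup_add algebra_simps)

lemma toggle_commute:
  assumes "q \<noteq> p" "q \<noteq> p\<^sub>0" "q \<noteq> p\<^sub>1" "p \<noteq> q\<^sub>0" "p \<noteq> q\<^sub>1"
  shows "toggle q\<^sub>0 q q\<^sub>1 (toggle p\<^sub>0 p p\<^sub>1 x) = toggle p\<^sub>0 p p\<^sub>1 (toggle q\<^sub>0 q q\<^sub>1 x)"
  by (rule poly_mapping_eqI) (use assms in \<open>auto simp: lookup_toggle\<close>)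

text \<open>At \<open>q\<^sub>0\<close>, \<open>q\<close>, \<open>q\<^sub>1\<close> a vertex reads
  000, 100, 110 or 111, according to its level. The toggle exchanges 100 and 110, the levels
  \<open>j\<close> and \<open>j + 1\<close>, and fixes the other two; all remaining coordinates
  ignore the exchange.\<close>

lemma filter_vertex_toggle:
  assumes v: "v \<in> hatP w" "v' \<in> hatP w"
    and d: "\<And>d. d \<noteq> c \<Longrightarrow> level w d v' = level w d v"
    and c: "level w c v = j \<and> level w c v' = j + 1 \<or> level w c v = j + 1 \<and> level w c v' = j \<or>
      v = v' \<and> level w c v \<noteq> j \<and> level w c v \<noteq> j + 1"
    and q: "q\<^sub>0 \<in> track w c" "q \<in> track w c" "q\<^sub>1 \<in> track w c"
      "level w c q\<^sub>0 = j" "level w c q = j + 1" "level w c q\<^sub>1 = j + 2"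
  shows "filter_vertex w v' = toggle q\<^sub>0 q q\<^sub>1 (filter_vertex w v)"
proof (rule poly_mapping_eqI)
  fix i
  have fin: "finite (principal_filter w u)" for u
    using finite_meet_irreducibles by (auto simp: principal_filter_def)
  have lk: "Poly_Mapping.lookup (filter_vertex w u) p = of_bool (level w e p \<le> level w e u)"
    if "u \<in> hatP w" "p \<in> track w e" for u p e
    using that fin by (simp add: filter_vertex_eq lookup_indicator_vector in_principal_filter_iff)
  show "Poly_Mapping.lookup (filter_vertex w v') i =
    Poly_Mapping.lookup (toggle q\<^sub>0 q q\<^sub>1 (filter_vertex w v)) i"
  proof (cases "i = q")
    case True
    then show ?thesis using c q by (auto simp: lookup_toggle lk[OF v(1) q(1)] lk[OF v(1) q(2)]
        lk[OF v(1) q(3)] lk[OF v(2) q(2)])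
  next
    case False
    show ?thesis
    proof (cases "i \<in> meet_irreducibles w")
      case True
      then obtain e where e: "i \<in> track w e" by (auto simp: meet_irreducibles_eq)
      have "level w e i \<le> level w e v' \<longleftrightarrow> level w e i \<le> level w e v"
      proof (cases "e = c")
        case True
        then have "level w c i \<noteq> j + 1"
          using inj_onD[OF inj_on_level_track, of w c i q] False e q by auto
        then show ?thesis using c True by auto
      next
        case False
        then show ?thesis using d by simp
      qed
      then show ?thesis using False by (simp add: lookup_toggle lk[OF v(1) e] lk[OF v(2) e])
    next
      case notin: False
      then have "i \<notin> principal_filter w u" for u by (simp add: principal_filter_def)
      then show ?thesis using False fin
        by (simp add: lookup_toggle filter_vertex_eq lookup_indicator_vector)
    qed
  qed
qed

lemma track_Int:
  assumes "q \<in> track w c" "q \<in> track w d" "c \<noteq> d"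
  shows "q = Bot \<or> q = El 0"
  using assms by (cases c; cases d) (auto simp: track_def)

section \<open>Ladders as grids with two columns\<close>

definition ladder_edges :: "'a list \<Rightarrow> ('a \<times> 'a) set" where
  "ladder_edges ys = {(ys ! (i + 2), ys ! i) | i. i + 2 < length ys} \<union>
     {(ys ! (2 * i + 1), ys ! (2 * i)) | i. 2 * i + 1 < length ys}"

lemma ladder_edges_iff:
  assumes "distinct ys" "p < length ys" "q < length ys"
  shows "(ys ! p, ys ! q) \<in> ladder_edges ys \<longleftrightarrow> p = q + 2 \<or> p = q + 1 \<and> even q"
proof
  assume "(ys ! p, ys ! q) \<in> ladder_edges ys"
  then show "p = q + 2 \<or> p = q + 1 \<and> even q"
    using assms by (auto simp: ladder_edges_def nth_eq_iff_index_eq)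
next
  assume "p = q + 2 \<or> p = q + 1 \<and> even q"
  then show "(ys ! p, ys ! q) \<in> ladder_edges ys"
    using assms by (auto simp: ladder_edges_def elim!: evenE)
qed

text \<open>Index \<open>i\<close> stands for the grid point with column \<open>i mod 2\<close> and
  row \<open>i div 2\<close>. Covers are the unit steps: by 2 along a column, and by 1 within a
  row.\<close>

lemma covers_in_ladder_grid:
  assumes ys: "distinct ys"
    and lt: "\<And>i j. i < length ys \<Longrightarrow> j < length ys \<Longrightarrow>
      lt (ys ! i) (ys ! j) \<longleftrightarrow> i \<noteq> j \<and> j mod 2 \<le> i mod 2 \<and> j div 2 \<le> i div 2"
  shows "{(a, b). covers_in (set ys) lt a b} = ladder_edges ys"
proof -
  have eq: "covers_in (set ys) lt (ys ! i) (ys ! j) \<longleftrightarrow> i = j + 2 \<or> i = j + 1 \<and> even j"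
    if ij: "i < length ys" "j < length ys" for i j
  proof
    assume cov: "covers_in (set ys) lt (ys ! i) (ys ! j)"
    then have l: "i \<noteq> j" "j mod 2 \<le> i mod 2" "j div 2 \<le> i div 2" using lt ij by (auto simp: covers_in_def)
    have no: "\<not> (lt (ys ! i) (ys ! k) \<and> lt (ys ! k) (ys ! j))" if "k < length ys" for k
      using cov that by (auto simp: covers_in_def)
    show "i = j + 2 \<or> i = j + 1 \<and> even j"
    proof (cases "i mod 2 = j mod 2")
      case True
      then have "j + 2 \<le> i" using l by presburger
      then have "j + 2 = i" using no[of "j + 2"] lt[of i "j + 2"] lt[of "j + 2" j] True ij by auto
      then show ?thesis by simp
    next
      case False
      then have "odd i" "even j" using l(2) by (metis even_iff_mod_2_eq_zero le_zero_eq parity_cases)+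
      then obtain s t where st: "i = 2 * s + 1" "j = 2 * t" by (elim oddE evenE) blast
      then have "s = t" using no[of "2 * s"] lt[of i "2 * s"] lt[of "2 * s" j] ij l by auto
      then show ?thesis using st by simp
    qed
  next
    assume *: "i = j + 2 \<or> i = j + 1 \<and> even j"
    have "lt (ys ! i) (ys ! j)" using * lt[OF ij] by (auto elim: evenE)
    moreover have "\<not> (lt (ys ! i) z \<and> lt z (ys ! j))" if mem: "z \<in> set ys" for z
    proof
      assume z: "lt (ys ! i) z \<and> lt z (ys ! j)"
      obtain k where k: "k < length ys" "z = ys ! k" using mem by (auto simp: in_set_conv_nth)
      then have nk: "i \<noteq> k \<and> k mod 2 \<le> i mod 2 \<and> k div 2 \<le> i div 2" "k \<noteq> j \<and> j mod 2 \<le> k mod 2 \<and> j div 2 \<le> k div 2"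
        using z lt ij by auto
      moreover have "i mod 2 = j mod 2 \<and> i div 2 = j div 2 + 1 \<or> i mod 2 = 1 \<and> j mod 2 = 0 \<and> i div 2 = j div 2"
        using * by (auto elim: evenE)
      ultimately have "k mod 2 = i mod 2 \<and> k div 2 = i div 2 \<or> k mod 2 = j mod 2 \<and> k div 2 = j div 2"
        by auto
      then have "k = i \<or> k = j" by (metis div_mult_mod_eq)
      then show False using nk by auto
    qed
    ultimately show "covers_in (set ys) lt (ys ! i) (ys ! j)" using ij by (auto simp: covers_in_def)
  qed
  show ?thesis
  proof (intro equalityI subsetI)
    fix x assume "x \<in> {(a, b). covers_in (set ys) lt a b}"
    then obtain a b where ab: "x = (a, b)" "covers_in (set ys) lt a b" by auto
    then obtain i j where "i < length ys" "j < length ys" "a = ys ! i" "b = ys ! j"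
      by (auto simp: covers_in_def in_set_conv_nth)
    then show "x \<in> ladder_edges ys" using ab eq ladder_edges_iff[OF ys] by auto
  next
    fix x assume "x \<in> ladder_edges ys"
    moreover from this obtain i j where "x = (ys ! i, ys ! j)" "i < length ys" "j < length ys"
      by (auto simp: ladder_edges_def)
    ultimately show "x \<in> {(a, b). covers_in (set ys) lt a b}" using eq ladder_edges_iff[OF ys] by auto
  qed
qed

lemma ladder_edges_unique:
  assumes xs: "distinct xs" and ys: "distinct ys" and set: "set xs = set ys"
    and edges: "ladder_edges xs = ladder_edges ys" and n5: "5 \<le> length ys"
  shows "xs = ys"
proof (rule nth_equalityI)
  define n where "n = length ys"
  have len: "length xs = n" "length ys = n" using xs ys set distinct_card n_def by metis+
  then show "length xs = length ys" by simp
  have n: "5 \<le> n" using n5 len by simp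
  \<comment> \<open>The elements of a ladder are recognised one after the other from the elements below them.\<close>
  have idx: "\<exists>q<n. xs ! p = ys ! q" "\<exists>q<n. ys ! p = xs ! q" if "p < n" for p
  proof -
    have "xs ! p \<in> set ys" "ys ! p \<in> set xs" using that len set nth_mem by metis+
    then show "\<exists>q<n. xs ! p = ys ! q" "\<exists>q<n. ys ! p = xs ! q" using len by (auto simp: in_set_conv_nth)
  qed
  have below: "xs ! p = ys ! (q + 2) \<or> xs ! p = ys ! (q + 1) \<and> even q"
    if "xs ! q' = ys ! q" "p = q' + 2 \<or> p = q' + 1 \<and> even q'" "p < n" "q < n" for p q q'
  proof -
    have "(xs ! p, xs ! q') \<in> ladder_edges xs" using that ladder_edges_iff[OF xs, of p q'] len by auto
    then have e: "(xs ! p, ys ! q) \<in> ladder_edges ys" using edges that by simp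
    obtain p' where p': "p' < n" "xs ! p = ys ! p'" using idx \<open>p < n\<close> by blast
    then show ?thesis using e ladder_edges_iff[OF ys, of p' q] that len by auto
  qed
  have below': "ys ! p = xs ! (q' + 2) \<or> ys ! p = xs ! (q' + 1) \<and> even q'"
    if "xs ! q' = ys ! q" "p = q + 2 \<or> p = q + 1 \<and> even q" "p < n" "q' < n" "q < n" for p q q'
  proof -
    have "(ys ! p, ys ! q) \<in> ladder_edges ys" using that ladder_edges_iff[OF ys, of p q] len by auto
    then have e: "(ys ! p, xs ! q') \<in> ladder_edges xs" using edges that by simp
    obtain p' where p': "p' < n" "ys ! p = xs ! p'" using idx \<open>p < n\<close> by blast
    then show ?thesis using e ladder_edges_iff[OF xs, of p' q'] that len by auto
  qed
  have inj: "xs ! p = xs ! q \<longleftrightarrow> p = q" "ys ! p = ys ! q \<longleftrightarrow> p = q" if "p < n" "q < n" for p q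
    using xs ys len that by (auto simp: nth_eq_iff_index_eq)
  have z: "xs ! 0 = ys ! 0"
  proof -
    obtain p where p: "p < n" "xs ! 0 = ys ! p" using idx[of 0] n by auto
    have "p = 0"
    proof (rule ccontr)
      assume "p \<noteq> 0"
      then obtain q where q: "q < n" "p = q + 2 \<or> p = q + 1 \<and> even q"
      proof (cases "p = 1")
        case False
        then have "p = (p - 2) + 2" "p - 2 < n" using p \<open>p \<noteq> 0\<close> by simp_all
        then show ?thesis using that by blast
      qed (use that[of 0] n in auto)
      then have "(ys ! p, ys ! q) \<in> ladder_edges xs" using ladder_edges_iff[OF ys, of p q] p len edges by auto
      moreover obtain q' where "q' < n" "ys ! q = xs ! q'" using idx q by blast
      ultimately show False using ladder_edges_iff[OF xs, of 0 q'] p len n by auto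
    qed
    then show ?thesis using p by simp
  qed
  have one: "xs ! 1 = ys ! 1"
  proof (rule ccontr)
    assume "xs ! 1 \<noteq> ys ! 1"
    \<comment> \<open>An element at index 1 has a single element directly below it, one at index 2
      has two, at indices 3 and 4. This is where five labels are needed: a single square admits the
      exchange of its side corners.\<close>
    then have "xs ! 1 = ys ! 2" using below[OF z, of 1] n by (auto simp: numeral_2_eq_2)
    then have "ys ! 3 = xs ! 3" "ys ! 4 = xs ! 3"
      using below'[of 1 2 3] below'[of 1 2 4] n by (auto simp: numeral_3_eq_3)
    then show False using inj(2)[of 3 4] n by auto
  qed
  have two: "xs ! 2 = ys ! 2"
    using below[OF z, of 2] inj(1)[of 2 1] one n by (auto simp: numeral_2_eq_2)
  fix i assume "i < length xs"
  then have "i < n" using len by simp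
  then show "xs ! i = ys ! i"
  proof (induction i rule: less_induct)
    case (less i)
    show ?case
    proof (cases "i \<le> 2")
      case True
      then have "i = 0 \<or> i = 1 \<or> i = 2" by auto
      then show ?thesis using z one two by auto
    next
      case False
      define j where "j = i - 2"
      have j: "i = j + 2" "j \<noteq> 0" using False by (auto simp: j_def)
      have "xs ! j = ys ! j" "xs ! (j + 1) = ys ! (j + 1)" using less j by auto
      then show ?thesis using below[of j j i] inj(1)[of i "j + 1"] less.prems j by auto
    qed
  qed
qed

lemma is_ladder_labeling_iff:
  "is_ladder_labeling w r ys \<longleftrightarrow> distinct ys \<and> set ys = ladder w r \<and>
     {(a, b). covers_in (ladder w r) (hat_less w) a b} = ladder_edges ys \<and>
     (w = [] \<longrightarrow> ys = [El 0, El 1, El 2, El 3])"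
proof -
  have "{(ys ! (j + 2 - 1), ys ! (j - 1)) | j. 1 \<le> j \<and> j + 2 \<le> length ys} =
      {(ys ! (i + 2), ys ! i) | i. i + 2 < length ys}" (is "?A = ?B")
  proof (intro equalityI subsetI)
    fix x assume "x \<in> ?A"
    then obtain j where j: "x = (ys ! (j + 2 - 1), ys ! (j - 1))" "1 \<le> j" "j + 2 \<le> length ys" by blast
    then have "j + 2 - 1 = (j - 1) + 2" by simp
    then show "x \<in> ?B" using j by (intro CollectI exI[of _ "j - 1"]) auto
  next
    fix x assume "x \<in> ?B"
    then obtain i where "x = (ys ! (i + 2), ys ! i)" "i + 2 < length ys" by blast
    then show "x \<in> ?A" by (intro CollectI exI[of _ "i + 1"]) auto
  qed
  moreover have "{(ys ! (2 * j - 1), ys ! (2 * j - 1 - 1)) | j. 1 \<le> j \<and> 2 * j \<le> length ys} =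
      {(ys ! (2 * i + 1), ys ! (2 * i)) | i. 2 * i + 1 < length ys}" (is "?A = ?B")
  proof (intro equalityI subsetI)
    fix x assume "x \<in> ?A"
    then obtain j where j: "x = (ys ! (2 * j - 1), ys ! (2 * j - 1 - 1))" "1 \<le> j" "2 * j \<le> length ys" by blast
    then have "2 * j - 1 = 2 * (j - 1) + 1" by simp
    then show "x \<in> ?B" using j by (intro CollectI exI[of _ "j - 1"]) auto
  next
    fix x assume "x \<in> ?B"
    then obtain i where "x = (ys ! (2 * i + 1), ys ! (2 * i))" "2 * i + 1 < length ys" by blast
    then show "x \<in> ?A" by (intro CollectI exI[of _ "i + 1"]) auto
  qed
  ultimately show ?thesis
    unfolding is_ladder_labeling_def Let_def ladder_edges_def by simp
qed

section \<open>Breakpoints of a word\<close>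

lemma breaks_eq_Cons: "breaks w = 0 # filter (\<lambda>c. letter_at w c \<noteq> letter_at w (c + 1)) [1..<length w] @ [length w]"
  by (simp add: breaks_def)

lemma sorted_breaks: "w \<noteq> [] \<Longrightarrow> sorted_wrt (<) (breaks w)"
  unfolding breaks_eq_Cons
  by (auto simp: sorted_wrt_append intro!: sorted_wrt_filter) 

lemma length_breaks: "length (breaks w) = num_ladders w + 1"
  by (simp add: num_ladders_def breaks_eq_Cons)

lemma breaks_nth_less:
  assumes "w \<noteq> []" "r < s" "s \<le> num_ladders w"
  shows "breaks w ! r < breaks w ! s"
  using sorted_wrt_nth_less[OF sorted_breaks[OF assms(1)], of r s] assms length_breaks by simp

lemma set_breaks: "set (breaks w) = {0, length w} \<union>
    {c. 1 \<le> c \<and> c < length w \<and> letter_at w c \<noteq> letter_at w (c + 1)}"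
  by (auto simp: breaks_eq_Cons)

lemma breaks_first_last: "breaks w ! 0 = 0" "breaks w ! num_ladders w = length w"
  by (auto simp: breaks_eq_Cons num_ladders_def nth_append)

lemma breaks_inner:
  assumes "0 < r" "r < num_ladders w"
  shows "1 \<le> breaks w ! r" "breaks w ! r < length w"
    "letter_at w (breaks w ! r) \<noteq> letter_at w (breaks w ! r + 1)"
proof -
  let ?f = "filter (\<lambda>c. letter_at w c \<noteq> letter_at w (c + 1)) [1..<length w]"
  obtain s where s: "r = Suc s" using assms by (cases r) auto
  have "s < length ?f" using assms s by (simp add: num_ladders_def breaks_eq_Cons)
  then have "breaks w ! r = ?f ! s" "?f ! s \<in> set ?f"
    using s by (auto simp: breaks_eq_Cons nth_append simp del: set_filter intro: nth_mem)
  then have "breaks w ! r \<in> set ?f" by simp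
  then show "1 \<le> breaks w ! r" "breaks w ! r < length w"
    "letter_at w (breaks w ! r) \<noteq> letter_at w (breaks w ! r + 1)" by auto
qed

text \<open>The form in which the exclusion of both patterns is used: it supplies the second letter
  of the margin on either side of a ladder.\<close>

lemma snake_word_no_zigzag:
  assumes w: "w \<in> snake_words_V" and i: "1 \<le> i" "i + 2 \<le> length w"
    and ne: "letter_at w i \<noteq> letter_at w (i + 1)"
  shows "letter_at w (i + 2) = letter_at w (i + 1)"
proof (rule ccontr)
  assume ne': "letter_at w (i + 2) \<noteq> letter_at w (i + 1)"
  obtain j where j: "i = Suc j" using i by (cases i) auto
  have "drop j w = w ! j # w ! Suc j # w ! Suc (Suc j) # drop (j + 3) w"
    using i j by (simp add: Cons_nth_drop_Suc numeral_3_eq_3)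
  then have "w = take j w @ [w ! j, w ! Suc j, w ! Suc (Suc j)] @ drop (j + 3) w"
    using append_take_drop_id[of j w] by simp
  then have "sublist [w ! j, w ! Suc j, w ! Suc (Suc j)] w" unfolding sublist_def by blast
  moreover have "w ! j \<noteq> w ! Suc j" "w ! Suc (Suc j) \<noteq> w ! Suc j"
    using ne ne' j by (auto simp: letter_at_def)
  ultimately show False using w
    by (cases "w ! j"; cases "w ! Suc j"; cases "w ! Suc (Suc j)") (auto simp: snake_words_V_def)
qed

lemma square_eq:
  assumes "n \<le> length w"
  shows "square w n = {side_cover w n, 2 * n + 1, 2 * n + 2, 2 * n + 3}"
proof (cases "n = 0")
  case True
  then show ?thesis by (auto simp: square_def side_cover_def)
next
  case False
  have "{y. (2 * n + 2, y) \<in> snake_covers w} = {side_cover w n}"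
    using assms by (auto simp: snake_covers_iff; presburger)
  then show ?thesis using False by (auto simp: square_def)
qed

lemma side_cover_cases: "side_cover w n \<in> {2 * n - 1, 2 * n}"
  by (auto simp: side_cover_def)

text \<open>One ladder, from square \<open>a\<close> to square \<open>b\<close>, runs in direction
  \<open>d\<close>, and its rungs point in direction \<open>c\<close>. The letters next to it are
  \<open>c\<close> up to two places on either side; this margin keeps all other elements off the two
  lines of the ladder. For the empty word \<open>d = R\<close> yields the prescribed labels 0, 1, 2,
  3.\<close>

locale ladder_span =
  fixes w :: snake_word and a b :: nat and c d :: letter
  assumes letters: "c \<noteq> d"
    and span: "a \<le> b" "b \<le> length w" "w \<noteq> [] \<Longrightarrow> a < b"
    and empty: "w = [] \<Longrightarrow> d = R"
    and straight: "\<And>n. a < n \<Longrightarrow> n \<le> b \<Longrightarrow> letter_at w n = d"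
    and before: "a \<noteq> 0 \<Longrightarrow> letter_at w a = c" "2 \<le> a \<Longrightarrow> letter_at w (a - 1) = c"
    and after: "b < length w \<Longrightarrow> letter_at w (b + 1) = c" "b + 2 \<le> length w \<Longrightarrow> letter_at w (b + 2) = c"
begin

text \<open>The second label must be the rung partner of the top. In square \<open>a\<close> this is
  \<open>2 a + 2\<close> if the letter there points along the rungs, and \<open>2 a + 1\<close>
  otherwise. From \<open>2 a + 3\<close> on the labels follow the numbering.\<close>

definition labels :: "nat list" where
  "labels = side_cover w a # (if eff_letter w a = c then 2 * a + 2 else 2 * a + 1) #
     (if eff_letter w a = c then 2 * a + 1 else 2 * a + 2) # [2 * a + 3..<2 * b + 4]"

lemma eff_letter_cases: "eff_letter w a = c \<or> eff_letter w a = d"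
  using letters by (cases "eff_letter w a"; cases c; cases d) auto

lemma eff_letter_inner: "a < n \<Longrightarrow> n \<le> b \<Longrightarrow> eff_letter w n = d"
  using straight by (simp add: eff_letter_def)

lemma letter_count_inner:
  "a \<le> n \<Longrightarrow> n \<le> b \<Longrightarrow> letter_count w c n = letter_count w c a \<and> letter_count w d n = letter_count w d a + (n - a)"
proof (induction n rule: dec_induct)
  case (step n)
  then show ?case using straight[of "Suc n"] letters by auto
qed simp

lemma length_labels: "length labels = 2 * (b - a) + 4"
  using span by (simp add: labels_def)

lemma labels_nth_ge: "3 \<le> i \<Longrightarrow> i < length labels \<Longrightarrow> labels ! i = 2 * a + i"
proof -
  assume i: "3 \<le> i" "i < length labels"
  then obtain j where j: "i = Suc (Suc (Suc j))" by (metis Suc_le_D numeral_3_eq_3 Suc_le_mono)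
  then show "labels ! i = 2 * a + i" using i by (simp add: labels_def)
qed

lemma depth_labels:
  assumes "i < length labels"
  shows "depth w c (labels ! i) = letter_count w c a + i mod 2 \<and>
    depth w d (labels ! i) = letter_count w d a + i div 2"
proof -
  have a: "a \<le> length w" using span by simp
  consider "i = 0" | "i = 1" | "i = 2" | "i = 3" | "4 \<le> i" by linarith
  then show ?thesis
  proof cases
    case 1
    then show ?thesis by (simp add: labels_def depth_side_cover[OF a])
  next
    case 2
    show ?thesis
    proof (cases "eff_letter w a = c")
      case True
      then have "labels ! i = 2 * a + 2" using 2 by (simp add: labels_def)
      then show ?thesis using True letters 2 by (simp only: depth_even) simp
    next
      case False
      then have "labels ! i = 2 * a + 1" using 2 by (simp add: labels_def)
      then show ?thesis using False eff_letter_cases letters 2 by (simp only: depth_odd') auto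
    qed
  next
    case 3
    show ?thesis
    proof (cases "eff_letter w a = c")
      case True
      then have "labels ! i = 2 * a + 1" using 3 by (simp add: labels_def)
      then show ?thesis using True letters 3 by (simp only: depth_odd') simp
    next
      case False
      then have "labels ! i = 2 * a + 2" using 3 by (simp add: labels_def)
      then show ?thesis using False eff_letter_cases letters 3 by (simp only: depth_even) auto
    qed
  next
    case 4
    then have "labels ! i = 2 * a + 3" using labels_nth_ge[of 3] assms by simp
    then show ?thesis using 4 by (simp only: depth_odd) simp
  next
    case 5
    \<comment> \<open>The square whose elements \<open>2 n + 2\<close> and \<open>2 n + 3\<close>
      form the rung of index \<open>i\<close>.\<close>
    define n where "n = a + i div 2 - 1"
    have n: "a < n" "n \<le> b" "i div 2 = n - a + 1" using 5 assms unfolding length_labels n_def by auto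
    have count: "letter_count w c n = letter_count w c a" "letter_count w d n = letter_count w d a + (n - a)"
      using letter_count_inner[of n] n by auto
    have li: "labels ! i = 2 * a + i" using 5 assms labels_nth_ge by simp
    show ?thesis
    proof (cases "even i")
      case True
      then have "i = 2 * (i div 2)" by simp
      then have "labels ! i = 2 * n + 2" using li n by linarith
      then show ?thesis using True eff_letter_inner[OF n(1,2)] letters count n
        by (simp only: depth_even) auto
    next
      case False
      then have "i mod 2 = 1" "i = 2 * (i div 2) + 1" by (auto simp: odd_iff_mod_2_eq_one[THEN iffD1])
      moreover from this have "labels ! i = 2 * n + 3" using li n by linarith
      ultimately show ?thesis using count n by (simp only: depth_odd) simp
    qed
  qed
qed

lemma distinct_labels: "distinct labels"
proof (rule distinct_conv_nth[THEN iffD2], intro allI impI)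
  fix i j assume ij: "i < length labels" "j < length labels" "i \<noteq> j"
  have "i = 2 * (i div 2) + i mod 2" "j = 2 * (j div 2) + j mod 2" by simp_all
  then have "i mod 2 \<noteq> j mod 2 \<or> i div 2 \<noteq> j div 2" using ij(3) by metis
  then show "labels ! i \<noteq> labels ! j" using depth_labels[OF ij(1)] depth_labels[OF ij(2)] by auto
qed

lemma set_labels: "set labels = {side_cover w a, 2 * a + 1, 2 * a + 2} \<union> {2 * a + 3..<2 * b + 4}"
  by (auto simp: labels_def)

lemma labels_le: "x \<in> set labels \<Longrightarrow> x \<le> 2 * length w + 3"
  using side_cover_less[of w a] span by (auto simp: set_labels)

lemma squares_eq_labels: "(\<Union>j\<in>{a..b}. square w j) = set labels"
proof (intro equalityI subsetI)
  fix x assume "x \<in> (\<Union>j\<in>{a..b}. square w j)"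
  then obtain n where n: "a \<le> n" "n \<le> b" "x \<in> square w n" by auto
  then have x: "x \<in> {side_cover w n, 2 * n + 1, 2 * n + 2, 2 * n + 3}" using square_eq span by simp
  show "x \<in> set labels"
  proof (cases "n = a")
    case True
    then show ?thesis using x span by (auto simp: set_labels)
  next
    case False
    then have "x \<in> {2 * n - 1, 2 * n, 2 * n + 1, 2 * n + 2, 2 * n + 3}" using x side_cover_cases[of w n] n by auto
    moreover have "2 * n - 1 \<ge> 2 * a + 1" using n False by simp
    ultimately show ?thesis using n False unfolding set_labels by auto
  qed
next
  fix x assume "x \<in> set labels"
  then consider "x \<in> square w a" | "2 * a + 4 \<le> x" "x < 2 * b + 4"
  proof -
    have "square w a = {side_cover w a, 2 * a + 1, 2 * a + 2, 2 * a + 3}" using square_eq[of a] span by simp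
    moreover have "x \<in> {side_cover w a, 2 * a + 1, 2 * a + 2} \<or> x = 2 * a + 3 \<or> 2 * a + 4 \<le> x \<and> x < 2 * b + 4"
      using \<open>x \<in> set labels\<close> unfolding set_labels by auto
    ultimately show ?thesis using that by blast
  qed
  then show "x \<in> (\<Union>j\<in>{a..b}. square w j)"
  proof cases
    case 1
    then show ?thesis using span by (intro UN_I[of a]) auto
  next
    case 2
    define n where "n = x div 2 - 1"
    have "x = 2 * n + 2 \<or> x = 2 * n + 3" using 2 unfolding n_def by (cases "even x") (auto elim!: evenE oddE)
    moreover from this have "a \<le> n" "n \<le> b" using 2 by auto
    ultimately have n: "a \<le> n" "n \<le> b" "x = 2 * n + 2 \<or> x = 2 * n + 3" by blast+
    then have "x \<in> square w n" using square_eq[of n] span by auto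
    then show ?thesis using n by auto
  qed
qed

text \<open>The two lines of the ladder contain no other element: the \<open>c\<close>-letters in
  the margin push everything later past them and keep everything earlier in front of them.\<close>

lemma depth_outside:
  assumes x: "x \<le> 2 * length w + 3" "x \<notin> set labels"
  shows "depth w c x < letter_count w c a \<or> letter_count w c a + 1 < depth w c x"
proof (cases "2 * b + 4 \<le> x")
  case True
  then have b: "b < length w" using x by simp
  have B: "letter_count w c (b + 1) = letter_count w c a + 1"
    using letter_count_inner[of b] span after(1)[OF b] by simp
  have "letter_count w c a + 1 < depth w c x"
  proof (cases x rule: index_cases)
    case (3 n)
    show ?thesis
    proof (cases "n = b + 1")
      case True
      then have "eff_letter w n = c" using after(1)[OF b] by (simp add: eff_letter_def)
      then show ?thesis unfolding 3 depth_even using B True by simp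
    next
      case False
      then have n: "b + 2 \<le> n" "n \<le> length w" using \<open>2 * b + 4 \<le> x\<close> 3 x by auto
      \<comment> \<open>The second letter of the margin acts here: with \<open>d\<close> instead,
        the side corner of square \<open>b + 2\<close> would fall on the second line.\<close>
      have "letter_count w c (b + 2) = letter_count w c a + 2" using B after(2) n by simp
      then show ?thesis unfolding 3 depth_even using letter_count_mono[OF n(1), of w c] by simp
    qed
  next
    case (4 n)
    then have "b + 1 \<le> n" using True by simp
    then show ?thesis unfolding 4 depth_odd using letter_count_mono[of "b + 1" n w c] B by simp
  qed (use True in auto)
  then show ?thesis by simp
next
  case False
  have "x < 2 * a + 1"
  proof (rule ccontr)
    assume "\<not> x < 2 * a + 1"
    then have "x \<in> set labels" using False unfolding set_labels by auto
    then show False using x by simp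
  qed
  moreover have ns: "x \<noteq> side_cover w a" using x by (auto simp: set_labels)
  moreover have "side_cover w 0 = 0" by (simp add: side_cover_def)
  ultimately have "a \<noteq> 0" by (cases "a = 0") auto
  then have A: "letter_at w a = c" using before by simp
  then have cnt: "letter_count w c a = letter_count w c (a - 1) + 1" using \<open>a \<noteq> 0\<close> by (cases a) auto
  have "depth w c x < letter_count w c a"
  \<comment> \<open>Before letter 1 there is only the implicit one, so the few elements preceding
    the ladder are checked directly.\<close>
  proof (cases "a = 1")
    case True
    have "x \<le> 2" using \<open>x < 2 * a + 1\<close> True by simp
    then have "x = 0 \<or> x = 1 \<or> x = 2" by auto
    moreover have "depth w c 2 = (if c = R then 1 else 0)"
      by (simp add: eff_letter_def numeral_2_eq_2)
    ultimately show ?thesis using ns A cnt True by (cases c) (auto simp: side_cover_def)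
  next
    case False
    then have a2: "2 \<le> a" using \<open>a \<noteq> 0\<close> by simp
    then have eff: "eff_letter w (a - 1) = c" using before by (simp add: eff_letter_def)
    have "side_cover w a = 2 * a" using a2 before A by (auto simp: side_cover_def)
    then have "x \<le> 2 * (a - 1) + 1" using ns \<open>x < 2 * a + 1\<close> by simp
    then have "depth w c x \<le> depth w c (2 * (a - 1) + 1)" by (rule depth_le_odd)
    also have "\<dots> = letter_count w c (a - 1)" unfolding depth_odd' using eff by simp
    finally show ?thesis using cnt by simp
  qed
  then show ?thesis by simp
qed

definition ys :: "hat list" where
  "ys = map El labels"

lemma length_ys: "length ys = 2 * (b - a) + 4"
  by (simp add: ys_def length_labels)

lemma distinct_ys: "distinct ys"
  using distinct_labels by (simp add: ys_def distinct_map inj_on_def)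

lemma ys_in_hatP: "set ys \<subseteq> hatP w"
  using labels_le by (auto simp: ys_def)

lemma ys_less_iff:
  assumes "i < length ys" "j < length ys"
  shows "hat_less w (ys ! i) (ys ! j) \<longleftrightarrow> i \<noteq> j \<and> j mod 2 \<le> i mod 2 \<and> j div 2 \<le> i div 2"
proof -
  have ij: "i < length labels" "j < length labels" using assms by (auto simp: ys_def)
  have "labels ! i \<le> 2 * length w + 3" using labels_le ij by auto
  moreover have "labels ! i = labels ! j \<longleftrightarrow> i = j" using ij distinct_labels by (simp add: nth_eq_iff_index_eq)
  moreover have "(\<forall>e. P e) \<longleftrightarrow> P c \<and> P d" for P
    using letters by (cases c; cases d) (auto simp: all_letter)
  ultimately show ?thesis
    using ij depth_labels[OF ij(1)] depth_labels[OF ij(2)] by (auto simp: ys_def trancl_snake_covers_iff)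
qed

lemma level_ys:
  assumes "i < length ys"
  shows "level w c (ys ! i) = letter_count w c a + 1 + i mod 2"
    "level w d (ys ! i) = letter_count w d a + 1 + i div 2"
  using depth_labels[of i] assms by (auto simp: ys_def)

lemma level_outside:
  assumes "v \<in> hatP w" "v \<notin> set ys"
  shows "level w c v \<noteq> letter_count w c a + 1 \<and> level w c v \<noteq> letter_count w c a + 2"
proof (cases v)
  case Bot
  then show ?thesis using letter_count_mono[of a "length w" w c] span by simp
next
  case (El x)
  then have "x \<notin> set labels" "x \<le> 2 * length w + 3" using assms by (auto simp: ys_def)
  then show ?thesis using depth_outside[of x] El by auto
qed simp

text \<open>For a nonempty word there are at least two squares and the cover relations determine the
  labels; the empty word has its labels prescribed.\<close>

lemma ladder_labeling_eq:
  assumes r: "ladder w r = El ` (\<Union>j\<in>{a..b}. square w j)"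
  shows "ladder_labeling w r = ys"
  unfolding ladder_labeling_def
proof (rule the_equality)
  have set_ys: "set ys = ladder w r" by (simp add: r squares_eq_labels ys_def)
  have edges: "{(x, y). covers_in (ladder w r) (hat_less w) x y} = ladder_edges ys"
    unfolding set_ys[symmetric] using distinct_ys ys_less_iff by (rule covers_in_ladder_grid)
  have nil: "ys = [El 0, El 1, El 2, El 3]" if "w = []"
  proof -
    have "a = 0" "b = 0" using that span by auto
    moreover have "eff_letter w 0 \<noteq> c" using empty[OF that] letters by (auto simp: eff_letter_def)
    ultimately show ?thesis unfolding ys_def labels_def by (simp add: side_cover_def upt_rec)
  qed
  show "is_ladder_labeling w r ys"
    unfolding is_ladder_labeling_iff using distinct_ys set_ys edges nil by simp
  fix zs assume zs: "is_ladder_labeling w r zs"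
  show "zs = ys"
  proof (cases "w = []")
    case True
    then show ?thesis using zs nil by (simp add: is_ladder_labeling_iff)
  next
    case False
    then have "5 \<le> length ys" using span length_ys by simp
    then show ?thesis using zs distinct_ys set_ys edges
      by (intro ladder_edges_unique) (auto simp: is_ladder_labeling_iff)
  qed
qed

definition partner :: "nat \<Rightarrow> nat" where
  "partner i = (if even i then i + 1 else i - 1)"

lemma partner_less: "i < length ys \<Longrightarrow> partner i < length ys"
  unfolding length_ys partner_def by presburger

lemma partner_partner: "partner (partner i) = i"
  unfolding partner_def by presburger

lemma elementary_twist_ys:
  assumes r: "ladder w r = El ` (\<Union>j\<in>{a..b}. square w j)"
  shows "i < length ys \<Longrightarrow> elementary_twist w r (ys ! i) = ys ! partner i"
    "v \<in> hatP w \<Longrightarrow> v \<notin> set ys \<Longrightarrow> elementary_twist w r v = v"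
proof -
  have "rungs w r = {{ys ! (2 * j - 1 - 1), ys ! (2 * j - 1)} | j. 1 \<le> j \<and> 2 * j \<le> length ys}"
    unfolding rungs_def ladder_labeling_eq[OF r] Let_def ..
  also have "\<dots> = (\<lambda>i. {ys ! i, ys ! partner i}) ` {..<length ys}" (is "?A = ?B")
  proof (intro equalityI subsetI)
    fix X assume "X \<in> ?A"
    then obtain j where j: "X = {ys ! (2 * j - 1 - 1), ys ! (2 * j - 1)}" "1 \<le> j" "2 * j \<le> length ys" by blast
    then obtain i where i: "j = Suc i" by (cases j) auto
    then have "X = {ys ! (2 * i), ys ! partner (2 * i)}" "2 * i < length ys"
      using j by (simp_all add: partner_def)
    then show "X \<in> ?B" by blast
  next
    fix X assume "X \<in> ?B"
    then obtain i where i: "X = {ys ! i, ys ! partner i}" "i < length ys" by blast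
    define j where "j = i div 2 + 1"
    have "i div 2 < b - a + 2" using i(2) unfolding length_ys by (intro less_mult_imp_div_less) simp
    then have j: "1 \<le> j" "2 * j \<le> length ys" unfolding length_ys j_def by auto
    have "(i = 2 * j - 1 - 1 \<and> partner i = 2 * j - 1) \<or> (i = 2 * j - 1 \<and> partner i = 2 * j - 1 - 1)"
      by (cases "even i") (auto elim!: evenE oddE simp: partner_def j_def)
    then have "X = {ys ! (2 * j - 1 - 1), ys ! (2 * j - 1)}" using i(1) by auto
    then show "X \<in> ?A" using j by blast
  qed
  finally have rungs: "rungs w r = (\<lambda>i. {ys ! i, ys ! partner i}) ` {..<length ys}" .
  have un: "\<Union> (rungs w r) = set ys"
    using partner_less unfolding rungs by (force simp: in_set_conv_nth)
  show "elementary_twist w r v = v" if "v \<in> hatP w" "v \<notin> set ys"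
    using that un by (simp add: elementary_twist_def)
  assume i: "i < length ys"
  have inP: "ys ! i \<in> hatP w" "ys ! i \<in> set ys" using i ys_in_hatP by auto
  have "(THE z. {ys ! i, z} \<in> rungs w r) = ys ! partner i"
  proof (rule the_equality)
    show "{ys ! i, ys ! partner i} \<in> rungs w r" using i unfolding rungs by blast
    fix z assume "{ys ! i, z} \<in> rungs w r"
    then obtain k where k: "k < length ys" "{ys ! i, z} = {ys ! k, ys ! partner k}" unfolding rungs by blast
    then have "ys ! i = ys ! k \<and> z = ys ! partner k \<or> ys ! i = ys ! partner k \<and> z = ys ! k"
      by (auto simp: doubleton_eq_iff)
    then show "z = ys ! partner i"
      using i k partner_less[OF k(1)] distinct_ys partner_partner[of k]
      by (auto simp: nth_eq_iff_index_eq)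
  qed
  then show "elementary_twist w r (ys ! i) = ys ! partner i"
    using inP un by (simp add: elementary_twist_def)
qed

text \<open>Passing to the rung partner changes \<open>i mod 2\<close> and keeps
  \<open>i div 2\<close>, so it swaps the two adjacent \<open>c\<close>-levels of the ladder and
  preserves the \<open>d\<close>-level. Fixed elements avoid both levels.\<close>

lemma filter_vertex_elementary_twist:
  assumes r: "ladder w r = El ` (\<Union>j\<in>{a..b}. square w j)"
    and q: "q\<^sub>0 \<in> track w c" "q \<in> track w c" "q\<^sub>1 \<in> track w c"
      "level w c q\<^sub>0 = letter_count w c a + 1" "level w c q = letter_count w c a + 2"
      "level w c q\<^sub>1 = letter_count w c a + 3"
    and v: "v \<in> hatP w"
  shows "elementary_twist w r v \<in> hatP w" "elementary_twist w r (elementary_twist w r v) = v"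
    "filter_vertex w (elementary_twist w r v) = toggle q\<^sub>0 q q\<^sub>1 (filter_vertex w v)"
proof -
  have "elementary_twist w r v \<in> hatP w \<and> elementary_twist w r (elementary_twist w r v) = v \<and>
    filter_vertex w (elementary_twist w r v) = toggle q\<^sub>0 q q\<^sub>1 (filter_vertex w v)"
  proof (cases "v \<in> set ys")
    case True
    then obtain i where i: "i < length ys" "v = ys ! i" by (metis in_set_conv_nth)
    let ?j = "partner i"
    have j: "?j < length ys" by (rule partner_less[OF i(1)])
    have tw: "elementary_twist w r v = ys ! ?j" "elementary_twist w r (ys ! ?j) = v"
      using elementary_twist_ys(1)[OF r] i j partner_partner[of i] by simp_all
    have P: "ys ! ?j \<in> hatP w" using j ys_in_hatP by auto
    have p: "?j div 2 = i div 2" "i mod 2 = 0 \<and> ?j mod 2 = 1 \<or> i mod 2 = 1 \<and> ?j mod 2 = 0"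
      unfolding partner_def by presburger+
    have "filter_vertex w (ys ! ?j) = toggle q\<^sub>0 q q\<^sub>1 (filter_vertex w v)"
    proof (rule filter_vertex_toggle[OF v P])
      show "level w e (ys ! ?j) = level w e v" if "e \<noteq> c" for e
      proof -
        have "e = d" using that letters by (cases e; cases c; cases d) auto
        then show ?thesis using level_ys(2)[OF i(1)] level_ys(2)[OF j] i p by simp
      qed
    qed (use level_ys(1)[OF i(1)] level_ys(1)[OF j] i p q in auto)
    then show ?thesis using tw P by simp
  next
    case False
    then have tw: "elementary_twist w r v = v" using elementary_twist_ys(2)[OF r v] by simp
    have "filter_vertex w v = toggle q\<^sub>0 q q\<^sub>1 (filter_vertex w v)"
      by (rule filter_vertex_toggle[OF v v]) (use level_outside[OF v False] q in auto)
    then show ?thesis using tw v by simp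
  qed
  then show "elementary_twist w r v \<in> hatP w" "elementary_twist w r (elementary_twist w r v) = v"
    "filter_vertex w (elementary_twist w r v) = toggle q\<^sub>0 q q\<^sub>1 (filter_vertex w v)" by auto
qed

end

section \<open>All ladders of one word\<close>

lemma breaks_nth_le:
  assumes "w \<noteq> []" "r \<le> s" "s \<le> num_ladders w"
  shows "breaks w ! r \<le> breaks w ! s"
  using breaks_nth_less[OF assms(1), of r s] assms by (cases "r = s") auto

definition ladder_letter :: "snake_word \<Rightarrow> nat \<Rightarrow> letter" where
  "ladder_letter w r = (if w = [] then R else letter_at w (breaks w ! (r - 1) + 1))"

definition rung_letter :: "snake_word \<Rightarrow> nat \<Rightarrow> letter" where
  "rung_letter w r = (if ladder_letter w r = L then R else L)"

lemma rung_letter_neq: "rung_letter w r \<noteq> ladder_letter w r"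
  by (auto simp: rung_letter_def)

lemma neq_imp_rung_letter: "x \<noteq> ladder_letter w r \<Longrightarrow> x = rung_letter w r"
  by (cases x; cases "ladder_letter w r") (auto simp: rung_letter_def)

lemma ladder_span_breaks:
  assumes w: "w \<in> snake_words_V" and r: "r \<in> {1..num_ladders w}"
  shows "ladder_span w (breaks w ! (r - 1)) (breaks w ! r) (rung_letter w r) (ladder_letter w r)"
proof -
  let ?a = "breaks w ! (r - 1)" and ?b = "breaks w ! r" and ?d = "ladder_letter w r"
  have less: "?a < ?b" if "w \<noteq> []" using breaks_nth_less[OF that, of "r - 1" r] r by simp
  have nil: "?a = 0 \<and> ?b = 0" if "w = []"
    using that r by (auto simp: breaks_def num_ladders_def)
  have "?b \<in> set (breaks w)" using r length_breaks by auto
  then have bk: "?b \<le> length w" unfolding set_breaks by auto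
  have straight: "letter_at w n = ?d" if n: "?a < n" "n \<le> ?b" for n
  proof -
    have ne: "w \<noteq> []" using nil n by auto
    have "Suc ?a \<le> n" using n by simp
    then show ?thesis using n(2)
    proof (induction n rule: dec_induct)
      case base
      then show ?case using ne by (simp add: ladder_letter_def)
    next
      case (step n)
      \<comment> \<open>A change of letter at \<open>n\<close> would be a breakpoint strictly
        between two consecutive ones.\<close>
      have "n \<notin> set (breaks w)"
      proof
        assume "n \<in> set (breaks w)"
        then obtain s where s: "s \<le> num_ladders w" "breaks w ! s = n"
          using length_breaks by (metis in_set_conv_nth Suc_eq_plus1 less_Suc_eq_le)
        have "\<not> r \<le> s" using breaks_nth_le[OF ne, of r s] s step.prems by auto
        moreover have "r - 1 \<le> num_ladders w" using r by auto
        then have "\<not> s \<le> r - 1" using breaks_nth_le[OF ne, of s "r - 1"] s step.hyps by auto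
        ultimately show False by simp
      qed
      then have "letter_at w n = letter_at w (n + 1)" using step bk unfolding set_breaks by auto
      then show ?case using step by simp
    qed
  qed
  have inner: "0 < r - 1 \<and> ?a + 1 \<le> length w \<and> letter_at w ?a = rung_letter w r" if a: "?a \<noteq> 0"
  proof -
    have ne: "w \<noteq> []" using nil a by auto
    have r1: "0 < r - 1" using a breaks_first_last(1)[of w] by (cases "r - 1") auto
    then have "?a < length w" "letter_at w ?a \<noteq> letter_at w (?a + 1)"
      using breaks_inner[of "r - 1" w] r by auto
    then show ?thesis using r1 neq_imp_rung_letter[of _ w r] ne by (simp add: ladder_letter_def)
  qed
  have after: "w \<noteq> [] \<and> letter_at w ?b = ?d \<and> letter_at w (?b + 1) = rung_letter w r" if b: "?b < length w"
  proof -
    have ne: "w \<noteq> []" using b by auto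
    then have d: "letter_at w ?b = ?d" using straight less by simp
    have "r \<noteq> num_ladders w" using b breaks_first_last(2)[of w] by auto
    then have "letter_at w ?b \<noteq> letter_at w (?b + 1)" using breaks_inner[of r w] r by auto
    then have "letter_at w (?b + 1) \<noteq> ?d" using d by simp
    then show ?thesis using ne d neq_imp_rung_letter by blast
  qed
  show ?thesis
  proof
    show "rung_letter w r \<noteq> ?d" by (rule rung_letter_neq)
    show "?a \<le> ?b" using less nil by (cases "w = []") auto
    show "?b \<le> length w" by (rule bk)
    show "?a < ?b" if "w \<noteq> []" using less that .
    show "?d = R" if "w = []" using that by (simp add: ladder_letter_def)
    show "letter_at w n = ?d" if "?a < n" "n \<le> ?b" for n using straight that .
    show "letter_at w ?a = rung_letter w r" if "?a \<noteq> 0" using inner that by blast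
    show "letter_at w (?a - 1) = rung_letter w r" if "2 \<le> ?a"
    proof (rule ccontr)
      assume *: "letter_at w (?a - 1) \<noteq> rung_letter w r"
      have i: "?a + 1 \<le> length w" "letter_at w ?a = rung_letter w r" using inner that by auto
      then have ne: "w \<noteq> []" by auto
      \<comment> \<open>A change just before \<open>?a\<close> would force a repetition after it,
        but \<open>?a\<close> is itself a breakpoint.\<close>
      have "letter_at w (?a - 1 + 2) = letter_at w (?a - 1 + 1)"
        using * i that by (intro snake_word_no_zigzag[OF w]) auto
      then have "letter_at w (?a + 1) = rung_letter w r" using i that by (simp add: eval_nat_numeral)
      then show False using ne rung_letter_neq[of w r] by (simp add: ladder_letter_def)
    qed
    show "letter_at w (?b + 1) = rung_letter w r" if "?b < length w" using after that by blast
    show "letter_at w (?b + 2) = rung_letter w r" if b: "?b + 2 \<le> length w"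
    proof -
      have a: "w \<noteq> []" "letter_at w ?b = ?d" "letter_at w (?b + 1) = rung_letter w r" using after b by auto
      have "letter_at w (?b + 2) = letter_at w (?b + 1)"
        using a b less rung_letter_neq[of w r] by (intro snake_word_no_zigzag[OF w]) auto
      then show ?thesis using a by simp
    qed
  qed
qed

definition base_count :: "snake_word \<Rightarrow> nat \<Rightarrow> nat" where
  "base_count w r = letter_count w (rung_letter w r) (breaks w ! (r - 1))"

text \<open>Both letters following ladder \<open>r\<close> are rung letters, whereas ladder
  \<open>s\<close> begins with a different letter, so both are passed before \<open>s\<close>
  starts. With a gap of one, the coordinate changed by one toggle would be read by the
  other.\<close>

lemma base_count_gap:
  assumes w: "w \<in> snake_words_V" and r: "r \<in> {1..num_ladders w}" "s \<in> {1..num_ladders w}" "r < s"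
    and same: "rung_letter w r = rung_letter w s"
  shows "base_count w r + 2 \<le> base_count w s"
proof -
  interpret ladder_span w "breaks w ! (r - 1)" "breaks w ! r" "rung_letter w r" "ladder_letter w r"
    using ladder_span_breaks[OF w r(1)] .
  let ?b = "breaks w ! r" and ?a = "breaks w ! (s - 1)" and ?c = "rung_letter w r"
  have ne: "w \<noteq> []" using r by (auto simp: num_ladders_def breaks_def)
  have bk: "?b < length w" using breaks_nth_less[OF ne, of r "num_ladders w"] r breaks_first_last(2)[of w] by simp
  have ak: "?a < length w" using breaks_nth_less[OF ne, of "s - 1" "num_ladders w"] r breaks_first_last(2)[of w]
    by simp
  have ba: "?b \<le> ?a" using breaks_nth_le[OF ne, of r "s - 1"] r by auto
  have "letter_at w (?a + 1) \<noteq> ?c"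
    using rung_letter_neq[of w s] ne same by (simp add: ladder_letter_def)
  then have "?a \<noteq> ?b" "?a \<noteq> ?b + 1" using after ak bk by auto
  then have "?b + 2 \<le> ?a" using ba by simp
  then have "letter_count w ?c (?b + 2) \<le> letter_count w ?c ?a" by (rule letter_count_mono)
  moreover have "letter_count w ?c (?b + 2) = letter_count w ?c ?b + 2"
    using after bk ak \<open>?b + 2 \<le> ?a\<close> by simp
  moreover have "base_count w r \<le> letter_count w ?c ?b"
    unfolding base_count_def using span by (intro letter_count_mono) simp
  ultimately show ?thesis using same by (simp add: base_count_def)
qed

text \<open>Commutation extends from generators to products, first on one side and then on the
  other; after that the square of a product is the product of the squares.\<close>

lemma (in group) generate_involution:
  assumes S: "S \<subseteq> carrier G" and inv: "\<And>x. x \<in> S \<Longrightarrow> x \<otimes> x = \<one>"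
    and comm: "\<And>x y. x \<in> S \<Longrightarrow> y \<in> S \<Longrightarrow> x \<otimes> y = y \<otimes> x" and g: "g \<in> generate G S"
  shows "g \<otimes> g = \<one>"
proof -
  have inv_eq: "inv x = x" if "x \<in> S" for x
    using that S inv inv_equality by blast
  have c: "g \<in> carrier G" if "g \<in> generate G S" for g
    using generate_in_carrier[OF S that] .
  have swap: "(x \<otimes> y) \<otimes> z = z \<otimes> (x \<otimes> y)"
    if "x \<in> carrier G" "y \<in> carrier G" "z \<in> carrier G" "x \<otimes> z = z \<otimes> x" "y \<otimes> z = z \<otimes> y" for x y z
    using that by (metis m_assoc)
  have comm1: "g \<otimes> x = x \<otimes> g" if "g \<in> generate G S" "x \<in> S" for g x
    using that(1)
  proof (induction rule: generate.induct)
    case (eng h1 h2)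
    then show ?case using swap[of h1 h2 x] c S that(2) by blast
  qed (use that S comm inv_eq in auto)
  have comm2: "g \<otimes> h = h \<otimes> g" if "g \<in> generate G S" "h \<in> generate G S" for g h
    using that(2)
  proof (induction rule: generate.induct)
    case (eng h1 h2)
    then show ?case using swap[of h1 h2 g] c that(1) by metis
  qed (use that c comm1 inv_eq in auto)
  show ?thesis
    using g
  proof (induction rule: generate.induct)
    case (eng h1 h2)
    have "(h1 \<otimes> h2) \<otimes> (h1 \<otimes> h2) = (h1 \<otimes> h1) \<otimes> (h2 \<otimes> h2)"
      using comm2[OF eng(1,2)] c[OF eng(1)] c[OF eng(2)] by (metis m_assoc m_closed)
    then show ?case using eng by simp
  qed (use inv inv_eq in auto)
qed

section \<open>Twists as linear involutions\<close>

lemma mult_BijGroup: "f \<in> Bij S \<Longrightarrow> g \<in> Bij S \<Longrightarrow> f \<otimes>\<^bsub>BijGroup S\<^esub> g = compose S f g"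
  by (simp add: BijGroup_def)

lemma twist_group_linear:
  assumes w: "w \<in> snake_words_V" and \<tau>: "\<tau> \<in> twist_group w"
  shows "\<tau> \<in> hatP w \<rightarrow> hatP w" "\<And>v. v \<in> hatP w \<Longrightarrow> \<tau> (\<tau> v) = v"
    "\<exists>B. linear B \<and> (\<forall>v\<in>hatP w. filter_vertex w (\<tau> v) = B (filter_vertex w v))"
proof -
  let ?I = "{1..num_ladders w}" and ?V = "hatP w" and ?p = "filter_vertex w" and ?t = "elementary_twist w"
  let ?G = "BijGroup ?V"
  interpret group ?G by (rule group_BijGroup)
  have "\<exists>q\<^sub>0 q q\<^sub>1. q\<^sub>0 \<in> track w (rung_letter w r) \<and> q \<in> track w (rung_letter w r) \<and> q\<^sub>1 \<in> track w (rung_letter w r) \<and>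
      level w (rung_letter w r) q\<^sub>0 = base_count w r + 1 \<and> level w (rung_letter w r) q = base_count w r + 2 \<and>
      level w (rung_letter w r) q\<^sub>1 = base_count w r + 3" if r: "r \<in> ?I" for r
  proof -
    interpret ladder_span w "breaks w ! (r - 1)" "breaks w ! r" "rung_letter w r" "ladder_letter w r"
      using ladder_span_breaks[OF w r] .
    have top: "base_count w r + 3 \<le> level w (rung_letter w r) Bot"
      unfolding base_count_def using span letter_count_mono[of "breaks w ! (r - 1)" "length w" w "rung_letter w r"]
      by simp
    have "\<exists>p. p \<in> track w (rung_letter w r) \<and> level w (rung_letter w r) p = base_count w r + i"
      if "1 \<le> i" "i \<le> 3" for i
      using track_at_level[of "base_count w r + i" w "rung_letter w r"] that top by auto
    from this[of 1] this[of 2] this[of 3] show ?thesis by auto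
  qed
  then obtain q\<^sub>0 q q\<^sub>1 where q: "\<And>r. r \<in> ?I \<Longrightarrow> q\<^sub>0 r \<in> track w (rung_letter w r) \<and>
      q r \<in> track w (rung_letter w r) \<and> q\<^sub>1 r \<in> track w (rung_letter w r) \<and>
      level w (rung_letter w r) (q\<^sub>0 r) = base_count w r + 1 \<and> level w (rung_letter w r) (q r) = base_count w r + 2 \<and>
      level w (rung_letter w r) (q\<^sub>1 r) = base_count w r + 3"
    by metis
  define A where "A r = toggle (q\<^sub>0 r) (q r) (q\<^sub>1 r)" for r
  have twist: "?t r v \<in> ?V" "?t r (?t r v) = v" "?p (?t r v) = A r (?p v)"
    if r: "r \<in> ?I" and v: "v \<in> ?V" for r v
  proof -
    interpret ladder_span w "breaks w ! (r - 1)" "breaks w ! r" "rung_letter w r" "ladder_letter w r"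
      using ladder_span_breaks[OF w r] .
    note * = filter_vertex_elementary_twist[OF ladder_def, of "q\<^sub>0 r" "q r" "q\<^sub>1 r" v]
    show "?t r v \<in> ?V" "?t r (?t r v) = v" "?p (?t r v) = A r (?p v)"
      using * q[OF r] v by (simp_all add: base_count_def A_def)
  qed
  \<comment> \<open>For equal rung directions the levels separate the coordinates. For different
    ones the tracks meet only in \<open>El 0\<close> and \<open>Bot\<close>, and the level of
    \<open>q r\<close> lies strictly between theirs.\<close>
  have apart: "q r \<noteq> q s \<and> q r \<noteq> q\<^sub>0 s \<and> q r \<noteq> q\<^sub>1 s" if rs: "r \<in> ?I" "s \<in> ?I" "r \<noteq> s" for r s
  proof (cases "rung_letter w r = rung_letter w s")
    case True
    have "base_count w r + 2 \<le> base_count w s \<or> base_count w s + 2 \<le> base_count w r"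
      using base_count_gap[OF w] rs True by (metis nat_neq_iff)
    then show ?thesis using q[OF rs(1)] q[OF rs(2)] True by auto
  next
    case False
    let ?c = "rung_letter w r"
    interpret ladder_span w "breaks w ! (r - 1)" "breaks w ! r" ?c "ladder_letter w r"
      using ladder_span_breaks[OF w rs(1)] .
    have "base_count w r \<le> letter_count w ?c (length w)"
      unfolding base_count_def using span by (intro letter_count_mono) simp
    then have "q r \<noteq> Bot" "q r \<noteq> El 0" using q[OF rs(1)] by auto
    then have "q r \<notin> track w (rung_letter w s)" using track_Int False q[OF rs(1)] by blast
    then show ?thesis using q[OF rs(2)] by auto
  qed
  have bij: "?t r \<in> Bij ?V" if r: "r \<in> ?I" for r
  proof -
    have "bij_betw (?t r) ?V ?V"
      by (rule bij_betw_byWitness[of _ "?t r"]) (use twist[OF r] in auto)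
    moreover have "?t r \<in> extensional ?V" by (simp add: elementary_twist_def)
    ultimately show ?thesis by (simp add: Bij_def)
  qed
  have inj: "inj_on ?p ?V" using uncrossing.inj_p[OF canonical_uncrossing] .
  have S: "?t ` ?I \<subseteq> carrier ?G" using bij by (auto simp: BijGroup_def)
  have inv: "x \<otimes>\<^bsub>?G\<^esub> x = \<one>\<^bsub>?G\<^esub>" if "x \<in> ?t ` ?I" for x
  proof -
    obtain r where r: "r \<in> ?I" "x = ?t r" using \<open>x \<in> ?t ` ?I\<close> by blast
    have "compose ?V (?t r) (?t r) = (\<lambda>v\<in>?V. v)" using twist[OF r(1)] by (auto simp: compose_def)
    then show ?thesis using r bij by (simp add: BijGroup_def)
  qed
  have comm: "x \<otimes>\<^bsub>?G\<^esub> y = y \<otimes>\<^bsub>?G\<^esub> x" if xy: "x \<in> ?t ` ?I" "y \<in> ?t ` ?I" for x y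
  proof -
    obtain r s where rs: "r \<in> ?I" "x = ?t r" "s \<in> ?I" "y = ?t s" using xy by blast
    have "?t r (?t s v) = ?t s (?t r v)" if v: "v \<in> ?V" for v
    proof (cases "r = s")
      case False
      have "A r (A s z) = A s (A r z)" for z
        unfolding A_def using apart[OF rs(1,3) False] apart[OF rs(3,1)] False by (intro toggle_commute) auto
      \<comment> \<open>The twists inherit commutation from the toggles because distinct elements
        give distinct vertices.\<close>
      then have "?p (?t r (?t s v)) = ?p (?t s (?t r v))" using twist rs v by simp
      then show ?thesis using inj_onD[OF inj] twist rs v by simp
    qed simp
    then have "compose ?V (?t r) (?t s) = compose ?V (?t s) (?t r)" by (auto simp: compose_def)
    then show ?thesis using rs bij by (simp add: mult_BijGroup)
  qed
  have gen: "\<tau> \<in> generate ?G (?t ` ?I)" using \<tau> by (simp add: twist_group_def)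
  have gen_Bij: "g \<in> Bij ?V" if "g \<in> generate ?G (?t ` ?I)" for g
    using generate_in_carrier[OF S that] by (simp add: BijGroup_def)
  have bij_\<tau>: "\<tau> \<in> Bij ?V" by (rule gen_Bij[OF gen])
  then show "\<tau> \<in> ?V \<rightarrow> ?V" by (rule Bij_imp_funcset)
  have "\<tau> \<otimes>\<^bsub>?G\<^esub> \<tau> = \<one>\<^bsub>?G\<^esub>"
    by (rule generate_involution[OF S _ _ gen]) (rule inv comm; assumption)+
  then have \<tau>\<tau>: "compose ?V \<tau> \<tau> = (\<lambda>v\<in>?V. v)" using bij_\<tau> by (simp add: BijGroup_def)
  show "\<tau> (\<tau> v) = v" if "v \<in> ?V" for v
    using fun_cong[OF \<tau>\<tau>, of v] that by (simp add: compose_eq)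
  show "\<exists>B. linear B \<and> (\<forall>v\<in>?V. ?p (\<tau> v) = B (?p v))"
    using gen
  proof (induction rule: generate.induct)
    case one
    then show ?case by (intro exI[of _ "\<lambda>x. x"]) (auto simp: BijGroup_def linear_id[unfolded id_def])
  next
    case (incl h)
    then obtain r where "r \<in> ?I" "h = ?t r" by blast
    then show ?case using twist linear_toggle by (intro exI[of _ "A r"]) (auto simp: A_def)
  next
    case (inv h)
    then obtain r where r: "r \<in> ?I" "h = ?t r" by blast
    have "inv\<^bsub>?G\<^esub> h = h" using inv_equality[of h h] \<open>h \<in> ?t ` ?I\<close> \<open>\<And>x. x \<in> ?t ` ?I \<Longrightarrow> x \<otimes>\<^bsub>?G\<^esub> x = \<one>\<^bsub>?G\<^esub>\<close> S by auto
    then show ?case using r twist linear_toggle by (intro exI[of _ "A r"]) (auto simp: A_def)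
  next
    case (eng g h)
    then obtain B C where BC: "linear B" "\<forall>v\<in>?V. ?p (g v) = B (?p v)"
      "linear C" "\<forall>v\<in>?V. ?p (h v) = C (?p v)" by blast
    have gh: "g \<in> Bij ?V" "h \<in> Bij ?V" using eng gen_Bij by blast+
    then have "h v \<in> ?V" if "v \<in> ?V" for v using that Bij_imp_funcset by blast
    then have "\<forall>v\<in>?V. ?p ((g \<otimes>\<^bsub>?G\<^esub> h) v) = (B \<circ> C) (?p v)"
      using BC gh by (simp add: mult_BijGroup compose_eq)
    then show ?case using linear_compose[OF BC(3,1)] by blast
  qed
qed

theorem theorem5p8:
  fixes w :: snake_word
  assumes "w \<in> snake_words_V"
  shows "regular_triangulation_induced_by (hatP w) (filter_vertex w) (snake_polytope w)
           (canonical_triangulation w) (canonical_height w) \<and>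
         (\<forall>\<tau> \<in> twist_group w.
            regular_triangulation_induced_by (hatP w) (filter_vertex w) (snake_polytope w)
              (twist_triangulation \<tau> (canonical_triangulation w))
              (\<lambda>x. canonical_height w (\<tau> x)))"
proof (intro conjI ballI)
  show "regular_triangulation_induced_by (hatP w) (filter_vertex w) (snake_polytope w)
      (canonical_triangulation w) (canonical_height w)"
    by (rule uncrossing_regular_triangulation[OF canonical_uncrossing])
  fix \<tau> assume \<tau>: "\<tau> \<in> twist_group w"
  obtain B where B: "linear B" "\<And>v. v \<in> hatP w \<Longrightarrow> filter_vertex w (\<tau> v) = B (filter_vertex w v)"
    using twist_group_linear(3)[OF assms \<tau>] by blast
  have "uncrossing (hatP w) (filter_vertex w) (twist_triangulation \<tau> (canonical_triangulation w))
      (\<lambda>x. canonical_height w (\<tau> x))"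
    by (rule uncrossing.uncrossing_involution[OF canonical_uncrossing _ _ B])
      (use twist_group_linear(1,2)[OF assms \<tau>] in auto)
  then show "regular_triangulation_induced_by (hatP w) (filter_vertex w) (snake_polytope w)
      (twist_triangulation \<tau> (canonical_triangulation w)) (\<lambda>x. canonical_height w (\<tau> x))"
    by (rule uncrossing_regular_triangulation)
qed

end
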